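(* Consider the linear system $$(A_t\otimes M_x+M_t\otimes A_x)\,u=F,\qquad A_t,M_t\in\mathbb{R}^{N_t\times N_t},\quad M_x,A_x\in\mathbb{R}^{m\times m},\quad F\in\mathbb{R}^{N_t m},$$ described in the context, and the following algorithm (Bartels-Stewart method with real-Schur decomposition). Step 1: Compute a real-Schur decomposition $A_t^{-1}M_t=QRQ^\top$ with $Q\in\mathbb{R}^{N_t\times N_t}$ orthogonal and $R\in\mathbb{R}^{N_t\times N_t}$ upper quasi-triangular, whose diagonal blocks are $1\times1$ blocks $(\lambda)$ for real eigenvalues $\lambda$ and $2\times 2$ blocks $\begin{pmatrix}\alpha & b_1 \\ b_2 & \alpha\end{pmatrix}$, with $b_1b_2<0$ and $|\beta|=\sqrt{|b_1b_2|}>0$, for conjugate pairs $\alpha\pm\mathrm{i}\beta$. Step 2: Compute $g=(g_1,\dots,g_{N_t})=\mathrm{vec}(\hat F A_t^{-1}Q)$ with $g_k\in\mathbb{R}^m$, where $\hat F\in\mathbb{R}^{m\times N_t}$ satisfies $\mathrm{vec}(\hat F)=F$. Step 3: Start with $k=N_t$; while $k>0$: (i) if $k=1$ or $R[k,k-1]=0$, solve $$(M_x+R[k,k]A_x)z_k=g_k-\sum_{j=k+1}^{N_t}R[k,j]A_xz_j$$ for $z_k\in\mathbb{R}^m$ and replace $k$ by $k-1$; (ii) otherwise, set $\alpha=R[k-1,k-1]$, $b_1=R[k-1,k]$, $b_2=R[k,k-1]$, solve $$\begin{pmatrix}|b_2|(M_x+\alpha A_x)&-b_1|b_2|A_x\\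 |b_1|b_2A_x&-|b_1|(M_x+\alpha A_x)\end{pmatrix}\begin{pmatrix}z_{k-1}\\ -z_k\end{pmatrix}=\begin{pmatrix}|b_2|\bigl(g_{k-1}-\sum_{j=k+1}^{N_t}R[k-1,j]A_xz_j\bigr)\\ |b_1|\bigl(g_k-\sum_{j=k+1}^{N_t}R[k,j]A_xz_j\bigr)\end{pmatrix}$$ for $z_{k-1},z_k\in\mathbb{R}^m$ and replace $k$ by $k-2$. Step 4: Output $u=\mathrm{vec}(ZQ^\top)$, where $Z=(z_1\,|\,\cdots\,|\,z_{N_t})\in\mathbb{R}^{m\times N_t}$. Then the matrix of every linear system in (i) is symmetric positive definite; the matrix of every linear system in (ii) is symmetric, indefinite, and the system is uniquely solvable; and the output $u$ is the solution of the given linear system. Moreover, if solving one spatial linear system of the form (i) or (ii) requires $\mathcal{O}(C_C(m))$ operations and $\mathcal{O}(C_S(m))$ storage, then the overall computational cost and the overall memory consumption of the algorithm are, respectively, $$\mathcal{O}\bigl(N_t^3+m N_t^2+C_C(m)\,N_t\bigr)\qquad\text{and}\qquad\mathcal{O}\bigl(N_t^2+m N_t+C_S(m)\bigr).$$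
   Context: Discrete problem. Let $T>0$ and let $\Omega\subset\mathbb{R}^d$, $d\in\{1,2,3\}$, be a bounded Lipschitz domain (an interval $(0,L)$ if $d=1$, polygonal if $d=2$, polyhedral if $d=3$); $Q_T:=\Omega\times(0,T)$. Let $0=t_0<t_1<\dots<t_{N_t}=T$, and let $\varphi_0,\dots,\varphi_{N_t}$ be the usual nodal hat functions (continuous, piecewise linear) on this time mesh. Let $\{\omega_1,\dots,\omega_{N_x}\}$ be a member of a shape-regular sequence of admissible decompositions of $\Omega$ into intervals ($d=1$), triangles or quadrilaterals ($d=2$), tetrahedra or hexahedra ($d=3$), and let $\psi_1,\dots,\psi_m$ be the nodal basis of the space of continuous piecewise linear (respectively linear/bilinear/trilinear) finite element functions vanishing on $\partial\Omega$. The modified Hilbert transformation $\mathcal{H}_T$ on $L^2(0,T)$ is defined by: if $v(t)=\sum_{k\ge0}v_k\sin\bigl((\tfrac{\pi}{2}+k\pi)\tfrac{t}{T}\bigr)$, then $(\mathcal{H}_Tv)(t)=\sum_{k\ge0}v_k\cos\bigl((\tfrac{\pi}{2}+k\pi)\tfrac{t}{T}\bigr)$. The matrices are $$M_x[i,j]=\langle\psi_j,\psi_i\rangle_{L^2(\Omega)},\quad A_x[i,j]=\langle\nabla\psi_j,\nabla\psi_i\rangle_{L^2(\Omega)}\quad(i,j=1,\dots,m),$$ $$M_t[\ell,k]=\langle\varphi_k,\mathcal{H}_T\varphi_\ell\rangle_{L^2(0,T)},\quad A_t[\ell,k]=\langle\partial_t\varphi_k,\mathcal{H}_T\varphi_\ell\rangle_{L^2(0,T)}\quad(\ell,k=1,\dots,N_t).$$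 Known facts: $M_x,A_x,A_t$ are symmetric positive definite; $M_t$ is nonsymmetric and positive definite, i.e. $x^\top M_tx>0$ for all real $x\neq0$; $M_x,A_x$ are sparse ($\mathcal{O}(m)$ nonzero entries). The right-hand side is $F=\mathrm{vec}(\widetilde F)\in\mathbb{R}^{N_tm}$ with $\widetilde F[i,k]=\langle Q_h^0f,\psi_i\,\mathcal{H}_T\varphi_k\rangle_{L^2(Q_T)}$, $i=1,\dots,m$, $k=1,\dots,N_t$, where $f\in L^2(Q_T)$ and $Q_h^0$ is the $L^2(Q_T)$-orthogonal projection onto functions that are constant on every space-time element $\omega_i\times(t_{\ell-1},t_\ell)$. Conventions. $\otimes$ is the Kronecker product of matrices; $\mathrm{vec}$ stacks the columns of a matrix into one vector. Empty sums are $0$. Computational cost counts arithmetic operations and memory counts stored numbers; the factorization in Step 1 is counted at its standard dense cost of $\mathcal{O}(N_t^3)$ operations and $\mathcal{O}(N_t^2)$ storage, and $A_t$ is applied inversely through a Cholesky factorization. $C_C$ and $C_S$ denote the cost and storage functions of the chosen spatial solver. *)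

theory Defs
  imports
    "HOL-Analysis.Analysis"
    "HOL-Library.Monad_Syntax"
    "Jordan_Normal_Form.Gauss_Jordan_Elimination"
begin

unbundle no vec_syntax
hide_type (open) Finite_Cartesian_Product.vec
hide_const (open) Finite_Cartesian_Product.vec Finite_Cartesian_Product.mat
  Finite_Cartesian_Product.row Finite_Cartesian_Product.column

section \<open>Linear algebra\<close>

definition symmetric_matrix :: "real mat \<Rightarrow> bool" where
  "symmetric_matrix A \<longleftrightarrow> square_mat A \<and> transpose_mat A = A"

text \<open>Positive definiteness does not include symmetry.\<close>

definition positive_definite :: "real mat \<Rightarrow> bool" where
  "positive_definite A \<longleftrightarrow> square_mat A \<and>
     (\<forall>x\<in>carrier_vec (dim_row A). x \<noteq> 0\<^sub>v (dim_row A) \<longrightarrow> 0 < x \<bullet> (A *\<^sub>v x))"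

definition spd :: "real mat \<Rightarrow> bool" where
  "spd A \<longleftrightarrow> symmetric_matrix A \<and> positive_definite A"

definition indefinite :: "real mat \<Rightarrow> bool" where
  "indefinite A \<longleftrightarrow>
     (\<exists>x\<in>carrier_vec (dim_row A). 0 < x \<bullet> (A *\<^sub>v x)) \<and>
     (\<exists>x\<in>carrier_vec (dim_row A). x \<bullet> (A *\<^sub>v x) < 0)"

definition uniquely_solvable :: "real mat \<Rightarrow> bool" where
  "uniquely_solvable A \<longleftrightarrow>
     (\<forall>b\<in>carrier_vec (dim_row A). \<exists>!z. z \<in> carrier_vec (dim_col A) \<and> A *\<^sub>v z = b)"

definition kronecker :: "real mat \<Rightarrow> real mat \<Rightarrow> real mat" (infixl \<open>\<otimes>\<^sub>K\<close> 70) where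
  "A \<otimes>\<^sub>K B = mat (dim_row A * dim_row B) (dim_col A * dim_col B)
     (\<lambda>(i, j). A $$ (i div dim_row B, j div dim_col B) * B $$ (i mod dim_row B, j mod dim_col B))"

definition stack_cols :: "real mat \<Rightarrow> real vec" where
  "stack_cols A = vec (dim_row A * dim_col A) (\<lambda>k. A $$ (k mod dim_row A, k div dim_row A))"

definition unstack_cols :: "nat \<Rightarrow> nat \<Rightarrow> real vec \<Rightarrow> real mat" where
  "unstack_cols nr nc v = mat nr nc (\<lambda>(i, j). v $ (j * nr + i))"

definition nnz :: "real mat \<Rightarrow> nat" where
  "nnz A = card {(i, j). i < dim_row A \<and> j < dim_col A \<and> A $$ (i, j) \<noteq> 0}"

text \<open>The diagonal blocks of a real Schur form have size one or two. A nonzero subdiagonal entry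
  \<open>R $$ (Suc i, i)\<close> marks the block with rows and columns \<open>i\<close>, \<open>Suc i\<close>; blocks do not overlap.\<close>

definition standardized_quasi_triangular :: "real mat \<Rightarrow> bool" where
  "standardized_quasi_triangular R \<longleftrightarrow> square_mat R \<and>
     (\<forall>i j. i < dim_row R \<and> Suc j < i \<longrightarrow> R $$ (i, j) = 0) \<and>
     (\<forall>i. Suc i < dim_row R \<and> R $$ (Suc i, i) \<noteq> 0 \<longrightarrow>
        (Suc (Suc i) < dim_row R \<longrightarrow> R $$ (Suc (Suc i), Suc i) = 0) \<and>
        R $$ (i, i) = R $$ (Suc i, Suc i) \<and> R $$ (i, Suc i) * R $$ (Suc i, i) < 0)"

definition real_schur :: "real mat \<Rightarrow> real mat \<times> real mat \<Rightarrow> bool" where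
  "real_schur A = (\<lambda>(Q, R).
     Q \<in> carrier_mat (dim_row A) (dim_row A) \<and> R \<in> carrier_mat (dim_row A) (dim_row A) \<and>
     inverts_mat Q (transpose_mat Q) \<and> inverts_mat (transpose_mat Q) Q \<and>
     standardized_quasi_triangular R \<and> A = Q * R * transpose_mat Q)"


section \<open>The discrete problem\<close>

definition l2 :: "'b::euclidean_space set \<Rightarrow> ('b \<Rightarrow> real) \<Rightarrow> bool" where
  "l2 S f \<longleftrightarrow> f \<in> borel_measurable (lebesgue_on S) \<and> integrable (lebesgue_on S) (\<lambda>x. (f x)\<^sup>2)"

definition l2_inner :: "'b::euclidean_space set \<Rightarrow> ('b \<Rightarrow> real) \<Rightarrow> ('b \<Rightarrow> real) \<Rightarrow> real" where
  "l2_inner S f g = (LINT x|lebesgue_on S. f x * g x)"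

definition l2_sums ::
    "'b::euclidean_space set \<Rightarrow> (nat \<Rightarrow> 'b \<Rightarrow> real) \<Rightarrow> ('b \<Rightarrow> real) \<Rightarrow> bool" where
  "l2_sums S f u \<longleftrightarrow> l2 S u \<and> (\<forall>k. l2 S (f k)) \<and>
     (\<lambda>n. LINT x|lebesgue_on S. (u x - (\<Sum>k<n. f k x))\<^sup>2) \<longlonglongrightarrow> 0"


subsection \<open>Time discretization\<close>

text \<open>\<open>mod_hilbert T v\<close> is a representative of a class in L2; it only occurs under integrals.\<close>

definition mod_hilbert :: "real \<Rightarrow> (real \<Rightarrow> real) \<Rightarrow> real \<Rightarrow> real" where
  "mod_hilbert T v = (SOME w. \<exists>c :: nat \<Rightarrow> real.
     l2_sums {0<..<T} (\<lambda>k s. c k * sin ((pi / 2 + real k * pi) * (s / T))) v \<and>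
     l2_sums {0<..<T} (\<lambda>k s. c k * cos ((pi / 2 + real k * pi) * (s / T))) w)"

definition time_mesh :: "real \<Rightarrow> nat \<Rightarrow> (nat \<Rightarrow> real) \<Rightarrow> bool" where
  "time_mesh T N t \<longleftrightarrow> 0 < N \<and> t 0 = 0 \<and> t N = T \<and> (\<forall>l<N. t l < t (Suc l))"

definition hat :: "nat \<Rightarrow> (nat \<Rightarrow> real) \<Rightarrow> nat \<Rightarrow> real \<Rightarrow> real" where
  "hat N t k s =
     (if 0 < k \<and> t (k - 1) \<le> s \<and> s \<le> t k then (s - t (k - 1)) / (t k - t (k - 1))
      else if k < N \<and> t k \<le> s \<and> s \<le> t (Suc k) then (t (Suc k) - s) / (t (Suc k) - t k)
      else 0)"

text \<open>Matrix indices start at 0, so row and column \<open>l\<close> belong to the hat function \<open>Suc l\<close>; the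
  hat function 0 is excluded by the initial condition. \<^const>\<open>deriv\<close> is the weak derivative up to
  the finitely many mesh points.\<close>

definition mass_t :: "real \<Rightarrow> nat \<Rightarrow> (nat \<Rightarrow> real) \<Rightarrow> real mat" where
  "mass_t T N t = mat N N (\<lambda>(l, k).
     l2_inner {0<..<T} (hat N t (Suc k)) (mod_hilbert T (hat N t (Suc l))))"

definition stiff_t :: "real \<Rightarrow> nat \<Rightarrow> (nat \<Rightarrow> real) \<Rightarrow> real mat" where
  "stiff_t T N t = mat N N (\<lambda>(l, k).
     l2_inner {0<..<T} (deriv (hat N t (Suc k))) (mod_hilbert T (hat N t (Suc l))))"

definition inv_stiff_mass_t :: "real \<Rightarrow> nat \<Rightarrow> (nat \<Rightarrow> real) \<Rightarrow> real mat" where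
  "inv_stiff_mass_t T N t = the (mat_inverse (stiff_t T N t)) * mass_t T N t"


subsection \<open>Spatial domain and finite elements\<close>

definition lipschitz_domain :: "'a::euclidean_space set \<Rightarrow> bool" where
  "lipschitz_domain \<Omega> \<longleftrightarrow> \<Omega> \<noteq> {} \<and> open \<Omega> \<and> connected \<Omega> \<and> bounded \<Omega> \<and>
     (\<forall>x\<in>frontier \<Omega>. \<exists>\<nu> \<gamma> C U. norm \<nu> = 1 \<and> open U \<and> x \<in> U \<and>
        C-lipschitz_on {y. inner y \<nu> = 0} \<gamma> \<and>
        \<Omega> \<inter> U = {y \<in> U. \<gamma> (y - inner y \<nu> *\<^sub>R \<nu>) < inner y \<nu>})"

definition admissible_domain :: "'a::euclidean_space set \<Rightarrow> bool" where
  "admissible_domain \<Omega> \<longleftrightarrow> DIM('a) \<in> {1, 2, 3} \<and> lipschitz_domain \<Omega> \<and>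
     (DIM('a) = 1 \<longrightarrow> (\<exists>L>0. \<Omega> = box 0 (L *\<^sub>R One))) \<and>
     (\<exists>\<P>. finite \<P> \<and> (\<forall>P\<in>\<P>. polytope P) \<and> closure \<Omega> = \<Union>\<P>)"

text \<open>An element is the image of a reference cell under a map whose components are shape functions
  of that cell. This gives intervals, triangles and tetrahedra for the simplex, and intervals,
  quadrilaterals and hexahedra with bilinear and trilinear maps for the cube.\<close>

datatype cell = SimplexCell | CubeCell

type_synonym 'a element = "cell \<times> ('a \<Rightarrow> 'a)"

fun reference :: "cell \<Rightarrow> 'a::euclidean_space set" where
  "reference SimplexCell = convex hull (insert 0 Basis)"
| "reference CubeCell = cbox 0 One"

fun shape_functions :: "cell \<Rightarrow> ('a::euclidean_space \<Rightarrow> real) set" where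
  "shape_functions SimplexCell = {p. \<exists>c a. \<forall>x. p x = c + inner a x}"
| "shape_functions CubeCell =
     {p. \<exists>c :: 'a set \<Rightarrow> real. \<forall>x. p x = (\<Sum>B\<in>Pow Basis. c B * (\<Prod>b\<in>B. inner x b))}"

fun is_element :: "'a::euclidean_space element \<Rightarrow> bool" where
  "is_element (s, G) \<longleftrightarrow>
     (\<forall>b\<in>Basis. (\<lambda>x. inner (G x) b) \<in> shape_functions s) \<and> inj_on G (reference s)"

fun region :: "'a::euclidean_space element \<Rightarrow> 'a set" where
  "region (s, G) = G ` reference s"

fun element_vertices :: "'a::euclidean_space element \<Rightarrow> 'a set" where
  "element_vertices (s, G) = G ` {x. x extreme_point_of reference s}"

text \<open>Two different elements meet in a common proper face, possibly empty.\<close>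

fun conforming :: "'a::euclidean_space element \<Rightarrow> 'a element \<Rightarrow> bool" where
  "conforming (s, G) (s', G') \<longleftrightarrow>
     (\<exists>f f'. f face_of reference s \<and> f \<noteq> reference s \<and>
        f' face_of reference s' \<and> f' \<noteq> reference s' \<and>
        G ` reference s \<inter> G' ` reference s' = G ` f \<and> G ` f = G' ` f' \<and>
        G ` {x. x extreme_point_of f} = G' ` {x. x extreme_point_of f'})"

definition admissible_decomposition :: "'a::euclidean_space set \<Rightarrow> 'a element list \<Rightarrow> bool" where
  "admissible_decomposition \<Omega> \<omega> \<longleftrightarrow> (\<forall>e\<in>set \<omega>. is_element e) \<and>
     closure \<Omega> = (\<Union>e\<in>set \<omega>. region e) \<and>
     (\<forall>i<length \<omega>. \<forall>j<length \<omega>. i \<noteq> j \<longrightarrow> conforming (\<omega> ! i) (\<omega> ! j))"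

text \<open>Shape regularity: relative to the diameter, the element maps are bi-Lipschitz with uniform
  constants. For simplices this is equivalent to a uniform bound on the ratio of diameter and
  inball diameter.\<close>

definition shape_regular_sequence ::
    "'a::euclidean_space set \<Rightarrow> (nat \<Rightarrow> 'a element list) \<Rightarrow> bool" where
  "shape_regular_sequence \<Omega> \<omega> \<longleftrightarrow> (\<forall>\<nu>. admissible_decomposition \<Omega> (\<omega> \<nu>)) \<and>
     (\<exists>\<sigma>>0. \<forall>\<nu>. \<forall>(s, G)\<in>set (\<omega> \<nu>). \<forall>x\<in>reference s. \<forall>y\<in>reference s.
        diameter (region (s, G)) * dist x y \<le> \<sigma> * dist (G x) (G y) \<and>
        dist (G x) (G y) \<le> \<sigma> * (diameter (region (s, G)) * dist x y))"

definition fe_space :: "'a::euclidean_space set \<Rightarrow> 'a element list \<Rightarrow> ('a \<Rightarrow> real) set" where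
  "fe_space \<Omega> \<omega> = {u. continuous_on (closure \<Omega>) u \<and> (\<forall>x\<in>frontier \<Omega>. u x = 0) \<and>
     (\<forall>(s, G)\<in>set \<omega>. \<exists>p\<in>shape_functions s. \<forall>x\<in>reference s. u (G x) = p x)}"

text \<open>The nodes are the mesh vertices inside the open set \<open>\<Omega>\<close>.\<close>

definition nodal_basis ::
    "'a::euclidean_space set \<Rightarrow> 'a element list \<Rightarrow> nat \<Rightarrow> (nat \<Rightarrow> 'a \<Rightarrow> real) \<Rightarrow> bool" where
  "nodal_basis \<Omega> \<omega> m \<psi> \<longleftrightarrow> 0 < m \<and>
     (\<exists>node. bij_betw node {..<m} ((\<Union>e\<in>set \<omega>. element_vertices e) \<inter> \<Omega>) \<and>
        (\<forall>i<m. \<psi> i \<in> fe_space \<Omega> \<omega> \<and> (\<forall>j<m. \<psi> i (node j) = (if i = j then 1 else 0))))"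

definition gradient :: "('a::euclidean_space \<Rightarrow> real) \<Rightarrow> 'a \<Rightarrow> 'a" where
  "gradient u x = (SOME D. GDERIV u x :> D)"

definition mass_x ::
    "'a::euclidean_space set \<Rightarrow> nat \<Rightarrow> (nat \<Rightarrow> 'a \<Rightarrow> real) \<Rightarrow> real mat" where
  "mass_x \<Omega> m \<psi> = mat m m (\<lambda>(i, j). l2_inner \<Omega> (\<psi> j) (\<psi> i))"

definition stiff_x ::
    "'a::euclidean_space set \<Rightarrow> nat \<Rightarrow> (nat \<Rightarrow> 'a \<Rightarrow> real) \<Rightarrow> real mat" where
  "stiff_x \<Omega> m \<psi> = mat m m (\<lambda>(i, j).
     LINT x|lebesgue_on \<Omega>. inner (gradient (\<psi> j) x) (gradient (\<psi> i) x))"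


subsection \<open>Right-hand side\<close>

definition piecewise_constant ::
    "'a::euclidean_space set \<Rightarrow> 'a element list \<Rightarrow> real \<Rightarrow> nat \<Rightarrow> (nat \<Rightarrow> real) \<Rightarrow>
      ('a \<times> real \<Rightarrow> real) set" where
  "piecewise_constant \<Omega> \<omega> T N t = {g. l2 (\<Omega> \<times> {0<..<T}) g \<and>
     (\<forall>e\<in>set \<omega>. \<forall>l<N. \<exists>c. \<forall>x\<in>interior (region e). \<forall>s\<in>{t l<..<t (Suc l)}. g (x, s) = c)}"

definition l2_projection ::
    "'a::euclidean_space set \<Rightarrow> 'a element list \<Rightarrow> real \<Rightarrow> nat \<Rightarrow> (nat \<Rightarrow> real) \<Rightarrow>
      ('a \<times> real \<Rightarrow> real) \<Rightarrow> 'a \<times> real \<Rightarrow> real" where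
  "l2_projection \<Omega> \<omega> T N t f = (SOME g. g \<in> piecewise_constant \<Omega> \<omega> T N t \<and>
     (\<forall>w\<in>piecewise_constant \<Omega> \<omega> T N t. l2_inner (\<Omega> \<times> {0<..<T}) (\<lambda>z. f z - g z) w = 0))"

definition rhs_vec ::
    "'a::euclidean_space set \<Rightarrow> 'a element list \<Rightarrow> nat \<Rightarrow> (nat \<Rightarrow> 'a \<Rightarrow> real) \<Rightarrow>
      real \<Rightarrow> nat \<Rightarrow> (nat \<Rightarrow> real) \<Rightarrow> ('a \<times> real \<Rightarrow> real) \<Rightarrow> real vec" where
  "rhs_vec \<Omega> \<omega> m \<psi> T N t f = stack_cols (mat m N (\<lambda>(i, k).
     l2_inner (\<Omega> \<times> {0<..<T}) (l2_projection \<Omega> \<omega> T N t f)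
       (\<lambda>(x, s). \<psi> i x * mod_hilbert T (hat N t (Suc k)) s)))"


section \<open>Cost model\<close>

text \<open>A computation has a value, a number of arithmetic operations (\<open>+\<close>, \<open>-\<close>, \<open>*\<close>, \<open>/\<close>, negation,
  absolute value and square root of reals) and the peak number of stored numbers, its result
  included and its inputs excluded. Copying, indexing and branching are not arithmetic operations.
  A sparse matrix stores value, row and column of each nonzero entry.\<close>

datatype 'a comp = Comp (val: 'a) (ops: nat) (mem: nat)

class stored =
  fixes cells :: "'a \<Rightarrow> nat"

datatype sparse = Sparse "real mat"

instantiation real :: stored begin
definition cells_real :: "real \<Rightarrow> nat" where "cells_real x = 1"
instance ..
end

instantiation vec :: (type) stored begin
definition cells_vec :: "'a vec \<Rightarrow> nat" where "cells_vec v = dim_vec v"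
instance ..
end

instantiation mat :: (type) stored begin
definition cells_mat :: "'a mat \<Rightarrow> nat" where "cells_mat A = dim_row A * dim_col A"
instance ..
end

instantiation prod :: (stored, stored) stored begin
definition cells_prod :: "'a \<times> 'b \<Rightarrow> nat" where "cells_prod p = cells (fst p) + cells (snd p)"
instance ..
end

instantiation sparse :: stored begin
fun cells_sparse :: "sparse \<Rightarrow> nat" where "cells_sparse (Sparse A) = 3 * nnz A"
instance ..
end

definition ret :: "'a::stored \<Rightarrow> 'a comp" where
  "ret x = Comp x 0 (cells x)"

text \<open>A bound value stays in memory until the end of its scope.\<close>

definition bind :: "'a::stored comp \<Rightarrow> ('a \<Rightarrow> 'b comp) \<Rightarrow> 'b comp" where
  "bind c f = (let r = f (val c) in
     Comp (val r) (ops c + ops r) (max (mem c) (cells (val c) + mem r)))"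

adhoc_overloading Monad_Syntax.bind \<rightleftharpoons> bind

text \<open>\<open>replace s c f\<close>: the state \<open>s\<close> is kept during \<open>c\<close> and then overwritten by its result.\<close>

definition replace :: "'s::stored \<Rightarrow> 's comp \<Rightarrow> ('s \<Rightarrow> 's comp) \<Rightarrow> 's comp" where
  "replace s c f = (let r = f (val c) in
     Comp (val r) (ops c + ops r) (max (cells s + mem c) (mem r)))"

fun for_each :: "nat list \<Rightarrow> (nat \<Rightarrow> 's \<Rightarrow> 's comp) \<Rightarrow> 's::stored \<Rightarrow> 's comp" where
  "for_each [] f s = ret s"
| "for_each (i # is) f s = replace s (f i s) (for_each is f)"

definition add_op :: "real \<Rightarrow> real \<Rightarrow> real comp" where "add_op x y = Comp (x + y) 1 1"
definition sub_op :: "real \<Rightarrow> real \<Rightarrow> real comp" where "sub_op x y = Comp (x - y) 1 1"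
definition mul_op :: "real \<Rightarrow> real \<Rightarrow> real comp" where "mul_op x y = Comp (x * y) 1 1"
definition div_op :: "real \<Rightarrow> real \<Rightarrow> real comp" where "div_op x y = Comp (x / y) 1 1"
definition neg_op :: "real \<Rightarrow> real comp" where "neg_op x = Comp (- x) 1 1"
definition abs_op :: "real \<Rightarrow> real comp" where "abs_op x = Comp \<bar>x\<bar> 1 1"
definition sqrt_op :: "real \<Rightarrow> real comp" where "sqrt_op x = Comp (sqrt x) 1 1"

definition peak :: "'i set \<Rightarrow> ('i \<Rightarrow> 'a comp) \<Rightarrow> nat" where
  "peak I f = Max (insert 0 ((\<lambda>i. mem (f i)) ` I))"

definition build_vec :: "nat \<Rightarrow> (nat \<Rightarrow> real comp) \<Rightarrow> real vec comp" where
  "build_vec n f = Comp (vec n (\<lambda>i. val (f i))) (\<Sum>i<n. ops (f i)) (n + peak {..<n} f)"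

definition build_cols :: "nat \<Rightarrow> nat \<Rightarrow> (nat \<Rightarrow> real vec comp) \<Rightarrow> real mat comp" where
  "build_cols nr nc f = Comp (mat nr nc (\<lambda>(i, j). val (f j) $ i)) (\<Sum>j<nc. ops (f j))
     (nr * nc + peak {..<nc} f)"

text \<open>\<open>P\<close> lists the positions that are computed and stored; all other entries are zero.\<close>

definition build_sparse ::
    "nat \<Rightarrow> nat \<Rightarrow> (nat \<times> nat) list \<Rightarrow> (nat \<times> nat \<Rightarrow> real comp) \<Rightarrow> sparse comp" where
  "build_sparse nr nc P f =
     Comp (Sparse (mat nr nc (\<lambda>p. if p \<in> set P then val (f p) else 0)))
       (\<Sum>p\<leftarrow>P. ops (f p)) (3 * length P + peak (set P) f)"

definition sum_up :: "nat list \<Rightarrow> (nat \<Rightarrow> real comp) \<Rightarrow> real comp" where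
  "sum_up is f = Comp (\<Sum>i\<leftarrow>is. val (f i)) (\<Sum>i\<leftarrow>is. ops (f i) + 1) (1 + peak (set is) f)"


section \<open>The Bartels-Stewart algorithm\<close>

definition set_entry :: "real vec \<Rightarrow> nat \<Rightarrow> real \<Rightarrow> real vec" where
  "set_entry v i x = vec (dim_vec v) (\<lambda>j. if j = i then x else v $ j)"

definition set_col :: "real mat \<Rightarrow> nat \<Rightarrow> real vec \<Rightarrow> real mat" where
  "set_col A k v = mat (dim_row A) (dim_col A) (\<lambda>(i, j). if j = k then v $ i else A $$ (i, j))"

definition cholesky :: "real mat \<Rightarrow> real mat comp" where
  "cholesky A = (let n = dim_row A in
     for_each [0..<n] (\<lambda>j L. do {
       s \<leftarrow> sum_up [0..<j] (\<lambda>k. mul_op (L $$ (j, k)) (L $$ (j, k)));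
       d \<leftarrow> sub_op (A $$ (j, j)) s;
       p \<leftarrow> sqrt_op d;
       c \<leftarrow> build_vec n (\<lambda>i.
         if i < j then ret 0
         else if i = j then ret p
         else do {
           s' \<leftarrow> sum_up [0..<j] (\<lambda>k. mul_op (L $$ (i, k)) (L $$ (j, k)));
           d' \<leftarrow> sub_op (A $$ (i, j)) s';
           div_op d' p
         });
       ret (set_col L j c)
     }) (0\<^sub>m n n))"

text \<open>Solution of \<open>L * transpose_mat L *\<^sub>v x = b\<close> for lower triangular \<open>L\<close>.\<close>

definition cholesky_solve :: "real mat \<Rightarrow> real vec \<Rightarrow> real vec comp" where
  "cholesky_solve L b = (let n = dim_row L in do {
     y \<leftarrow> for_each [0..<n] (\<lambda>i y. do {
       s \<leftarrow> sum_up [0..<i] (\<lambda>j. mul_op (L $$ (i, j)) (y $ j));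
       d \<leftarrow> sub_op (b $ i) s;
       q \<leftarrow> div_op d (L $$ (i, i));
       ret (set_entry y i q)
     }) (0\<^sub>v n);
     for_each (rev [0..<n]) (\<lambda>i x. do {
       s \<leftarrow> sum_up [Suc i..<n] (\<lambda>j. mul_op (L $$ (j, i)) (x $ j));
       d \<leftarrow> sub_op (y $ i) s;
       q \<leftarrow> div_op d (L $$ (i, i));
       ret (set_entry x i q)
     }) (0\<^sub>v n)
   })"

definition mat_mult :: "real mat \<Rightarrow> real mat \<Rightarrow> real mat comp" where
  "mat_mult A B = build_cols (dim_row A) (dim_col B) (\<lambda>j. build_vec (dim_row A) (\<lambda>i.
     sum_up [0..<dim_col A] (\<lambda>k. mul_op (A $$ (i, k)) (B $$ (k, j)))))"

fun sparse_mult_vec :: "sparse \<Rightarrow> real vec \<Rightarrow> real vec comp" where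
  "sparse_mult_vec (Sparse A) x = build_vec (dim_row A) (\<lambda>i.
     sum_up (filter (\<lambda>j. A $$ (i, j) \<noteq> 0) [0..<dim_col A]) (\<lambda>j. mul_op (A $$ (i, j)) (x $ j)))"

text \<open>In the code and in the statement, \<open>k\<close> is the index of a row of \<open>R\<close> counted from 0.\<close>

definition starts_single :: "real mat \<Rightarrow> nat \<Rightarrow> bool" where
  "starts_single R k \<longleftrightarrow> k = 0 \<or> R $$ (k, k - 1) = 0"

definition system_i :: "real mat \<Rightarrow> real mat \<Rightarrow> real mat \<Rightarrow> nat \<Rightarrow> real mat" where
  "system_i M A R k = M + R $$ (k, k) \<cdot>\<^sub>m A"

definition system_ii :: "real mat \<Rightarrow> real mat \<Rightarrow> real mat \<Rightarrow> nat \<Rightarrow> real mat" where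
  "system_ii M A R k = (let \<alpha> = R $$ (k - 1, k - 1); b1 = R $$ (k - 1, k); b2 = R $$ (k, k - 1) in
     four_block_mat
       (\<bar>b2\<bar> \<cdot>\<^sub>m (M + \<alpha> \<cdot>\<^sub>m A)) ((- b1 * \<bar>b2\<bar>) \<cdot>\<^sub>m A)
       ((\<bar>b1\<bar> * b2) \<cdot>\<^sub>m A)        ((- \<bar>b1\<bar>) \<cdot>\<^sub>m (M + \<alpha> \<cdot>\<^sub>m A)))"

text \<open>\<open>visited R v\<close>: the back substitution loop, started at the size of \<open>R\<close>, reaches the
  value \<open>v\<close> of its variable, the number of unknown columns left; the next row index is \<open>v - 1\<close>.\<close>

inductive visited :: "real mat \<Rightarrow> nat \<Rightarrow> bool" for R where
  start: "visited R (dim_row R)"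
| single: "visited R (Suc k) \<Longrightarrow> starts_single R k \<Longrightarrow> visited R k"
| double: "visited R (Suc k) \<Longrightarrow> \<not> starts_single R k \<Longrightarrow> visited R (k - 1)"

definition systems_i :: "real mat \<Rightarrow> real mat \<Rightarrow> real mat \<Rightarrow> real mat set" where
  "systems_i M A R = {system_i M A R k | k. visited R (Suc k) \<and> starts_single R k}"

definition systems_ii :: "real mat \<Rightarrow> real mat \<Rightarrow> real mat \<Rightarrow> real mat set" where
  "systems_ii M A R = {system_ii M A R k | k. visited R (Suc k) \<and> \<not> starts_single R k}"

definition joint_pattern :: "real mat \<Rightarrow> real mat \<Rightarrow> (nat \<times> nat) list" where
  "joint_pattern M A = filter (\<lambda>p. M $$ p \<noteq> 0 \<or> A $$ p \<noteq> 0)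
     (List.product [0..<dim_row M] [0..<dim_col M])"

fun assemble_i :: "sparse \<Rightarrow> sparse \<Rightarrow> real mat \<Rightarrow> nat \<Rightarrow> sparse comp" where
  "assemble_i (Sparse M) (Sparse A) R k =
     build_sparse (dim_row M) (dim_col M) (joint_pattern M A) (\<lambda>p. do {
       a \<leftarrow> mul_op (R $$ (k, k)) (A $$ p);
       add_op (M $$ p) a
     })"

fun assemble_ii :: "sparse \<Rightarrow> sparse \<Rightarrow> real mat \<Rightarrow> nat \<Rightarrow> sparse comp" where
  "assemble_ii (Sparse M) (Sparse A) R k =
     (let m = dim_row M; \<alpha> = R $$ (k - 1, k - 1); b1 = R $$ (k - 1, k); b2 = R $$ (k, k - 1)
      in do {
        c1 \<leftarrow> abs_op b1;
        c2 \<leftarrow> abs_op b2;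
        build_sparse (2 * m) (2 * m)
          (concat (map (\<lambda>(i, j). [(i, j), (i, j + m), (i + m, j), (i + m, j + m)])
            (joint_pattern M A)))
          (\<lambda>(i, j).
            if i < m \<and> j < m then do {
              a \<leftarrow> mul_op \<alpha> (A $$ (i, j));
              s \<leftarrow> add_op (M $$ (i, j)) a;
              mul_op c2 s
            } else if i < m then do {
              b \<leftarrow> neg_op b1;
              c \<leftarrow> mul_op b c2;
              mul_op c (A $$ (i, j - m))
            } else if j < m then do {
              c \<leftarrow> mul_op c1 b2;
              mul_op c (A $$ (i - m, j))
            } else do {
              a \<leftarrow> mul_op \<alpha> (A $$ (i - m, j - m));
              s \<leftarrow> add_op (M $$ (i - m, j - m)) a;
              c \<leftarrow> neg_op c1;
              mul_op c s
            })
      })"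

text \<open>\<open>reduced_rhs A R G Z k l\<close> subtracts from column \<open>k\<close> of \<open>G\<close> the contributions of the columns
  \<open>l, l + 1, ...\<close> of \<open>Z\<close>.\<close>

definition reduced_rhs ::
    "sparse \<Rightarrow> real mat \<Rightarrow> real mat \<Rightarrow> real mat \<Rightarrow> nat \<Rightarrow> nat \<Rightarrow> real vec comp" where
  "reduced_rhs A R G Z k l = for_each [l..<dim_col R] (\<lambda>j r. do {
     w \<leftarrow> sparse_mult_vec A (col Z j);
     build_vec (dim_vec r) (\<lambda>i. do {
       p \<leftarrow> mul_op (R $$ (k, j)) (w $ i);
       sub_op (r $ i) p
     })
   }) (col G k)"

type_synonym spatial_solver = "sparse \<Rightarrow> real vec \<Rightarrow> real vec comp"

definition step_i :: "spatial_solver \<Rightarrow> sparse \<Rightarrow> sparse \<Rightarrow> real mat \<Rightarrow> real mat \<Rightarrow>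
    nat \<Rightarrow> real mat \<Rightarrow> real mat comp" where
  "step_i solve M A R G k Z = do {
     b \<leftarrow> reduced_rhs A R G Z k (Suc k);
     S \<leftarrow> assemble_i M A R k;
     z \<leftarrow> solve S b;
     ret (set_col Z k z)
   }"

definition step_ii :: "spatial_solver \<Rightarrow> sparse \<Rightarrow> sparse \<Rightarrow> real mat \<Rightarrow> real mat \<Rightarrow>
    nat \<Rightarrow> real mat \<Rightarrow> real mat comp" where
  "step_ii solve M A R G k Z = (let m = dim_row G in do {
     r1 \<leftarrow> reduced_rhs A R G Z (k - 1) (Suc k);
     r2 \<leftarrow> reduced_rhs A R G Z k (Suc k);
     c1 \<leftarrow> abs_op (R $$ (k - 1, k));
     c2 \<leftarrow> abs_op (R $$ (k, k - 1));
     b \<leftarrow> build_vec (2 * m) (\<lambda>i. if i < m then mul_op c2 (r1 $ i) else mul_op c1 (r2 $ (i - m)));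
     S \<leftarrow> assemble_ii M A R k;
     y \<leftarrow> solve S b;
     z \<leftarrow> build_vec m (\<lambda>i. neg_op (y $ (i + m)));
     ret (set_col (set_col Z (k - 1) (vec_first y m)) k z)
   })"

fun back_substitution :: "spatial_solver \<Rightarrow> sparse \<Rightarrow> sparse \<Rightarrow> real mat \<Rightarrow> real mat \<Rightarrow>
    nat \<Rightarrow> real mat \<Rightarrow> real mat comp" where
  "back_substitution solve M A R G 0 Z = ret Z"
| "back_substitution solve M A R G (Suc k) Z =
     (if starts_single R k
      then replace Z (step_i solve M A R G k Z) (back_substitution solve M A R G k)
      else replace Z (step_ii solve M A R G k Z) (back_substitution solve M A R G (k - 1)))"

text \<open>By symmetry of \<open>At\<close>, the rows of \<open>Fh\<close> times the inverse of \<open>At\<close> are Cholesky solutions.\<close>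

definition bartels_stewart :: "(real mat \<Rightarrow> (real mat \<times> real mat) comp) \<Rightarrow> spatial_solver \<Rightarrow>
    real mat \<Rightarrow> real mat \<Rightarrow> nat \<Rightarrow> sparse \<Rightarrow> sparse \<Rightarrow> real vec \<Rightarrow> real vec comp" where
  "bartels_stewart schur solve At Mt m Mx Ax F = (let n = dim_row At in do {
     L \<leftarrow> cholesky At;
     X \<leftarrow> build_cols n n (\<lambda>j. cholesky_solve L (col Mt j));
     (Q, R) \<leftarrow> schur X;
     Fh \<leftarrow> ret (unstack_cols m n F);
     Y \<leftarrow> build_cols n m (\<lambda>i. cholesky_solve L (row Fh i));
     G \<leftarrow> mat_mult (transpose_mat Y) Q;
     Z \<leftarrow> back_substitution solve Mx Ax R G n (0\<^sub>m m n);
     U \<leftarrow> mat_mult Z (transpose_mat Q);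
     ret (stack_cols U)
   })"

text \<open>Memory consumption includes the input data.\<close>

definition bartels_stewart_memory :: "(real mat \<Rightarrow> (real mat \<times> real mat) comp) \<Rightarrow>
    spatial_solver \<Rightarrow> real mat \<Rightarrow> real mat \<Rightarrow> nat \<Rightarrow> sparse \<Rightarrow> sparse \<Rightarrow> real vec \<Rightarrow> nat" where
  "bartels_stewart_memory schur solve At Mt m Mx Ax F =
     cells At + cells Mt + cells Mx + cells Ax + cells F +
     mem (bartels_stewart schur solve At Mt m Mx Ax F)"

end

theory Submission
  imports Defs "Jordan_Normal_Form.Determinant"
begin

text \<open>Write \<open>S = transpose_mat Q * At * Q\<close>. From \<open>At * Q * R = Mt * Q\<close> one gets
  \<open>S * R = transpose_mat Q * Mt * Q\<close>, so both \<open>S\<close> and \<open>S * R\<close> are positive definite. Testing with vectors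
  that are \<open>S\<close>-orthogonal to the coordinates in front of a diagonal block shows that the diagonal
  entry of every \<open>1 \<times> 1\<close> and \<open>2 \<times> 2\<close> block is positive. Hence \<open>Mx + \<alpha> Ax\<close> is positive definite, and the
  coupled matrix of a \<open>2 \<times> 2\<close> block is injective by testing with \<open>(x, - y)\<close>.

  With \<open>U = Z * transpose_mat Q\<close> the linear system reads \<open>Mx * Z + Ax * Z * transpose_mat R = G\<close>, which
  back substitution solves column by column. Since this works for every right-hand side, the Kronecker
  matrix is surjective, hence regular, and the solution is unique. The Cholesky pivots are positive
  because Schur complements of positive definite matrices are positive definite.\<close>

section \<open>Computations\<close>

text \<open>Over the complex numbers, comparing the forms of \<open>At\<close> and \<open>Mt\<close>
  on an eigenvector gives positive real parts at once. Here everything stays real: the coordinates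
  in front of a block span an \<open>R\<close>-invariant subspace, and
  \<open>S\<close>-orthogonality to it replaces passing to the quotient. In a 2x2 block the
  off-diagonal entries disturb the two diagonal terms; weights \<open>|b1|\<close> and
  \<open>|b2|\<close> remove the disturbance because \<open>b1\<close> and \<open>b2\<close> have
  opposite signs. The same weights symmetrize the coupled spatial system. The spatial solver is only
  known to be right on uniquely solvable matrices met by the loop, so solvability of each system has
  to be known before the value of the algorithm is. Costs in turn depend on values: storage counts
  the dimensions of intermediate results, and the path of the loop depends on \<open>R\<close>.
  Explicit natural-number bounds therefore come after correctness. Their lower-order terms are
  absorbed using that \<open>n\<close> and \<open>m\<close> are at least 1, and their constants do
  not depend on the meshes.\<close>

lemma comp_sel_ret [simp]:
  "val (ret x) = x" "ops (ret x) = 0" "mem (ret x) = cells x"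
  by (simp_all add: ret_def)

lemma comp_sel_bind [simp]:
  "val (bind c f) = val (f (val c))"
  "ops (bind c f) = ops c + ops (f (val c))"
  "mem (bind c f) = max (mem c) (cells (val c) + mem (f (val c)))"
  by (simp_all add: bind_def Let_def)

lemma comp_sel_replace [simp]:
  "val (replace s c f) = val (f (val c))"
  "ops (replace s c f) = ops c + ops (f (val c))"
  "mem (replace s c f) = max (cells s + mem c) (mem (f (val c)))"
  by (simp_all add: replace_def Let_def)

lemmas arith_op_defs = add_op_def sub_op_def mul_op_def div_op_def neg_op_def abs_op_def sqrt_op_def

lemma peak_le:
  assumes "finite I" "\<And>i. i \<in> I \<Longrightarrow> mem (f i) \<le> c"
  shows "peak I f \<le> c"
  using assms by (auto simp: peak_def)

lemma sum_ops_le: "(\<And>i. i < n \<Longrightarrow> ops (f i) \<le> c) \<Longrightarrow> (\<Sum>i<n. ops (f i)) \<le> n * c"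
  using sum_bounded_above[of "{..<n}" "\<lambda>i. ops (f i)" c] by simp

lemma val_build_vec [simp]: "val (build_vec n f) = vec n (\<lambda>i. val (f i))"
  by (simp add: build_vec_def)

lemma ops_build_vec_le: "(\<And>i. i < n \<Longrightarrow> ops (f i) \<le> c) \<Longrightarrow> ops (build_vec n f) \<le> n * c"
  by (simp add: build_vec_def sum_ops_le)

lemma mem_build_vec_le: "(\<And>i. i < n \<Longrightarrow> mem (f i) \<le> c) \<Longrightarrow> mem (build_vec n f) \<le> n + c"
  by (auto simp: build_vec_def intro!: peak_le)

lemma val_build_cols [simp]: "val (build_cols nr nc g) = mat nr nc (\<lambda>(i, j). val (g j) $ i)"
  by (simp add: build_cols_def)

lemma ops_build_cols_le: "(\<And>j. j < nc \<Longrightarrow> ops (g j) \<le> c) \<Longrightarrow> ops (build_cols nr nc g) \<le> nc * c"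
  using sum_bounded_above[of "{..<nc}" "\<lambda>i. ops (g i)" c] by (simp add: build_cols_def)

lemma mem_build_cols_le: "(\<And>j. j < nc \<Longrightarrow> mem (g j) \<le> c) \<Longrightarrow> mem (build_cols nr nc g) \<le> nr * nc + c"
  by (auto simp: build_cols_def intro!: peak_le)

lemma val_build_sparse [simp]:
  "val (build_sparse nr nc P f) = Sparse (mat nr nc (\<lambda>p. if p \<in> set P then val (f p) else 0))"
  by (simp add: build_sparse_def)

lemma ops_build_sparse_le: "(\<And>p. p \<in> set P \<Longrightarrow> ops (f p) \<le> c) \<Longrightarrow> ops (build_sparse nr nc P f) \<le> length P * c"
  using sum_list_mono[of P "\<lambda>p. ops (f p)" "\<lambda>_. c"] by (simp add: build_sparse_def sum_list_triv)

lemma mem_build_sparse_le: "(\<And>p. p \<in> set P \<Longrightarrow> mem (f p) \<le> c) \<Longrightarrow> mem (build_sparse nr nc P f) \<le> 3 * length P + c"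
  by (auto simp: build_sparse_def intro!: peak_le)

lemma val_sum_up [simp]: "val (sum_up is f) = (\<Sum>i\<leftarrow>is. val (f i))"
  by (simp add: sum_up_def)

text \<open>Each term pays one multiplication and one addition to the accumulator. Besides the
  accumulator only the current product is stored, whatever the length of the list.\<close>

lemma cost_sum_up_mul:
  "ops (sum_up is (\<lambda>k. mul_op (f k) (g k))) = 2 * length is"
  "mem (sum_up is (\<lambda>k. mul_op (f k) (g k))) \<le> 2"
  using peak_le[of "set is" "\<lambda>k. mul_op (f k) (g k)" 1]
  by (simp_all add: sum_up_def mul_op_def sum_list_triv)

lemma val_for_each: "val (for_each is f s) = fold (\<lambda>i s. val (f i s)) is s"
  by (induction "is" arbitrary: s) auto

lemma fold_upt_invariant:
  assumes "a \<le> b" "I a s" "\<And>i s. \<lbrakk>a \<le> i; i < b; I i s\<rbrakk> \<Longrightarrow> I (Suc i) (f i s)"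
  shows "I b (fold f [a..<b] s)"
  using assms
proof (induction b rule: dec_induct)
  case (step b)
  then show ?case by simp
qed simp

text \<open>Serves downward sweeps: \<open>I i\<close> describes the state in which the indices from
  \<open>i\<close> on have been treated, so treating \<open>i\<close> leads from
  \<open>I (Suc i)\<close> to \<open>I i\<close>.\<close>

lemma fold_rev_upt_invariant:
  assumes "I n s" "\<And>i s. \<lbrakk>i < n; I (Suc i) s\<rbrakk> \<Longrightarrow> I i (f i s)"
  shows "I 0 (fold f (rev [0..<n]) s)"
  using assms by (induction n arbitrary: s) auto

text \<open>\<open>P\<close> carries facts about the state, such as its dimension, on which the cost
  of a single pass depends.\<close>

lemma for_each_ops_le:
  assumes "P s"
    and "\<And>i s. \<lbrakk>i \<in> set is; P s\<rbrakk> \<Longrightarrow> P (val (f i s)) \<and> ops (f i s) \<le> c"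
  shows "ops (for_each is f s) \<le> length is * c"
  using assms
proof (induction "is" arbitrary: s)
  case (Cons i "is")
  have "ops (f i s) \<le> c" "P (val (f i s))" using Cons.prems by auto
  moreover from this have "ops (for_each is f (val (f i s))) \<le> length is * c"
    using Cons.prems by (intro Cons.IH) auto
  ultimately show ?case by simp
qed simp

text \<open>\<open>replace\<close> keeps the old state only until the pass has delivered the new
  one. So a single state of size at most \<open>a\<close> coexists with the work space
  \<open>c\<close> of a pass, and the peak does not grow with the number of passes.\<close>

lemma for_each_mem_le:
  assumes "P s" "\<And>s. P s \<Longrightarrow> cells s \<le> a"
    and "\<And>i s. \<lbrakk>i \<in> set is; P s\<rbrakk> \<Longrightarrow> P (val (f i s)) \<and> mem (f i s) \<le> c"
  shows "mem (for_each is f s) \<le> a + c"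
  using assms
proof (induction "is" arbitrary: s)
  case (Cons i "is")
  have *: "mem (f i s) \<le> c" "P (val (f i s))" "cells s \<le> a" using Cons.prems by auto
  then have "mem (for_each is f (val (f i s))) \<le> a + c"
    using Cons.prems by (intro Cons.IH) auto
  with * show ?case by simp
qed (simp add: trans_le_add1)

lemma sum_list_map_upt: "(\<Sum>i\<leftarrow>[a..<b]. f i) = (\<Sum>i=a..<b. f i)" for f :: "nat \<Rightarrow> 'b::comm_monoid_add"
  by (simp add: interv_sum_list_conv_sum_set_nat)

section \<open>Positive definite forms\<close>

text \<open>Index sets take the place of submatrices: the Cholesky loop shrinks
  \<open>{j..<n}\<close> from the left while all indices keep their meaning. Symmetry is not built
  in, since the form of \<open>S * R\<close> is treated as well.\<close>

definition pos_def_on :: "nat set \<Rightarrow> (nat \<Rightarrow> nat \<Rightarrow> real) \<Rightarrow> bool" where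
  "pos_def_on I C \<longleftrightarrow>
     (\<forall>x. (\<exists>i\<in>I. x i \<noteq> 0) \<longrightarrow> 0 < (\<Sum>i\<in>I. \<Sum>j\<in>I. x i * C i j * x j))"

lemma pos_def_on_diag:
  assumes "pos_def_on I C" "finite I" "i \<in> I"
  shows "0 < C i i"
proof -
  let ?e = "\<lambda>j. if j = i then 1 else 0 :: real"
  have "0 < (\<Sum>a\<in>I. \<Sum>b\<in>I. ?e a * C a b * ?e b)"
    using assms(3) by (intro assms(1)[unfolded pos_def_on_def, rule_format]) auto
  also have "\<dots> = C i i"
    by (simp add: sum.remove[OF assms(2,3)] cong: sum.cong_simp)
  finally show ?thesis .
qed

text \<open>Completing the square: for fixed \<open>x\<close> on \<open>I\<close>, the form on
  \<open>insert p I\<close> is minimal when the coordinate at \<open>p\<close> is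
  \<open>- t\<close>, and its value there is the form of the Schur complement at
  \<open>x\<close>.\<close>

lemma pos_def_on_schur_complement:
  assumes pd: "pos_def_on (insert p I) C" and fin: "finite I" and p: "p \<notin> I"
    and sym: "\<And>i j. i \<in> insert p I \<Longrightarrow> j \<in> insert p I \<Longrightarrow> C i j = C j i"
  shows "pos_def_on I (\<lambda>i j. C i j - C i p * C j p / C p p)"
  unfolding pos_def_on_def
proof (intro allI impI)
  fix x :: "nat \<Rightarrow> real" assume x: "\<exists>i\<in>I. x i \<noteq> 0"
  have d: "0 < C p p" using pos_def_on_diag[OF pd] fin by auto
  define s where "s = (\<Sum>i\<in>I. x i * C i p)"
  define t where "t = s / C p p"
  define y where "y = x(p := - t)"
  have y: "y i = x i" if "i \<in> I" for i using that p by (auto simp: y_def)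
  have yp: "y p = - t" by (simp add: y_def)
  have s': "(\<Sum>j\<in>I. C p j * x j) = s"
    unfolding s_def using sym by (intro sum.cong) (auto simp: mult.commute)
  have "0 < (\<Sum>i\<in>insert p I. \<Sum>j\<in>insert p I. y i * C i j * y j)"
    using x y by (intro pd[unfolded pos_def_on_def, rule_format]) auto
  also have "\<dots> = t * C p p * t - t * (\<Sum>j\<in>I. C p j * x j) +
      (\<Sum>i\<in>I. - (x i * C i p) * t + (\<Sum>j\<in>I. x i * C i j * x j))"
    using fin p by (simp add: y yp sum_distrib_left sum_negf mult.assoc cong: sum.cong)
  also have "(\<Sum>i\<in>I. - (x i * C i p) * t + (\<Sum>j\<in>I. x i * C i j * x j)) =
      - (s * t) + (\<Sum>i\<in>I. \<Sum>j\<in>I. x i * C i j * x j)"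
    unfolding sum.distrib s_def sum_distrib_right by (simp add: sum_negf)
  finally have "0 < (\<Sum>i\<in>I. \<Sum>j\<in>I. x i * C i j * x j) - s * s / C p p"
    using d by (simp add: t_def s')
  also have "s * s / C p p = (\<Sum>i\<in>I. \<Sum>j\<in>I. x i * (C i p * C j p / C p p) * x j)"
    unfolding s_def by (simp add: sum_product sum_divide_distrib mult_ac)
  finally show "0 < (\<Sum>i\<in>I. \<Sum>j\<in>I. x i * (C i j - C i p * C j p / C p p) * x j)"
    by (simp add: right_diff_distrib left_diff_distrib sum_subtractf)
qed

lemma pos_def_on_cong:
  assumes "\<And>i j. i \<in> I \<Longrightarrow> j \<in> I \<Longrightarrow> C i j = D i j"
  shows "pos_def_on I C \<longleftrightarrow> pos_def_on I D"
  unfolding pos_def_on_def using assms by (simp cong: sum.cong)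

lemma scalar_prod_mult_mat_vec:
  assumes "A \<in> carrier_mat n k" "x \<in> carrier_vec n" "y \<in> carrier_vec k"
  shows "x \<bullet> (A *\<^sub>v y) = (\<Sum>i<n. \<Sum>j<k. x $ i * A $$ (i, j) * y $ j)"
  using assms by (simp add: scalar_prod_def sum_distrib_left mult.assoc lessThan_atLeast0)

lemma pos_def_on_iff_positive_definite:
  assumes A: "A \<in> carrier_mat n n"
  shows "pos_def_on {..<n} (\<lambda>i j. A $$ (i, j)) \<longleftrightarrow> positive_definite A"
proof
  assume pd: "pos_def_on {..<n} (\<lambda>i j. A $$ (i, j))"
  show "positive_definite A" unfolding positive_definite_def
  proof (intro conjI ballI impI)
    fix x :: "real vec" assume x: "x \<in> carrier_vec (dim_row A)" "x \<noteq> 0\<^sub>v (dim_row A)"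
    then have "\<exists>i\<in>{..<n}. x $ i \<noteq> 0" using A by (auto simp: vec_eq_iff)
    with pd show "0 < x \<bullet> (A *\<^sub>v x)"
      using x A by (subst scalar_prod_mult_mat_vec[of _ n n]) (auto simp: pos_def_on_def)
  qed (use A in auto)
next
  assume pd: "positive_definite A"
  show "pos_def_on {..<n} (\<lambda>i j. A $$ (i, j))" unfolding pos_def_on_def
  proof (intro allI impI)
    fix x :: "nat \<Rightarrow> real" assume x: "\<exists>i\<in>{..<n}. x i \<noteq> 0"
    let ?x = "vec n x"
    from x have "?x \<noteq> 0\<^sub>v n" by (auto simp: vec_eq_iff)
    then have "0 < ?x \<bullet> (A *\<^sub>v ?x)" using pd A by (auto simp: positive_definite_def)
    then show "0 < (\<Sum>i<n. \<Sum>j<n. x i * A $$ (i, j) * x j)"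
      using A by (subst (asm) scalar_prod_mult_mat_vec[of _ n n]) (auto cong: sum.cong_simp)
  qed
qed

lemma sum_split_at:
  fixes f :: "nat \<Rightarrow> 'b::comm_monoid_add"
  assumes "k < n"
  shows "(\<Sum>j<n. f j) = (\<Sum>j=0..<k. f j) + f k + (\<Sum>j=Suc k..<n. f j)"
proof -
  have "(\<Sum>j<n. f j) = sum f {0..<k} + sum f {k..<n}"
    using assms by (simp add: lessThan_atLeast0 sum.atLeastLessThan_concat)
  then show ?thesis using assms by (simp add: sum.atLeast_Suc_lessThan add.assoc)
qed

section \<open>Cholesky factorization\<close>

lemma cholesky_correct:
  assumes A: "A \<in> carrier_mat n n" and spd: "spd A"
  shows "val (cholesky A) \<in> carrier_mat n n"
    and "\<And>i k. i < k \<Longrightarrow> k < n \<Longrightarrow> val (cholesky A) $$ (i, k) = 0"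
    and "\<And>k. k < n \<Longrightarrow> val (cholesky A) $$ (k, k) \<noteq> 0"
    and "val (cholesky A) * transpose_mat (val (cholesky A)) = A"
proof -
  \<comment> \<open>\<open>C j L\<close> is what remains of \<open>A\<close> after removing the
    contribution of the first \<open>j\<close> columns of \<open>L\<close>. On
    \<open>{j..<n}\<close> it is the Schur complement still to be factorized.\<close>
  define C where "C j L i l = A $$ (i, l) - (\<Sum>k<j. L $$ (i, k) * L $$ (l, k))"
    for j i l and L :: "real mat"
  \<comment> \<open>Columns from \<open>j\<close> on are still zero, so the row products over all
    \<open>l < n\<close> see only finished columns; these already reproduce the first
    \<open>j\<close> columns of \<open>A\<close>.\<close>
  define I where "I j L \<longleftrightarrow> L \<in> carrier_mat n n \<and>
    (\<forall>k<n. \<forall>i<n. i < k \<or> j \<le> k \<longrightarrow> L $$ (i, k) = 0) \<and> (\<forall>k<j. L $$ (k, k) \<noteq> 0) \<and>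
    (\<forall>k<j. \<forall>i<n. (\<Sum>l<n. L $$ (i, l) * L $$ (k, l)) = A $$ (i, k)) \<and>
    pos_def_on {j..<n} (C j L)" for j and L :: "real mat"
  define f where "f j L = set_col L j (vec n (\<lambda>i. if i < j then 0
      else if i = j then sqrt (C j L j j) else C j L i j / sqrt (C j L j j)))" for j L
  have sym: "A $$ (i, j) = A $$ (j, i)" if "i < n" "j < n" for i j
    using spd that A unfolding spd_def symmetric_matrix_def by (metis carrier_matD index_transpose_mat(1))
  have "val (cholesky A) = fold f [0..<n] (0\<^sub>m n n)"
    using A by (simp add: cholesky_def Let_def val_for_each f_def[abs_def] arith_op_defs C_def sum_list_map_upt
        lessThan_atLeast0 if_distrib[of val] cong: if_cong)
  also have "I n \<dots>"
  proof (rule fold_upt_invariant)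
    show "I 0 (0\<^sub>m n n)"
      using A spd pos_def_on_iff_positive_definite[OF A, unfolded lessThan_atLeast0]
      by (auto simp: I_def C_def spd_def cong: pos_def_on_cong)
  next
    fix j L assume "0 \<le> j" and "j < n" and I: "I j L"
    then have j: "j < n" and L: "L \<in> carrier_mat n n" by (auto simp: I_def)
    have d: "0 < C j L j j" using I j by (auto simp: I_def intro: pos_def_on_diag)
    define c where "c i = C j L i j / sqrt (C j L j j)" for i
    \<comment> \<open>In rows before \<open>j\<close> nothing of column \<open>j\<close> remains,
      because those indices are finished and \<open>A\<close> is symmetric. Hence the zeros written
      above the pivot obey the same formula \<open>c\<close> as the entries below it.\<close>
    have C0: "C j L i j = 0" if "i < j" for i
    proof -
      have "(\<Sum>l<n. L $$ (j, l) * L $$ (i, l)) = A $$ (j, i)" using I that j by (auto simp: I_def)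
      moreover have "(\<Sum>l<n. L $$ (j, l) * L $$ (i, l)) = (\<Sum>l<j. L $$ (i, l) * L $$ (j, l))"
        using I that j by (intro sum.mono_neutral_cong_right) (auto simp: I_def)
      ultimately show ?thesis using sym[of i j] that j by (simp add: C_def)
    qed
    have cj: "c j = sqrt (C j L j j)" using d by (simp add: c_def real_div_sqrt)
    have f: "f j L = mat n n (\<lambda>(i, k). if k = j then c i else L $$ (i, k))"
      using L C0 cj by (auto simp: f_def set_col_def c_def)
    \<comment> \<open>The product of the new column with itself is exactly the correction term of
      the Schur complement; this makes the next remainder positive definite.\<close>
    have Cc: "c i * c l = C j L i j * C j L l j / C j L j j" for i l
      using d by (simp add: c_def)
    show "I (Suc j) (f j L)" unfolding I_def
    proof (intro conjI allI impI)
      fix k i assume k: "k < Suc j" and i: "i < n"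
      show "(\<Sum>l<n. f j L $$ (i, l) * f j L $$ (k, l)) = A $$ (i, k)"
      proof (cases "k = j")
        case False
        with k have "k < j" by simp
        then have "c k = 0" "L $$ (k, j) = 0" using C0 I j by (auto simp: c_def I_def)
        then have "(\<Sum>l<n. f j L $$ (i, l) * f j L $$ (k, l)) = (\<Sum>l<n. L $$ (i, l) * L $$ (k, l))"
          using i j \<open>k < j\<close> by (intro sum.cong) (auto simp: f)
        then show ?thesis using I \<open>k < j\<close> i by (simp add: I_def)
      next
        case True
        have "(\<Sum>l<n. f j L $$ (i, l) * f j L $$ (k, l)) =
            (\<Sum>l=0..<j. L $$ (i, l) * L $$ (j, l)) + c i * c j"
          using I i j True by (simp add: sum_split_at[OF j] f I_def cong: sum.cong_simp)
        also have "c i * c j = C j L i j" using Cc[of i j] d by simp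
        finally show ?thesis using True by (simp add: C_def lessThan_atLeast0)
      qed
    next
      have "insert j {Suc j..<n} = {j..<n}" using j by auto
      moreover have "C j L i l = C j L l i" if "i < n" "l < n" for i l
        using sym[OF that] by (simp add: C_def mult.commute)
      ultimately have "pos_def_on {Suc j..<n} (\<lambda>i l. C j L i l - C j L i j * C j L l j / C j L j j)"
        using I j by (intro pos_def_on_schur_complement) (auto simp: I_def)
      then show "pos_def_on {Suc j..<n} (C (Suc j) (f j L))"
        using j by (subst pos_def_on_cong[of _ _
            "\<lambda>i l. C j L i l - C j L i j * C j L l j / C j L j j"]) (auto simp: C_def f Cc[unfolded C_def])
    qed (use I j d cj C0 in \<open>auto simp: f I_def c_def less_Suc_eq\<close>)
  qed simp
  finally have I: "I n (val (cholesky A))" .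
  from I show "val (cholesky A) \<in> carrier_mat n n"
    and "\<And>i k. i < k \<Longrightarrow> k < n \<Longrightarrow> val (cholesky A) $$ (i, k) = 0"
    and "\<And>k. k < n \<Longrightarrow> val (cholesky A) $$ (k, k) \<noteq> 0"
    by (auto simp: I_def)
  from I A show "val (cholesky A) * transpose_mat (val (cholesky A)) = A"
    by (intro eq_matI) (auto simp: I_def scalar_prod_def lessThan_atLeast0)
qed

text \<open>Equations that hold continue to hold: by triangularity, the entry written at
  \<open>i\<close> has coefficient zero in all earlier rows of \<open>L\<close> during the forward
  sweep, and in all later rows of the transpose during the backward sweep.\<close>

lemma cholesky_solve_correct:
  assumes L: "L \<in> carrier_mat n n" and lower: "\<And>i k. i < k \<Longrightarrow> k < n \<Longrightarrow> L $$ (i, k) = 0"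
    and diag: "\<And>k. k < n \<Longrightarrow> L $$ (k, k) \<noteq> 0" and b: "b \<in> carrier_vec n"
  shows "val (cholesky_solve L b) \<in> carrier_vec n"
    and "(L * transpose_mat L) *\<^sub>v val (cholesky_solve L b) = b"
proof -
  define f where
    "f i y = set_entry y i ((b $ i - (\<Sum>j=0..<i. L $$ (i, j) * y $ j)) / L $$ (i, i))" for i y
  define y where "y = fold f [0..<n] (0\<^sub>v n)"
  have "y \<in> carrier_vec n \<and> (\<forall>r<n. (\<Sum>j<n. L $$ (r, j) * y $ j) = b $ r)"
    unfolding y_def
  proof (rule fold_upt_invariant[where
        I = "\<lambda>i y. y \<in> carrier_vec n \<and> (\<forall>r<i. (\<Sum>j<n. L $$ (r, j) * y $ j) = b $ r)"])
    fix i y assume i: "i < n"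
      and I: "y \<in> carrier_vec n \<and> (\<forall>r<i. (\<Sum>j<n. L $$ (r, j) * y $ j) = b $ r)"
    then have y: "y \<in> carrier_vec n" by simp
    have "(\<Sum>j<n. L $$ (r, j) * f i y $ j) = b $ r" if "r < Suc i" for r
    proof (cases "r = i")
      case True
      then show ?thesis using y i lower diag
        by (simp add: sum_split_at[OF i] f_def set_entry_def cong: sum.cong_simp)
    next
      case False
      with that have "r < i" by simp
      then have "(\<Sum>j<n. L $$ (r, j) * f i y $ j) = (\<Sum>j<n. L $$ (r, j) * y $ j)"
        using y i lower[of r i] by (intro sum.cong) (auto simp: f_def set_entry_def)
      then show ?thesis using I \<open>r < i\<close> by simp
    qed
    with y show "f i y \<in> carrier_vec n \<and> (\<forall>r<Suc i. (\<Sum>j<n. L $$ (r, j) * f i y $ j) = b $ r)"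
      by (auto simp: f_def set_entry_def)
  qed auto
  then have y: "y \<in> carrier_vec n" "\<And>r. r < n \<Longrightarrow> (\<Sum>j<n. L $$ (r, j) * y $ j) = b $ r"
    by auto
  define g where
    "g i x = set_entry x i ((y $ i - (\<Sum>j=Suc i..<n. L $$ (j, i) * x $ j)) / L $$ (i, i))" for i x
  define x where "x = fold g (rev [0..<n]) (0\<^sub>v n)"
  have x_eq: "val (cholesky_solve L b) = x"
    using L by (simp add: x_def y_def f_def[abs_def] g_def[abs_def] cholesky_solve_def arith_op_defs sum_list_map_upt
        val_for_each)
  have "x \<in> carrier_vec n \<and> (\<forall>r. 0 \<le> r \<and> r < n \<longrightarrow> (\<Sum>j<n. L $$ (j, r) * x $ j) = y $ r)"
    unfolding x_def
  proof (rule fold_rev_upt_invariant[where I = "\<lambda>i x. x \<in> carrier_vec n \<and>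
        (\<forall>r. i \<le> r \<and> r < n \<longrightarrow> (\<Sum>j<n. L $$ (j, r) * x $ j) = y $ r)"])
    fix i x assume i: "i < n" and I: "x \<in> carrier_vec n \<and>
        (\<forall>r. Suc i \<le> r \<and> r < n \<longrightarrow> (\<Sum>j<n. L $$ (j, r) * x $ j) = y $ r)"
    then have x: "x \<in> carrier_vec n" by simp
    have "(\<Sum>j<n. L $$ (j, r) * g i x $ j) = y $ r" if r: "i \<le> r" "r < n" for r
    proof (cases "r = i")
      case True
      then show ?thesis using x i lower diag
        by (simp add: sum_split_at[OF i] g_def set_entry_def cong: sum.cong_simp)
    next
      case False
      with r have "i < r" by simp
      then have "(\<Sum>j<n. L $$ (j, r) * g i x $ j) = (\<Sum>j<n. L $$ (j, r) * x $ j)"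
        using x r lower[of i r] by (intro sum.cong) (auto simp: g_def set_entry_def)
      then show ?thesis using I \<open>i < r\<close> r by simp
    qed
    with x show "g i x \<in> carrier_vec n \<and>
      (\<forall>r. i \<le> r \<and> r < n \<longrightarrow> (\<Sum>j<n. L $$ (j, r) * g i x $ j) = y $ r)"
      by (auto simp: g_def set_entry_def)
  qed auto
  then have x: "x \<in> carrier_vec n" "\<And>r. r < n \<Longrightarrow> (\<Sum>j<n. L $$ (j, r) * x $ j) = y $ r"
    by auto
  have "transpose_mat L *\<^sub>v x = y"
    using x y(1) L by (intro eq_vecI) (auto simp: scalar_prod_def lessThan_atLeast0)
  moreover have "L *\<^sub>v y = b"
    using y b L by (intro eq_vecI) (auto simp: scalar_prod_def lessThan_atLeast0)
  ultimately show "val (cholesky_solve L b) \<in> carrier_vec n"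
    "(L * transpose_mat L) *\<^sub>v val (cholesky_solve L b) = b"
    using L x by (simp_all add: x_eq assoc_mult_mat_vec[of _ n n _ n])
qed

section \<open>Diagonal blocks of the Schur form\<close>

lemma sum_eq_single:
  fixes g :: "nat \<Rightarrow> real"
  assumes "k < n" "\<And>l. l < n \<Longrightarrow> l \<noteq> k \<Longrightarrow> g l = 0"
  shows "(\<Sum>l<n. g l) = g k"
proof -
  have "(\<Sum>l<n. g l) = (\<Sum>l\<in>{k}. g l)"
    using assms by (intro sum.mono_neutral_right) auto
  then show ?thesis by simp
qed

text \<open>Gram-Schmidt for a form that need not be symmetric. One more orthogonality condition is
  met by subtracting a multiple of the vector \<open>u\<close> that the induction hypothesis
  provides at the index \<open>p\<close> itself; \<open>u\<close> has no entries beyond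
  \<open>p\<close>, so the normalization at \<open>k\<close> survives.\<close>

lemma orthogonal_vector_exists:
  assumes pd: "pos_def_on {..<n} S" and "p \<le> k" "k < n"
  shows "\<exists>x. x k = 1 \<and> (\<forall>i. p \<le> i \<and> i \<noteq> k \<longrightarrow> x i = 0) \<and> (\<forall>j<p. (\<Sum>i<n. x i * S i j) = 0)"
  using assms(2,3)
proof (induction p arbitrary: k)
  case 0
  show ?case by (rule exI[of _ "\<lambda>i. if i = k then 1 else 0"]) simp
next
  case (Suc p)
  from Suc.IH[of k] Suc.prems obtain x where
    x: "x k = 1" "\<forall>i. p \<le> i \<and> i \<noteq> k \<longrightarrow> x i = 0" "\<forall>j<p. (\<Sum>i<n. x i * S i j) = 0" by auto
  from Suc.IH[of p] Suc.prems obtain u where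
    u: "u p = 1" "\<forall>i. p \<le> i \<and> i \<noteq> p \<longrightarrow> u i = 0" "\<forall>j<p. (\<Sum>i<n. u i * S i j) = 0" by auto
  have p: "p < n" using Suc.prems by simp
  \<comment> \<open>The form at \<open>u\<close> collapses to column \<open>p\<close>: earlier
    columns vanish by orthogonality, later ones because \<open>u\<close> has no entries there.
    Positivity thus makes the divisor in \<open>t\<close> nonzero.\<close>
  have "0 < (\<Sum>i<n. \<Sum>j<n. u i * S i j * u j)"
    using u(1) p by (intro pd[unfolded pos_def_on_def, rule_format]) force
  also have "\<dots> = (\<Sum>j<n. (\<Sum>i<n. u i * S i j) * u j)"
    by (subst sum.swap) (simp add: sum_distrib_right)
  also have "\<dots> = (\<Sum>i<n. u i * S i p) * u p"
    using u p by (intro sum_eq_single) (auto simp: neq_iff)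
  finally have d: "(\<Sum>i<n. u i * S i p) \<noteq> 0" using u(1) by simp
  define t where "t = (\<Sum>i<n. x i * S i p) / (\<Sum>i<n. u i * S i p)"
  have form: "(\<Sum>i<n. (x i - t * u i) * S i j) = (\<Sum>i<n. x i * S i j) - t * (\<Sum>i<n. u i * S i j)"
    for j by (simp add: left_diff_distrib sum_subtractf sum_distrib_left mult.assoc)
  have "(\<Sum>i<n. x i * S i p) - t * (\<Sum>i<n. u i * S i p) = 0" using d by (simp add: t_def)
  then show ?case
    using x u Suc.prems
    by (intro exI[of _ "\<lambda>i. x i - t * u i"]) (auto simp: form less_Suc_eq simp del: right_minus_eq)
qed

text \<open>Regroups the form of \<open>S * R\<close> so that the left vector meets \<open>S\<close>
  and the right vector meets \<open>R\<close>; orthogonality and the zero pattern of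
  \<open>R\<close> can then be used separately.\<close>

lemma form_mult_eq:
  fixes S R :: "nat \<Rightarrow> nat \<Rightarrow> real"
  shows "(\<Sum>i<n. \<Sum>l<n. x i * (\<Sum>q<n. S i q * R q l) * y l) =
    (\<Sum>q<n. (\<Sum>i<n. x i * S i q) * (\<Sum>l<n. R q l * y l))"
proof -
  have "(\<Sum>i<n. \<Sum>l<n. x i * (\<Sum>q<n. S i q * R q l) * y l) =
      (\<Sum>i<n. \<Sum>q<n. \<Sum>l<n. x i * S i q * (R q l * y l))"
    by (subst (2) sum.swap) (simp add: sum_distrib_left sum_distrib_right mult_ac)
  also have "\<dots> = (\<Sum>q<n. \<Sum>i<n. \<Sum>l<n. x i * S i q * (R q l * y l))"
    by (rule sum.swap)
  finally show ?thesis by (simp add: sum_product)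
qed

text \<open>The diagonal block of \<open>R\<close> with indices \<open>{p..k}\<close> is isolated by testing with vectors that are
  supported on \<open>{..k}\<close> and \<open>S\<close>-orthogonal to the coordinates below \<open>p\<close>; both \<open>S\<close> and \<open>S * R\<close> are
  positive on these.\<close>

locale diagonal_block =
  fixes n p k :: nat and S R :: "nat \<Rightarrow> nat \<Rightarrow> real"
  assumes S: "pos_def_on {..<n} S"
    and SR: "pos_def_on {..<n} (\<lambda>i l. \<Sum>q<n. S i q * R q l)"
    and pk: "p \<le> k" and k: "k < n"
    and below: "\<And>q l. k < q \<Longrightarrow> q < n \<Longrightarrow> l \<le> k \<Longrightarrow> R q l = 0"
    and left: "\<And>q l. p \<le> q \<Longrightarrow> q < n \<Longrightarrow> l < p \<Longrightarrow> R q l = 0"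
begin

text \<open>\<open>w\<close> is the Gram matrix, with respect to \<open>S\<close>, of one test
  vector \<open>x a\<close> per block index: the unit vector at \<open>a\<close> corrected below
  \<open>p\<close> so as to be \<open>S\<close>-orthogonal to the coordinates there. The second
  positive quantity is the form of \<open>S * R\<close> at \<open>x a\<close>. Symmetry is
  conditional because the locale does not assume it of \<open>S\<close>.\<close>

lemma block_vectors:
  shows "\<exists>w. (\<forall>a\<in>{p..k}. 0 < w a a) \<and> (\<forall>a\<in>{p..k}. 0 < (\<Sum>q\<in>{p..k}. w a q * R q a)) \<and>
    ((\<forall>i<n. \<forall>j<n. S i j = S j i) \<longrightarrow> (\<forall>a\<in>{p..k}. \<forall>b\<in>{p..k}. w a b = w b a))"
proof -
  have "\<forall>a. \<exists>x. p \<le> a \<and> a \<le> k \<longrightarrow> x a = 1 \<and> (\<forall>i. p \<le> i \<and> i \<noteq> a \<longrightarrow> x i = 0) \<and>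
      (\<forall>j<p. (\<Sum>i<n. x i * S i j) = 0)"
  proof (intro allI)
    fix a
    show "\<exists>x. p \<le> a \<and> a \<le> k \<longrightarrow> x a = 1 \<and> (\<forall>i. p \<le> i \<and> i \<noteq> a \<longrightarrow> x i = 0) \<and>
        (\<forall>j<p. (\<Sum>i<n. x i * S i j) = 0)"
    proof (cases "p \<le> a \<and> a \<le> k")
      case True
      with k have "p \<le> a" "a < n" by auto
      from orthogonal_vector_exists[OF S this] show ?thesis by simp
    qed blast
  qed
  from choice[OF this] obtain x where x: "\<And>a. p \<le> a \<Longrightarrow> a \<le> k \<Longrightarrow> x a a = 1"
      "\<And>a i. p \<le> a \<Longrightarrow> a \<le> k \<Longrightarrow> p \<le> i \<Longrightarrow> i \<noteq> a \<Longrightarrow> x a i = 0"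
      "\<And>a j. p \<le> a \<Longrightarrow> a \<le> k \<Longrightarrow> j < p \<Longrightarrow> (\<Sum>i<n. x a i * S i j) = 0"
    by blast
  define w where "w a b = (\<Sum>i<n. x a i * S i b)" for a b
  \<comment> \<open>The entries of \<open>x b\<close> away from \<open>b\<close> lie below
    \<open>p\<close>, where \<open>w a\<close> vanishes by orthogonality.\<close>
  have w: "(\<Sum>i<n. \<Sum>j<n. x a i * S i j * x b j) = w a b"
    if "p \<le> a" "a \<le> k" "p \<le> b" "b \<le> k" for a b
  proof -
    have "(\<Sum>i<n. \<Sum>j<n. x a i * S i j * x b j) = (\<Sum>j<n. w a j * x b j)"
      by (subst sum.swap) (simp add: sum_distrib_right w_def)
    also have "\<dots> = w a b * x b b"
    proof (rule sum_eq_single)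
      show "w a j * x b j = 0" if "j \<noteq> b" for j
        using x(2)[of b j] x(3)[of a j] that \<open>p \<le> a\<close> \<open>a \<le> k\<close> \<open>p \<le> b\<close> \<open>b \<le> k\<close>
        by (cases "p \<le> j") (auto simp: w_def)
    qed (use that k in simp)
    finally show ?thesis using x that by simp
  qed
  have nonzero: "\<exists>i\<in>{..<n}. x a i \<noteq> 0" if "p \<le> a" "a \<le> k" for a
    using x(1)[OF that] that k by (intro bexI[of _ a]) auto
  show ?thesis
  proof (intro exI[of _ w] conjI ballI impI)
    fix a assume "a \<in> {p..k}"
    then have a: "p \<le> a" "a \<le> k" by auto
    show "0 < w a a"
      using S[unfolded pos_def_on_def, rule_format, OF nonzero[OF a]] w[OF a a] by simp
  next
    fix a assume "a \<in> {p..k}"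
    then have a: "p \<le> a" "a \<le> k" by auto
    have "0 < (\<Sum>q<n. w a q * (\<Sum>l<n. R q l * x a l))"
      using SR[unfolded pos_def_on_def, rule_format, OF nonzero[OF a]]
      unfolding form_mult_eq w_def .
    also have "\<dots> = (\<Sum>q\<in>{p..k}. w a q * R q a)"
    proof (rule sum.mono_neutral_cong_right)
      \<comment> \<open>Rows from \<open>p\<close> on vanish left of \<open>p\<close>, and from
        \<open>p\<close> on \<open>x a\<close> has only the entry at \<open>a\<close>. Of the other
        rows, those before \<open>p\<close> are removed by \<open>w a q = 0\<close> and those after
        \<open>k\<close> by \<open>below\<close>.\<close>
      have *: "(\<Sum>l<n. R q l * x a l) = R q a" if "p \<le> q" "q < n" for q
      proof -
        have "(\<Sum>l<n. R q l * x a l) = R q a * x a a"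
        proof (rule sum_eq_single)
          show "R q l * x a l = 0" if "l \<noteq> a" for l
            using x(2)[OF a, of l] left[of q l] that \<open>p \<le> q\<close> \<open>q < n\<close> by (cases "p \<le> l") auto
        qed (use a k in simp)
        then show ?thesis using x(1)[OF a] by simp
      qed
      show "\<forall>q\<in>{..<n} - {p..k}. w a q * (\<Sum>l<n. R q l * x a l) = 0"
      proof
        fix q assume q: "q \<in> {..<n} - {p..k}"
        show "w a q * (\<Sum>l<n. R q l * x a l) = 0"
        proof (cases "q < p")
          case True
          then show ?thesis using x(3)[OF a] by (simp add: w_def)
        next
          case False
          with q have "p \<le> q" "q < n" "k < q" by auto
          then show ?thesis using * below[of q a] a by simp
        qed
      qed
      show "w a q * (\<Sum>l<n. R q l * x a l) = w a q * R q a" if "q \<in> {p..k}" for q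
        using * that k by simp
    qed (use k in auto)
    finally show "0 < (\<Sum>q\<in>{p..k}. w a q * R q a)" .
  next
    fix a b assume sym: "\<forall>i<n. \<forall>j<n. S i j = S j i" and "a \<in> {p..k}" "b \<in> {p..k}"
    then have ab: "p \<le> a" "a \<le> k" "p \<le> b" "b \<le> k" by auto
    have "w a b = (\<Sum>i<n. \<Sum>j<n. x a i * S i j * x b j)" using w ab by simp
    also have "\<dots> = (\<Sum>j<n. \<Sum>i<n. x b j * S j i * x a i)"
      by (subst sum.swap) (auto simp: sym mult_ac intro!: sum.cong)
    also have "\<dots> = w b a" using w ab by simp
    finally show "w a b = w b a" .
  qed
qed

lemma single_block_pos: "0 < R k k" if "p = k"
proof -
  obtain w where "\<forall>a\<in>{p..k}. 0 < w a a" "\<forall>a\<in>{p..k}. 0 < (\<Sum>q\<in>{p..k}. w a q * R q a)"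
    using block_vectors by auto
  with pk have "0 < w k k" "0 < (\<Sum>q\<in>{p..k}. w k q * R q k)" by auto
  then show ?thesis using that by (simp add: zero_less_mult_iff)
qed

text \<open>Weighted by \<open>|b1|\<close> and \<open>|b2|\<close>, the two positive quantities add
  up without mixed terms, since \<open>w\<close> is symmetric and \<open>b1\<close>,
  \<open>b2\<close> have opposite signs. What remains is the common diagonal entry times a positive
  number.\<close>

lemma double_block_pos:
  assumes kp: "k = Suc p" and diag: "R p p = R k k" and off: "R p k * R k p < 0"
    and sym: "\<And>i j. i < n \<Longrightarrow> j < n \<Longrightarrow> S i j = S j i"
  shows "0 < R p p"
proof -
  obtain w where *: "\<forall>a\<in>{p..k}. 0 < w a a" "\<forall>a\<in>{p..k}. 0 < (\<Sum>q\<in>{p..k}. w a q * R q a)"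
    "\<forall>a\<in>{p..k}. \<forall>b\<in>{p..k}. w a b = w b a"
    using block_vectors sym by auto
  then have w: "0 < w p p" "0 < w k k" "w p k = w k p"
    "0 < (\<Sum>q\<in>{p..k}. w p q * R q p)" "0 < (\<Sum>q\<in>{p..k}. w k q * R q k)"
    using pk by (meson atLeastAtMost_iff order_refl)+
  have set: "{p..k} = {p, k}" using kp by auto
  let ?b1 = "R p k" and ?b2 = "R k p"
  have cross: "\<bar>?b1\<bar> * ?b2 + \<bar>?b2\<bar> * ?b1 = 0"
    using off by (cases "?b1 > 0") (auto simp: mult_less_0_iff)
  have "0 < \<bar>?b1\<bar> * (w p p * R p p + w p k * ?b2) + \<bar>?b2\<bar> * (w k p * ?b1 + w k k * R k k)"
  proof (rule add_pos_pos)
    show "0 < \<bar>?b1\<bar> * (w p p * R p p + w p k * ?b2)"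
      using w(4) off kp unfolding set by (intro mult_pos_pos) auto
    show "0 < \<bar>?b2\<bar> * (w k p * ?b1 + w k k * R k k)"
      using w(5) off kp unfolding set by (intro mult_pos_pos) auto
  qed
  also have "\<dots> = R p p * (\<bar>?b1\<bar> * w p p + \<bar>?b2\<bar> * w k k) + w p k * (\<bar>?b1\<bar> * ?b2 + \<bar>?b2\<bar> * ?b1)"
    by (simp add: diag w(3) algebra_simps)
  finally have "0 < R p p * (\<bar>?b1\<bar> * w p p + \<bar>?b2\<bar> * w k k)" by (simp add: cross)
  moreover have "0 < \<bar>?b1\<bar> * w p p + \<bar>?b2\<bar> * w k k"
    using w(1,2) off by (intro add_pos_pos mult_pos_pos) auto
  ultimately show ?thesis by (simp add: zero_less_mult_iff)
qed

end

section \<open>Boundaries between diagonal blocks\<close>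

lemma visited_le: "visited R v \<Longrightarrow> v \<le> dim_row R"
  by (induction rule: visited.induct) auto

text \<open>The definition marks a block at its upper index, whereas the loop meets it at its lower
  index \<open>k\<close>. The last conclusion says that \<open>k - 1\<close> is again a boundary,
  because blocks do not overlap.\<close>

lemma not_starts_singleD:
  assumes R: "standardized_quasi_triangular R" and "visited R (Suc k)" "\<not> starts_single R k"
  shows "0 < k" "k < dim_row R" "R $$ (k - 1, k - 1) = R $$ (k, k)"
    "R $$ (k - 1, k) * R $$ (k, k - 1) < 0" "1 < k \<Longrightarrow> R $$ (k - 1, k - 2) = 0"
proof -
  from assms(3) show k: "0 < k" by (simp add: starts_single_def)
  from visited_le[OF assms(2)] show k': "k < dim_row R" by simp
  have sub: "R $$ (Suc (k - 1), k - 1) \<noteq> 0" using assms(3) k by (simp add: starts_single_def)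
  have "Suc (k - 1) = k" using k by simp
  with R k' sub have "R $$ (k - 1, k - 1) = R $$ (k, k) \<and> R $$ (k - 1, k) * R $$ (k, k - 1) < 0"
    unfolding standardized_quasi_triangular_def by metis
  then show "R $$ (k - 1, k - 1) = R $$ (k, k)" "R $$ (k - 1, k) * R $$ (k, k - 1) < 0" by auto
  show "R $$ (k - 1, k - 2) = 0" if "1 < k"
  proof (rule ccontr)
    assume "R $$ (k - 1, k - 2) \<noteq> 0"
    moreover have "Suc (k - 2) = k - 1" "Suc (Suc (k - 2)) = k" "Suc (k - 2) < dim_row R"
      using that k' by auto
    ultimately have "R $$ (k, k - 1) = 0"
      using R k' unfolding standardized_quasi_triangular_def by metis
    with assms(3) show False by (simp add: starts_single_def)
  qed
qed

text \<open>Every value of the loop variable is a boundary between blocks, so \<open>R\<close> is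
  block triangular there. Only the entry at \<open>(v, v - 1)\<close> depends on how the loop
  arrived at \<open>v\<close>; all others lie below the first subdiagonal.\<close>

lemma visited_block_zero:
  assumes R: "standardized_quasi_triangular R" and v: "visited R v"
    and q: "v \<le> q" "q < dim_row R" and l: "l < v"
  shows "R $$ (q, l) = 0"
proof -
  have "0 < v \<longrightarrow> v < dim_row R \<longrightarrow> R $$ (v, v - 1) = 0"
    using v
  proof cases
    case (double k)
    then show ?thesis
      using not_starts_singleD[OF R double(2,3)] by (auto simp: numeral_2_eq_2)
  qed (auto simp: starts_single_def)
  moreover have "R $$ (q, l) = 0" if "Suc l < q"
    using R q that unfolding standardized_quasi_triangular_def by blast
  moreover have "q = v \<and> l = v - 1" if "\<not> Suc l < q" using q l that by auto
  ultimately show ?thesis using q l by (cases "Suc l < q") auto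
qed

lemma scalar_prod_congruence:
  fixes A Q :: "real mat"
  assumes A: "A \<in> carrier_mat n n" and Q: "Q \<in> carrier_mat n n" and x: "x \<in> carrier_vec n"
  shows "x \<bullet> ((transpose_mat Q * A * Q) *\<^sub>v x) = (Q *\<^sub>v x) \<bullet> (A *\<^sub>v (Q *\<^sub>v x))"
proof -
  have "(transpose_mat Q * A * Q) *\<^sub>v x = transpose_mat Q *\<^sub>v (A *\<^sub>v (Q *\<^sub>v x))"
    using A Q x by (simp add: assoc_mult_mat_vec[of _ n n _ n])
  then show ?thesis
    using A Q x transpose_vec_mult_scalar[of "transpose_mat Q" n n "A *\<^sub>v (Q *\<^sub>v x)" x] by simp
qed

lemma positive_definite_congruence:
  assumes A: "A \<in> carrier_mat n n" "positive_definite A" and Q: "Q \<in> carrier_mat n n"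
    and inv: "transpose_mat Q * Q = 1\<^sub>m n"
  shows "positive_definite (transpose_mat Q * A * Q)"
  unfolding positive_definite_def
proof (intro conjI ballI impI)
  fix x :: "real vec"
  assume x: "x \<in> carrier_vec (dim_row (transpose_mat Q * A * Q))"
    "x \<noteq> 0\<^sub>v (dim_row (transpose_mat Q * A * Q))"
  then have x': "x \<in> carrier_vec n" "x \<noteq> 0\<^sub>v n" using Q by auto
  have "Q *\<^sub>v x \<noteq> 0\<^sub>v n"
  proof
    assume "Q *\<^sub>v x = 0\<^sub>v n"
    then have "(transpose_mat Q * Q) *\<^sub>v x = transpose_mat Q *\<^sub>v 0\<^sub>v n"
      using Q x' by (simp add: assoc_mult_mat_vec[of _ n n _ n])
    also have "transpose_mat Q *\<^sub>v 0\<^sub>v n = 0\<^sub>v n" using Q by (intro eq_vecI) auto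
    finally show False using x' by (simp add: inv)
  qed
  then show "0 < x \<bullet> ((transpose_mat Q * A * Q) *\<^sub>v x)"
    using A Q x'(1) by (subst scalar_prod_congruence[of A n]) (auto simp: positive_definite_def)
qed (use A Q in auto)

section \<open>Spatial systems\<close>

lemma det_nonzero_inverse:
  fixes A :: "real mat"
  assumes A: "A \<in> carrier_mat n n" and "det A \<noteq> 0"
  shows "\<exists>B\<in>carrier_mat n n. A * B = 1\<^sub>m n \<and> B * A = 1\<^sub>m n"
  using det_non_zero_imp_unit[OF assms, of "()"] by (auto simp: Units_def ring_mat_def)

lemma uniquely_solvable_if_det_nonzero:
  assumes A: "A \<in> carrier_mat n n" and "det A \<noteq> 0"
  shows "uniquely_solvable A"
proof -
  from det_nonzero_inverse[OF assms] obtain B where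
    B: "B \<in> carrier_mat n n" "A * B = 1\<^sub>m n" "B * A = 1\<^sub>m n" by auto
  show ?thesis unfolding uniquely_solvable_def
  proof (intro ballI ex1I conjI)
    fix b :: "real vec" assume "b \<in> carrier_vec (dim_row A)"
    with A have b: "b \<in> carrier_vec n" by auto
    show "B *\<^sub>v b \<in> carrier_vec (dim_col A)" using A B b by auto
    show "A *\<^sub>v (B *\<^sub>v b) = b"
      using A B b by (simp flip: assoc_mult_mat_vec)
    fix z assume "z \<in> carrier_vec (dim_col A) \<and> A *\<^sub>v z = b"
    moreover from this have "B *\<^sub>v (A *\<^sub>v z) = z"
      using A B by (subst assoc_mult_mat_vec[symmetric, of _ n n _ n]) auto
    ultimately show "z = B *\<^sub>v b" by simp
  qed
qed

lemma uniquely_solvable_if_injective: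
  assumes A: "A \<in> carrier_mat n n"
    and inj: "\<And>v. v \<in> carrier_vec n \<Longrightarrow> A *\<^sub>v v = 0\<^sub>v n \<Longrightarrow> v = 0\<^sub>v n"
  shows "uniquely_solvable A"
  using inj by (intro uniquely_solvable_if_det_nonzero[OF A]) (auto simp: det_0_iff_vec_prod_zero[OF A])

text \<open>A kernel vector \<open>w\<close> of the transpose has the form
  \<open>A *\<^sub>v z\<close>, and moving \<open>A\<close> to the other side of
  \<open>w \<bullet> w\<close> gives zero. So the transpose, and with it \<open>A\<close>, has
  nonzero determinant.\<close>

lemma uniquely_solvable_if_surjective:
  assumes A: "A \<in> carrier_mat n n"
    and surj: "\<And>b. b \<in> carrier_vec n \<Longrightarrow> \<exists>z\<in>carrier_vec n. A *\<^sub>v z = b"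
  shows "uniquely_solvable A"
proof (rule uniquely_solvable_if_det_nonzero[OF A])
  have "w = 0\<^sub>v n" if w: "w \<in> carrier_vec n" "transpose_mat A *\<^sub>v w = 0\<^sub>v n" for w
  proof -
    from surj[OF w(1)] obtain z where z: "z \<in> carrier_vec n" "A *\<^sub>v z = w" by auto
    have "w \<bullet> w = (transpose_mat A *\<^sub>v w) \<bullet> z"
      using A w z by (subst transpose_vec_mult_scalar[of A n n]) auto
    then have "w \<bullet> w = 0" using w z by simp
    then have "(\<Sum>i<n. w $ i * w $ i) = 0" using w by (simp add: scalar_prod_def lessThan_atLeast0)
    then have "w $ i = 0" if "i < n" for i
      using that by (subst (asm) sum_nonneg_eq_0_iff) auto
    then show ?thesis using w by (intro eq_vecI) auto
  qed
  then have "det (transpose_mat A) \<noteq> 0"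
    using A by (auto simp: det_0_iff_vec_prod_zero[of "transpose_mat A" n])
  then show "det A \<noteq> 0" using A by (simp add: det_transpose[of A n])
qed

lemma uniquely_solvable_positive_definite:
  assumes A: "A \<in> carrier_mat n n" "positive_definite A"
  shows "uniquely_solvable A"
proof (rule uniquely_solvable_if_injective[OF A(1)], rule ccontr)
  fix v assume v: "v \<in> carrier_vec n" "A *\<^sub>v v = 0\<^sub>v n" "v \<noteq> 0\<^sub>v n"
  then have "0 < v \<bullet> (A *\<^sub>v v)" using A by (auto simp: positive_definite_def)
  with v show False by simp
qed

lemma spd_scalar_prod_commute:
  assumes A: "spd A" "A \<in> carrier_mat n n" and "x \<in> carrier_vec n" "y \<in> carrier_vec n"
  shows "x \<bullet> (A *\<^sub>v y) = y \<bullet> (A *\<^sub>v x)"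
proof -
  have "x \<bullet> (A *\<^sub>v y) = (transpose_mat A *\<^sub>v x) \<bullet> y"
    using assms transpose_vec_mult_scalar[of A n n y x] by simp
  also have "transpose_mat A = A" using A by (simp add: spd_def symmetric_matrix_def)
  finally show ?thesis using assms by (simp add: comm_scalar_prod[of _ n])
qed

lemma smult_mat_mult_vec:
  fixes A :: "real mat"
  assumes "A \<in> carrier_mat n k" "x \<in> carrier_vec k"
  shows "(c \<cdot>\<^sub>m A) *\<^sub>v x = c \<cdot>\<^sub>v (A *\<^sub>v x)"
  using assms by (intro eq_vecI) auto

lemma spd_add_smult:
  assumes M: "spd M" "M \<in> carrier_mat n n" and A: "spd A" "A \<in> carrier_mat n n" and c: "0 < c"
  shows "spd (M + c \<cdot>\<^sub>m A)"
proof -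
  have "transpose_mat (c \<cdot>\<^sub>m A) = c \<cdot>\<^sub>m transpose_mat A" using A by (intro eq_matI) auto
  then have "symmetric_matrix (M + c \<cdot>\<^sub>m A)"
    using M A by (auto simp: spd_def symmetric_matrix_def transpose_add[of _ n n])
  moreover have "0 < x \<bullet> ((M + c \<cdot>\<^sub>m A) *\<^sub>v x)" if x: "x \<in> carrier_vec n" "x \<noteq> 0\<^sub>v n" for x
  proof -
    have "x \<bullet> ((M + c \<cdot>\<^sub>m A) *\<^sub>v x) = x \<bullet> (M *\<^sub>v x) + c * (x \<bullet> (A *\<^sub>v x))"
      using M A x by (simp add: add_mult_distrib_mat_vec[of _ n n] smult_mat_mult_vec[of _ n n]
          scalar_prod_add_distrib[of _ n])
    moreover have "0 < x \<bullet> (M *\<^sub>v x)" "0 < x \<bullet> (A *\<^sub>v x)"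
      using M A x by (auto simp: spd_def positive_definite_def)
    ultimately show ?thesis using c by (simp add: add_pos_pos)
  qed
  ultimately show ?thesis using M A by (auto simp: spd_def positive_definite_def)
qed

text \<open>Testing \<open>(x, y)\<close> with \<open>(x, - y)\<close> cancels the coupling of the two blocks.\<close>

lemma coupled_system:
  fixes H A :: "real mat" and a b c :: real
  assumes H: "spd H" "H \<in> carrier_mat m m" and A: "spd A" "A \<in> carrier_mat m m"
    and m: "0 < m" and a: "0 < a" and b: "0 < b"
  defines "K \<equiv> four_block_mat (a \<cdot>\<^sub>m H) (c \<cdot>\<^sub>m A) (c \<cdot>\<^sub>m A) ((- b) \<cdot>\<^sub>m H)"
  shows "symmetric_matrix K" "indefinite K" "uniquely_solvable K"
proof -
  have K: "K \<in> carrier_mat (m + m) (m + m)" using H A by (auto simp: K_def)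
  have Hpos: "0 < x \<bullet> (H *\<^sub>v x)" if "x \<in> carrier_vec m" "x \<noteq> 0\<^sub>v m" for x
    using H that by (auto simp: spd_def positive_definite_def)
  have Kxy: "K *\<^sub>v (x @\<^sub>v y) =
      (a \<cdot>\<^sub>v (H *\<^sub>v x) + c \<cdot>\<^sub>v (A *\<^sub>v y)) @\<^sub>v (c \<cdot>\<^sub>v (A *\<^sub>v x) + (- b) \<cdot>\<^sub>v (H *\<^sub>v y))"
    if "x \<in> carrier_vec m" "y \<in> carrier_vec m" for x y
    unfolding K_def using H A that
    by (subst four_block_mat_mult_vec[of _ m m _ m _ m]) (auto simp: smult_mat_mult_vec[of _ m m])
  have tr: "transpose_mat (d \<cdot>\<^sub>m B) = d \<cdot>\<^sub>m B" if "spd B" "B \<in> carrier_mat m m" for d B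
  proof -
    have "transpose_mat (d \<cdot>\<^sub>m B) = d \<cdot>\<^sub>m transpose_mat B" using that by (intro eq_matI) auto
    then show ?thesis using that by (simp add: spd_def symmetric_matrix_def)
  qed
  show "symmetric_matrix K"
    using K H A unfolding symmetric_matrix_def K_def
    by (subst transpose_four_block_mat[of _ m m _ m _ m]) (auto simp: tr)
  \<comment> \<open>Nonzero because \<open>0 < m\<close>. Placed in one half with zeros in the
    other, \<open>e\<close> sees only one of the two diagonal blocks of \<open>K\<close>, which have
    opposite signs.\<close>
  define e :: "real vec" where "e = unit_vec m 0"
  have e: "e \<in> carrier_vec m" "e \<noteq> 0\<^sub>v m" using m by (auto simp: e_def)
  show "indefinite K"
    unfolding indefinite_def
  proof (intro conjI bexI)
    have Ae: "A *\<^sub>v 0\<^sub>v m = 0\<^sub>v m" "H *\<^sub>v 0\<^sub>v m = 0\<^sub>v m" using A H by (auto intro!: eq_vecI)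
    show "0 < (e @\<^sub>v 0\<^sub>v m) \<bullet> (K *\<^sub>v (e @\<^sub>v 0\<^sub>v m))"
      using e A H Hpos[OF e] a
      by (subst Kxy) (auto simp: Ae scalar_prod_append[of _ m _ m] scalar_prod_add_distrib[of _ m])
    show "(0\<^sub>v m @\<^sub>v e) \<bullet> (K *\<^sub>v (0\<^sub>v m @\<^sub>v e)) < 0"
      using e A H Hpos[OF e] b
      by (subst Kxy) (auto simp: Ae scalar_prod_append[of _ m _ m] scalar_prod_add_distrib[of _ m])
  qed (use K e in auto)
  show "uniquely_solvable K"
  proof (rule uniquely_solvable_if_injective[OF K])
    fix v assume v: "v \<in> carrier_vec (m + m)" "K *\<^sub>v v = 0\<^sub>v (m + m)"
    define x where "x = vec_first v m"
    define y where "y = vec_last v m"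
    have xy: "x \<in> carrier_vec m" "y \<in> carrier_vec m" "v = x @\<^sub>v y"
      using v(1) by (auto simp: x_def y_def)
    have "0\<^sub>v (m + m) = 0\<^sub>v m @\<^sub>v 0\<^sub>v m" by (intro eq_vecI) auto
    with v(2) have "(a \<cdot>\<^sub>v (H *\<^sub>v x) + c \<cdot>\<^sub>v (A *\<^sub>v y)) @\<^sub>v
        (c \<cdot>\<^sub>v (A *\<^sub>v x) + (- b) \<cdot>\<^sub>v (H *\<^sub>v y)) = 0\<^sub>v m @\<^sub>v 0\<^sub>v m"
      using Kxy[OF xy(1,2)] xy(3) by simp
    then have eqs: "a \<cdot>\<^sub>v (H *\<^sub>v x) + c \<cdot>\<^sub>v (A *\<^sub>v y) = 0\<^sub>v m"
      "c \<cdot>\<^sub>v (A *\<^sub>v x) + (- b) \<cdot>\<^sub>v (H *\<^sub>v y) = 0\<^sub>v m"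
      using xy H A by (subst (asm) append_vec_eq[of _ m]; simp)+
    have "a * (x \<bullet> (H *\<^sub>v x)) + c * (x \<bullet> (A *\<^sub>v y)) = 0"
      using arg_cong[OF eqs(1), of "\<lambda>w. x \<bullet> w"] xy H A by (simp add: scalar_prod_add_distrib[of _ m])
    moreover have "c * (y \<bullet> (A *\<^sub>v x)) - b * (y \<bullet> (H *\<^sub>v y)) = 0"
      using arg_cong[OF eqs(2), of "\<lambda>w. y \<bullet> w"] xy H A by (simp add: scalar_prod_add_distrib[of _ m])
    ultimately have sum0: "a * (x \<bullet> (H *\<^sub>v x)) + b * (y \<bullet> (H *\<^sub>v y)) = 0"
      using spd_scalar_prod_commute[OF A xy(1,2)] by simp
    have nonneg: "0 \<le> z \<bullet> (H *\<^sub>v z)" if "z \<in> carrier_vec m" for z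
      using Hpos[of z] that H by (cases "z = 0\<^sub>v m") auto
    have "a * (x \<bullet> (H *\<^sub>v x)) = 0" "b * (y \<bullet> (H *\<^sub>v y)) = 0"
      using sum0 nonneg[OF xy(1)] nonneg[OF xy(2)] a b by (smt (verit) mult_nonneg_nonneg)+
    then have "x = 0\<^sub>v m" "y = 0\<^sub>v m" using Hpos[of x] Hpos[of y] xy a b by auto
    with xy show "v = 0\<^sub>v (m + m)" by (auto intro!: eq_vecI)
  qed
qed

text \<open>Opposite signs of \<open>b1\<close> and \<open>b2\<close> turn
  \<open>- b1 * |b2|\<close> into \<open>|b1| * b2\<close>: the row scaling in (ii) is what makes
  the two coupling blocks coincide.\<close>

lemma system_ii_eq:
  assumes "R $$ (k - 1, k) * R $$ (k, k - 1) < 0"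
  shows "system_ii M A R k = (let H = M + R $$ (k - 1, k - 1) \<cdot>\<^sub>m A;
      c = \<bar>R $$ (k - 1, k)\<bar> * R $$ (k, k - 1)
    in four_block_mat (\<bar>R $$ (k, k - 1)\<bar> \<cdot>\<^sub>m H) (c \<cdot>\<^sub>m A) (c \<cdot>\<^sub>m A) ((- \<bar>R $$ (k - 1, k)\<bar>) \<cdot>\<^sub>m H))"
proof -
  have "- R $$ (k - 1, k) * \<bar>R $$ (k, k - 1)\<bar> = \<bar>R $$ (k - 1, k)\<bar> * R $$ (k, k - 1)"
    using assms by (auto simp: mult_less_0_iff)
  then show ?thesis by (simp add: system_ii_def Let_def)
qed

section \<open>The temporal matrices\<close>

locale temporal_matrices =
  fixes n :: nat and At Mt X Q R :: "real mat"
  assumes n: "0 < n"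
    and At: "At \<in> carrier_mat n n" "spd At" and Mt: "Mt \<in> carrier_mat n n" "positive_definite Mt"
    and X_def: "X = the (mat_inverse At) * Mt" and schur: "real_schur X (Q, R)"
begin

lemma inverse_At:
  "the (mat_inverse At) \<in> carrier_mat n n" "At * the (mat_inverse At) = 1\<^sub>m n"
  "the (mat_inverse At) * At = 1\<^sub>m n"
proof -
  have "det At \<noteq> 0"
  proof
    assume "det At = 0"
    then obtain v where "v \<in> carrier_vec n" "v \<noteq> 0\<^sub>v n" "At *\<^sub>v v = 0\<^sub>v n"
      using det_0_iff_vec_prod_zero[OF At(1)] by auto
    moreover from this have "0 < v \<bullet> (At *\<^sub>v v)"
      using At by (auto simp: spd_def positive_definite_def)
    ultimately show False by simp
  qed
  then have "At \<in> Units (ring_mat TYPE(real) n ())" by (rule det_non_zero_imp_unit[OF At(1)])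
  then obtain B where "mat_inverse At = Some B" using mat_inverse(1)[OF At(1)] by fastforce
  then show "the (mat_inverse At) \<in> carrier_mat n n" "At * the (mat_inverse At) = 1\<^sub>m n"
    "the (mat_inverse At) * At = 1\<^sub>m n" using mat_inverse(2)[OF At(1)] by auto
qed

lemma X: "X \<in> carrier_mat n n" and At_X: "At * X = Mt"
proof -
  show "X \<in> carrier_mat n n" using inverse_At Mt by (simp add: X_def)
  have "At * X = (At * the (mat_inverse At)) * Mt"
    unfolding X_def using At Mt inverse_At by (subst assoc_mult_mat[of _ n n _ n _ n]) auto
  then show "At * X = Mt" using inverse_At Mt by simp
qed

lemma Q: "Q \<in> carrier_mat n n" and R: "R \<in> carrier_mat n n"
  and Q_orth: "transpose_mat Q * Q = 1\<^sub>m n" "Q * transpose_mat Q = 1\<^sub>m n"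
  and R_quasi: "standardized_quasi_triangular R" and X_eq: "X = Q * R * transpose_mat Q"
  using schur X by (auto simp: real_schur_def inverts_mat_def)

lemma At_Q_R: "At * Q * R = Mt * Q"
proof -
  have "Mt * Q = At * (Q * R * transpose_mat Q) * Q" using At_X X_eq by simp
  also have "\<dots> = At * Q * R * (transpose_mat Q * Q)"
    using At Q R by (simp add: assoc_mult_mat[of _ n n _ n _ n])
  finally show ?thesis using At Q R by (simp add: Q_orth)
qed

text \<open>\<open>p\<close> and \<open>Suc k\<close> are both loop values, hence boundaries, which
  gives the zero patterns \<open>left\<close> and \<open>below\<close>. Positivity of
  \<open>S * R\<close> comes from its being congruent to \<open>Mt\<close>.\<close>

lemma diagonal_block:
  assumes v: "visited R (Suc k)" and pv: "visited R p" and pk: "p \<le> k"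
  defines "S \<equiv> transpose_mat Q * At * Q"
  shows "diagonal_block n p k (\<lambda>i j. S $$ (i, j)) (\<lambda>i j. R $$ (i, j))"
proof
  have S: "S \<in> carrier_mat n n" using At Q by (simp add: S_def)
  show k: "k < n" using visited_le[OF v] R by auto
  show "pos_def_on {..<n} (\<lambda>i j. S $$ (i, j))"
    using positive_definite_congruence[OF At(1) _ Q Q_orth(1)] At S
    by (simp add: pos_def_on_iff_positive_definite S_def spd_def)
  have "S * R = transpose_mat Q * Mt * Q"
    using At Mt Q R At_Q_R by (simp add: S_def assoc_mult_mat[of _ n n _ n _ n])
  then have "pos_def_on {..<n} (\<lambda>i j. (S * R) $$ (i, j))"
    using positive_definite_congruence[OF Mt Q Q_orth(1)] S R Q Mt
    by (subst pos_def_on_iff_positive_definite) auto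
  then show "pos_def_on {..<n} (\<lambda>i l. \<Sum>q<n. S $$ (i, q) * R $$ (q, l))"
    using S R by (subst (asm) pos_def_on_cong) (auto simp: scalar_prod_def lessThan_atLeast0)
  show "R $$ (q, l) = 0" if "k < q" "q < n" "l \<le> k" for q l
    using visited_block_zero[OF R_quasi v, of q l] that R by auto
  show "R $$ (q, l) = 0" if "p \<le> q" "q < n" "l < p" for q l
    using visited_block_zero[OF R_quasi pv, of q l] that R by auto
qed (rule pk)

lemma single_pos:
  assumes "visited R (Suc k)" "starts_single R k"
  shows "0 < R $$ (k, k)"
  using diagonal_block.single_block_pos[OF diagonal_block[OF assms(1), of k]]
    visited.single[OF assms] by simp

lemma double_pos:
  assumes "visited R (Suc k)" "\<not> starts_single R k"
  shows "0 < R $$ (k - 1, k - 1)"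
proof -
  note blk = not_starts_singleD[OF R_quasi assms]
  define S where "S = transpose_mat Q * At * Q"
  have S: "S \<in> carrier_mat n n" using At Q by (simp add: S_def)
  have "transpose_mat S = S"
    using At Q unfolding S_def
    by (simp add: transpose_mult[of _ n n _ n] assoc_mult_mat[of _ n n _ n _ n] spd_def symmetric_matrix_def)
  then have sym: "S $$ (i, j) = S $$ (j, i)" if "i < n" "j < n" for i j
    using S that by (metis carrier_matD index_transpose_mat(1))
  interpret diagonal_block n "k - 1" k "\<lambda>i j. S $$ (i, j)" "\<lambda>i j. R $$ (i, j)"
    unfolding S_def using diagonal_block[OF assms(1)] visited.double[OF assms] by simp
  show ?thesis by (rule double_block_pos) (use blk sym in auto)
qed

lemma spd_system_i:
  assumes "spd M" "M \<in> carrier_mat m m" "spd A" "A \<in> carrier_mat m m"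
    and "visited R (Suc k)" "starts_single R k"
  shows "spd (system_i M A R k)"
  unfolding system_i_def using assms single_pos by (intro spd_add_smult) auto

lemma system_ii:
  assumes MA: "spd M" "M \<in> carrier_mat m m" "spd A" "A \<in> carrier_mat m m" and m: "0 < m"
    and v: "visited R (Suc k)" "\<not> starts_single R k"
  shows "symmetric_matrix (system_ii M A R k)" "indefinite (system_ii M A R k)"
    "uniquely_solvable (system_ii M A R k)"
proof -
  note k = not_starts_singleD[OF R_quasi v]
  have "spd (M + R $$ (k - 1, k - 1) \<cdot>\<^sub>m A)" using MA double_pos[OF v] by (intro spd_add_smult)
  note * = coupled_system[OF this _ MA(3,4) m, of "\<bar>R $$ (k, k - 1)\<bar>" "\<bar>R $$ (k - 1, k)\<bar>"]
  show "symmetric_matrix (system_ii M A R k)" "indefinite (system_ii M A R k)"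
    "uniquely_solvable (system_ii M A R k)"
    unfolding system_ii_eq[OF k(4)] Let_def by (rule *; use MA k(4) in fastforce)+
qed

end

section \<open>Kronecker products\<close>

lemma sum_div_mod:
  fixes f :: "nat \<Rightarrow> nat \<Rightarrow> real"
  assumes "0 < m"
  shows "(\<Sum>s<n * m. f (s div m) (s mod m)) = (\<Sum>b<n. \<Sum>a<m. f b a)"
proof -
  have "(\<Sum>s<n * m. f (s div m) (s mod m)) =
      (\<Sum>b<n. \<Sum>s\<in>{b * m..<b * m + m}. f (s div m) (s mod m))"
    by (rule sum.nat_group[symmetric])
  also have "\<dots> = (\<Sum>b<n. \<Sum>a<m. f b a)"
    using assms by (subst sum.atLeastLessThan_shift_0) (simp add: lessThan_atLeast0)
  finally show ?thesis .
qed

lemma kronecker_carrier [simp]: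
  "A \<in> carrier_mat a b \<Longrightarrow> B \<in> carrier_mat c d \<Longrightarrow> A \<otimes>\<^sub>K B \<in> carrier_mat (a * c) (b * d)"
  by (auto simp: kronecker_def)

lemma stack_cols_carrier [simp]: "U \<in> carrier_mat m n \<Longrightarrow> stack_cols U \<in> carrier_vec (n * m)"
  by (auto simp: stack_cols_def mult.commute)

text \<open>Turns the Kronecker system into a matrix equation. Entry \<open>(a, b)\<close> of
  \<open>U\<close> sits at position \<open>b * m + a\<close> of the stacked vector, so
  \<open>div m\<close> recovers the column and \<open>mod m\<close> the row, matching the indexing
  of the Kronecker product.\<close>

lemma kronecker_mult_stack_cols:
  assumes B: "B \<in> carrier_mat n n" and C: "C \<in> carrier_mat m m" and U: "U \<in> carrier_mat m n"
    and m: "0 < m"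
  shows "(B \<otimes>\<^sub>K C) *\<^sub>v stack_cols U = stack_cols (C * U * transpose_mat B)"
proof (rule eq_vecI)
  fix r assume "r < dim_vec (stack_cols (C * U * transpose_mat B))"
  then have r: "r < n * m" using B C U by (simp add: stack_cols_def mult.commute)
  then have r': "r div m < n" "r mod m < m" using m by (auto simp: less_mult_imp_div_less)
  have "((B \<otimes>\<^sub>K C) *\<^sub>v stack_cols U) $ r =
      (\<Sum>s<n * m. B $$ (r div m, s div m) * C $$ (r mod m, s mod m) * U $$ (s mod m, s div m))"
    using B C U r by (simp add: kronecker_def stack_cols_def scalar_prod_def lessThan_atLeast0 mult.commute)
  also have "\<dots> = (\<Sum>b<n. \<Sum>a<m. B $$ (r div m, b) * C $$ (r mod m, a) * U $$ (a, b))"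
    by (rule sum_div_mod[OF m])
  also have "\<dots> = (C * U * transpose_mat B) $$ (r mod m, r div m)"
    using B C U r'
    by (subst sum.swap)
      (simp add: scalar_prod_def lessThan_atLeast0 sum_distrib_left sum_distrib_right mult_ac)
  finally show "((B \<otimes>\<^sub>K C) *\<^sub>v stack_cols U) $ r = stack_cols (C * U * transpose_mat B) $ r"
    using B C U r by (simp add: stack_cols_def mult.commute)
qed (use B C U in \<open>simp add: kronecker_def stack_cols_def\<close>)

lemma div_mod_less: "i < m * n \<Longrightarrow> i mod m < m \<and> i div m < n" for i m n :: nat
  by (cases m) (auto simp: less_mult_imp_div_less mult.commute)

lemma stack_cols_add:
  "U \<in> carrier_mat m n \<Longrightarrow> V \<in> carrier_mat m n \<Longrightarrow> stack_cols U + stack_cols V = stack_cols (U + V)"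
  by (intro eq_vecI) (auto simp: stack_cols_def dest: div_mod_less)

lemma stack_unstack_cols:
  assumes "v \<in> carrier_vec (n * m)"
  shows "stack_cols (unstack_cols m n v) = v"
  using assms by (intro eq_vecI)
    (auto simp: stack_cols_def unstack_cols_def mult.commute dest: div_mod_less)

section \<open>Operations of the algorithm\<close>

lemma val_mat_mult:
  assumes "A \<in> carrier_mat a b" "B \<in> carrier_mat b c"
  shows "val (mat_mult A B) = A * B"
  using assms by (intro eq_matI)
    (auto simp: mat_mult_def sum_list_map_upt arith_op_defs scalar_prod_def)

lemma val_sparse_mult_vec:
  assumes "A \<in> carrier_mat a b" "x \<in> carrier_vec b"
  shows "val (sparse_mult_vec (Sparse A) x) = A *\<^sub>v x"
proof (rule eq_vecI)
  fix i assume "i < dim_vec (A *\<^sub>v x)"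
  moreover have "(\<Sum>j\<leftarrow>filter (\<lambda>j. A $$ (i, j) \<noteq> 0) [0..<b]. A $$ (i, j) * x $ j) =
      (\<Sum>j\<leftarrow>[0..<b]. A $$ (i, j) * x $ j)"
    by (rule sum_list_map_filter) auto
  ultimately show "val (sparse_mult_vec (Sparse A) x) $ i = (A *\<^sub>v x) $ i"
    using assms by (simp add: arith_op_defs scalar_prod_def sum_list_map_upt)
qed (use assms in simp)

lemma val_reduced_rhs:
  assumes A: "A \<in> carrier_mat m m" and R: "dim_col R = n" and G: "G \<in> carrier_mat m n"
    and Z: "Z \<in> carrier_mat m n" and k: "k < n" and l: "l \<le> n"
  shows "val (reduced_rhs (Sparse A) R G Z k l) =
    vec m (\<lambda>i. G $$ (i, k) - (\<Sum>j=l..<n. R $$ (k, j) * (A *\<^sub>v col Z j) $ i))"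
proof -
  define f where
    "f j r = vec (dim_vec r) (\<lambda>i. r $ i - R $$ (k, j) * (val (sparse_mult_vec (Sparse A) (col Z j)) $ i))"
    for j r
  have "fold f [l..<n] (col G k) =
      vec m (\<lambda>i. G $$ (i, k) - (\<Sum>j=l..<n. R $$ (k, j) * (A *\<^sub>v col Z j) $ i))"
    using l
  proof (rule fold_upt_invariant)
    fix q r assume q: "l \<le> q" "q < n"
      and r: "r = vec m (\<lambda>i. G $$ (i, k) - (\<Sum>j=l..<q. R $$ (k, j) * (A *\<^sub>v col Z j) $ i))"
    have "col Z q \<in> carrier_vec m" using Z q by auto
    then show "f q r = vec m (\<lambda>i. G $$ (i, k) - (\<Sum>j=l..<Suc q. R $$ (k, j) * (A *\<^sub>v col Z j) $ i))"
      using A q unfolding r by (auto simp: f_def val_sparse_mult_vec[of A m m] simp del: sparse_mult_vec.simps)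
  qed (use G k in auto)
  then show ?thesis
    using R by (simp add: reduced_rhs_def val_for_each f_def[abs_def] arith_op_defs del: sparse_mult_vec.simps)
qed

lemma set_joint_pattern:
  assumes "M \<in> carrier_mat m m"
  shows "set (joint_pattern M A) = {(i, j). i < m \<and> j < m \<and> (M $$ (i, j) \<noteq> 0 \<or> A $$ (i, j) \<noteq> 0)}"
  using assms by (auto simp: joint_pattern_def)

lemma val_assemble_i:
  assumes "M \<in> carrier_mat m m" "A \<in> carrier_mat m m"
  shows "val (assemble_i (Sparse M) (Sparse A) R k) = Sparse (system_i M A R k)"
  using assms by (auto simp: set_joint_pattern[of M m] arith_op_defs system_i_def intro!: eq_matI)

text \<open>Membership is decided by undoing the shift by \<open>m\<close>. A position outside the
  list lies over a common zero of \<open>M\<close> and \<open>A\<close>, where all four blocks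
  vanish, so leaving it at zero is correct.\<close>

lemma set_block_pattern:
  assumes "M \<in> carrier_mat m m" "i < 2 * m" "j < 2 * m"
  shows "(i, j) \<in> set (concat (map (\<lambda>(i, j). [(i, j), (i, j + m), (i + m, j), (i + m, j + m)])
      (joint_pattern M A))) \<longleftrightarrow>
    ((if i < m then i else i - m), (if j < m then j else j - m)) \<in> set (joint_pattern M A)"
    (is "?l \<longleftrightarrow> ?r")
proof
  assume ?l
  then obtain a b where ab: "(a, b) \<in> set (joint_pattern M A)" "i = a \<or> i = a + m" "j = b \<or> j = b + m"
    by auto
  moreover from ab(1) have "a < m" "b < m" using assms by (auto simp: set_joint_pattern[of M m])
  ultimately show ?r by auto
next
  assume ?r
  then show ?l by (auto intro!: bexI[rotated] split: if_splits)
qed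

lemma val_assemble_ii:
  assumes "M \<in> carrier_mat m m" "A \<in> carrier_mat m m"
  shows "val (assemble_ii (Sparse M) (Sparse A) R k) = Sparse (system_ii M A R k)"
proof -
  have "val (assemble_ii (Sparse M) (Sparse A) R k) = Sparse B \<Longrightarrow> B = system_ii M A R k" for B
    using assms
    by (auto simp: Let_def arith_op_defs set_block_pattern[OF assms(1)] set_joint_pattern[of M m]
        system_ii_def simp del: set_concat intro!: eq_matI)
  then show ?thesis by (cases "val (assemble_ii (Sparse M) (Sparse A) R k)") simp
qed

section \<open>Correctness\<close>

locale bartels_stewart_problem = temporal_matrices +
  fixes m :: nat and M A :: "real mat" and solve :: spatial_solver
    and schur_alg :: "real mat \<Rightarrow> (real mat \<times> real mat) comp"
  assumes m: "0 < m" and M: "spd M" "M \<in> carrier_mat m m" and A: "spd A" "A \<in> carrier_mat m m"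
    and schur_alg: "val (schur_alg X) = (Q, R)"
    and solve: "\<And>S b. \<lbrakk>S \<in> systems_i M A R \<union> systems_ii M A R; uniquely_solvable S;
      b \<in> carrier_vec (dim_row S)\<rbrakk> \<Longrightarrow>
      val (solve (Sparse S) b) \<in> carrier_vec (dim_col S) \<and> S *\<^sub>v val (solve (Sparse S) b) = b"
begin

lemma system_i_carrier [simp]: "system_i M A R k \<in> carrier_mat m m"
  using M A by (simp add: system_i_def)

lemma system_ii_carrier [simp]: "system_ii M A R k \<in> carrier_mat (2 * m) (2 * m)"
  using M A by (auto simp: system_ii_def Let_def)

lemma solve_system_i:
  assumes "visited R (Suc k)" "starts_single R k" "b \<in> carrier_vec m"
  shows "val (solve (Sparse (system_i M A R k)) b) \<in> carrier_vec m"
    "system_i M A R k *\<^sub>v val (solve (Sparse (system_i M A R k)) b) = b"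
proof -
  have "uniquely_solvable (system_i M A R k)"
    using spd_system_i[OF M A assms(1,2)]
    by (intro uniquely_solvable_positive_definite[of _ m]) (auto simp: spd_def)
  moreover have "system_i M A R k \<in> systems_i M A R" using assms by (auto simp: systems_i_def)
  ultimately show "val (solve (Sparse (system_i M A R k)) b) \<in> carrier_vec m"
    "system_i M A R k *\<^sub>v val (solve (Sparse (system_i M A R k)) b) = b"
    using solve[of "system_i M A R k" b] assms(3) carrier_matD[OF system_i_carrier] by auto
qed

lemma solve_system_ii:
  assumes "visited R (Suc k)" "\<not> starts_single R k" "b \<in> carrier_vec (2 * m)"
  shows "val (solve (Sparse (system_ii M A R k)) b) \<in> carrier_vec (2 * m)"
    "system_ii M A R k *\<^sub>v val (solve (Sparse (system_ii M A R k)) b) = b"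
proof -
  have "system_ii M A R k \<in> systems_ii M A R" using assms by (auto simp: systems_ii_def)
  then show "val (solve (Sparse (system_ii M A R k)) b) \<in> carrier_vec (2 * m)"
    "system_ii M A R k *\<^sub>v val (solve (Sparse (system_ii M A R k)) b) = b"
    using solve[of "system_ii M A R k" b] system_ii(3)[OF M A m assms(1,2)] assms(3)
      carrier_matD[OF system_ii_carrier] by auto
qed

text \<open>Column \<open>q\<close> of \<open>M * Z + A * Z * transpose_mat R = G\<close>, in
  entries. The sum may run over all \<open>j\<close>: columns left of the block of \<open>q\<close>,
  not yet computed when \<open>q\<close> is, have coefficient zero.\<close>

definition column_eq :: "real mat \<Rightarrow> real mat \<Rightarrow> nat \<Rightarrow> bool" where
  "column_eq G Z q \<longleftrightarrow> (\<forall>i<m. (M *\<^sub>v col Z q) $ i + (\<Sum>j<n. R $$ (q, j) * (A *\<^sub>v col Z j) $ i) = G $$ (i, q))"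

text \<open>Columns with coefficient zero may be overwritten freely. This preserves finished
  equations while columns further left are computed.\<close>

lemma column_eq_cong:
  assumes "column_eq G Z q" "col Z' q = col Z q"
    and "\<And>j. j < n \<Longrightarrow> R $$ (q, j) \<noteq> 0 \<Longrightarrow> col Z' j = col Z j"
  shows "column_eq G Z' q"
proof -
  have "(\<Sum>j<n. R $$ (q, j) * (A *\<^sub>v col Z' j) $ i) = (\<Sum>j<n. R $$ (q, j) * (A *\<^sub>v col Z j) $ i)" for i
  proof (intro sum.cong refl)
    fix j assume "j \<in> {..<n}"
    then show "R $$ (q, j) * (A *\<^sub>v col Z' j) $ i = R $$ (q, j) * (A *\<^sub>v col Z j) $ i"
      using assms(3)[of j] by (cases "R $$ (q, j) = 0") auto
  qed
  then show ?thesis using assms(1,2) by (simp add: column_eq_def)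
qed

lemma set_col_carrier [simp]: "Z \<in> carrier_mat m n \<Longrightarrow> set_col Z k z \<in> carrier_mat m n"
  by (simp add: set_col_def)

lemma col_set_col:
  assumes "Z \<in> carrier_mat m n" "j < n" "z \<in> carrier_vec m"
  shows "col (set_col Z k z) j = (if j = k then z else col Z j)"
  using assms by (intro eq_vecI) (auto simp: set_col_def)

lemma step_i:
  assumes G: "G \<in> carrier_mat m n" and Z: "Z \<in> carrier_mat m n"
    and k: "visited R (Suc k)" "starts_single R k"
  defines "Z' \<equiv> val (step_i solve (Sparse M) (Sparse A) R G k Z)"
  shows "Z' \<in> carrier_mat m n" "\<And>j. j < n \<Longrightarrow> j \<noteq> k \<Longrightarrow> col Z' j = col Z j" "column_eq G Z' k"
proof -
  have kn: "k < n" using visited_le[OF k(1)] R by auto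
  define b where "b = val (reduced_rhs (Sparse A) R G Z k (Suc k))"
  have b: "b = vec m (\<lambda>i. G $$ (i, k) - (\<Sum>j=Suc k..<n. R $$ (k, j) * (A *\<^sub>v col Z j) $ i))"
    unfolding b_def using A R G Z kn by (intro val_reduced_rhs) auto
  define z where "z = val (solve (Sparse (system_i M A R k)) b)"
  have z: "z \<in> carrier_vec m" "system_i M A R k *\<^sub>v z = b"
    unfolding z_def by (rule solve_system_i[OF k]; simp add: b)+
  have Z': "Z' = set_col Z k z"
    unfolding Z'_def step_i_def comp_sel_bind val_assemble_i[OF M(2) A(2)]
    by (simp add: z_def b_def)
  show "Z' \<in> carrier_mat m n" using Z by (simp add: Z')
  show other: "col Z' j = col Z j" if "j < n" "j \<noteq> k" for j
    using Z z that by (simp add: Z' col_set_col)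
  have colk: "col Z' k = z" using Z z kn by (simp add: Z' col_set_col)
  show "column_eq G Z' k" unfolding column_eq_def
  proof (intro allI impI)
    fix i assume i: "i < m"
    have "(M *\<^sub>v z) $ i + R $$ (k, k) * (A *\<^sub>v z) $ i = (system_i M A R k *\<^sub>v z) $ i"
      using M A z(1) i unfolding system_i_def
      by (simp add: add_mult_distrib_mat_vec[of _ m m] smult_mat_mult_vec[of _ m m] del: index_mult_mat_vec)
    also have "\<dots> = G $$ (i, k) - (\<Sum>j=Suc k..<n. R $$ (k, j) * (A *\<^sub>v col Z j) $ i)"
      using i by (simp add: z b)
    finally have eq: "(M *\<^sub>v z) $ i + R $$ (k, k) * (A *\<^sub>v z) $ i +
      (\<Sum>j=Suc k..<n. R $$ (k, j) * (A *\<^sub>v col Z j) $ i) = G $$ (i, k)" by simp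
    \<comment> \<open>\<open>k\<close> is a boundary, so row \<open>k\<close> has no entries left of
      the diagonal.\<close>
    have "(\<Sum>j=0..<k. R $$ (k, j) * (A *\<^sub>v col Z' j) $ i) = 0"
      using visited_block_zero[OF R_quasi visited.single[OF k]] kn R by (intro sum.neutral) auto
    moreover have "(\<Sum>j=Suc k..<n. R $$ (k, j) * (A *\<^sub>v col Z' j) $ i) =
        (\<Sum>j=Suc k..<n. R $$ (k, j) * (A *\<^sub>v col Z j) $ i)"
      using other by (intro sum.cong) auto
    ultimately show "(M *\<^sub>v col Z' k) $ i + (\<Sum>j<n. R $$ (k, j) * (A *\<^sub>v col Z' j) $ i) = G $$ (i, k)"
      using eq by (simp add: sum_split_at[OF kn] colk)
  qed
qed

text \<open>The second half \<open>w\<close> of the solver's result is the negative of the new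
  column \<open>z\<close>. Cancelling the nonzero factors \<open>|b2|\<close> and
  \<open>|b1|\<close> from the two block rows recovers the coupled equations of the columns
  \<open>k - 1\<close> and \<open>k\<close>.\<close>

lemma step_ii:
  assumes G: "G \<in> carrier_mat m n" and Z: "Z \<in> carrier_mat m n"
    and k: "visited R (Suc k)" "\<not> starts_single R k"
  defines "Z' \<equiv> val (step_ii solve (Sparse M) (Sparse A) R G k Z)"
  shows "Z' \<in> carrier_mat m n" "\<And>j. j < n \<Longrightarrow> j \<noteq> k - 1 \<Longrightarrow> j \<noteq> k \<Longrightarrow> col Z' j = col Z j"
    "column_eq G Z' (k - 1)" "column_eq G Z' k"
proof -
  note blk = not_starts_singleD[OF R_quasi k]
  have kn: "k < n" using blk R by auto
  define p where "p = k - 1"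
  have kp: "k = Suc p" and pn: "p < n" using blk kn by (auto simp: p_def)
  define b1 where "b1 = R $$ (p, k)"
  define b2 where "b2 = R $$ (k, p)"
  define \<alpha> where "\<alpha> = R $$ (p, p)"
  have b12: "b1 * b2 < 0" "b1 \<noteq> 0" "b2 \<noteq> 0" and akk: "R $$ (k, k) = \<alpha>"
    using blk by (auto simp: b1_def b2_def \<alpha>_def p_def)
  define rest where "rest q i = G $$ (i, q) - (\<Sum>j=Suc k..<n. R $$ (q, j) * (A *\<^sub>v col Z j) $ i)" for q i
  have r: "val (reduced_rhs (Sparse A) R G Z q (Suc k)) = vec m (rest q)" if "q < n" for q
    unfolding rest_def using A R G Z kn that by (intro val_reduced_rhs) auto
  define b where "b = vec (2 * m) (\<lambda>i. if i < m then \<bar>b2\<bar> * rest p i else \<bar>b1\<bar> * rest k (i - m))"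
  define y where "y = val (solve (Sparse (system_ii M A R k)) b)"
  define x where "x = vec_first y m"
  define w where "w = vec_last y m"
  define z where "z = vec m (\<lambda>i. - (y $ (i + m)))"
  have y: "y \<in> carrier_vec (2 * m)" "system_ii M A R k *\<^sub>v y = b"
    unfolding y_def by (rule solve_system_ii[OF k]; simp add: b_def)+
  have xw: "x \<in> carrier_vec m" "w \<in> carrier_vec m" "y = x @\<^sub>v w"
    using y(1) vec_first_last_append[of y m m] by (simp_all add: x_def w_def mult_2)
  have zw: "z = - w"
    using y(1) by (intro eq_vecI) (auto simp: w_def z_def vec_last_def add.commute)
  have z: "z \<in> carrier_vec m" by (simp add: z_def)
  have Z': "Z' = set_col (set_col Z p x) k z"
  proof -
    have "vec (2 * m) (\<lambda>i. if i < m then \<bar>b2\<bar> * vec m (rest p) $ i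
        else \<bar>b1\<bar> * vec m (rest k) $ (i - m)) = b"
      unfolding b_def by (intro eq_vecI) auto
    then show ?thesis
      using G r[OF kn] r[OF pn]
      unfolding Z'_def step_ii_def Let_def comp_sel_bind val_assemble_ii[OF M(2) A(2)]
      by (simp add: arith_op_defs if_distrib[of val] x_def z_def y_def
          del: One_nat_def cong: if_cong flip: p_def b1_def b2_def)
  qed
  show "Z' \<in> carrier_mat m n" using Z by (simp add: Z')
  have other: "col Z' j = col Z j" if "j < n" "j \<noteq> p" "j \<noteq> k" for j
    using Z z xw that by (simp add: Z' col_set_col)
  then show "col Z' j = col Z j" if "j < n" "j \<noteq> k - 1" "j \<noteq> k" for j
    using that by (simp add: p_def)
  have colp: "col Z' p = x" and colk: "col Z' k = z"
    using Z z xw kn pn kp by (auto simp: Z' col_set_col)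
  define H where "H = M + \<alpha> \<cdot>\<^sub>m A"
  have H: "H \<in> carrier_mat m m" using M A by (simp add: H_def)
  have Hv: "(H *\<^sub>v v) $ i = (M *\<^sub>v v) $ i + \<alpha> * (A *\<^sub>v v) $ i" if "v \<in> carrier_vec m" "i < m" for v i
    using M A that unfolding H_def
    by (simp add: add_mult_distrib_mat_vec[of _ m m] smult_mat_mult_vec[of _ m m] del: index_mult_mat_vec)
  let ?c = "\<bar>b1\<bar> * b2"
  have sys: "system_ii M A R k = four_block_mat (\<bar>b2\<bar> \<cdot>\<^sub>m H) (?c \<cdot>\<^sub>m A) (?c \<cdot>\<^sub>m A) ((- \<bar>b1\<bar>) \<cdot>\<^sub>m H)"
    using system_ii_eq[OF blk(4), of M A] by (simp add: Let_def H_def b1_def b2_def \<alpha>_def p_def)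
  have "(\<bar>b2\<bar> \<cdot>\<^sub>v (H *\<^sub>v x) + ?c \<cdot>\<^sub>v (A *\<^sub>v w)) @\<^sub>v (?c \<cdot>\<^sub>v (A *\<^sub>v x) + (- \<bar>b1\<bar>) \<cdot>\<^sub>v (H *\<^sub>v w)) = b"
    using y(2) H A xw unfolding sys xw(3)
    by (subst (asm) four_block_mat_mult_vec[of _ m m _ m _ m]) (auto simp: smult_mat_mult_vec[of _ m m])
  moreover have "b = vec m (\<lambda>i. \<bar>b2\<bar> * rest p i) @\<^sub>v vec m (\<lambda>i. \<bar>b1\<bar> * rest k i)"
    by (intro eq_vecI) (auto simp: b_def)
  ultimately have parts: "\<bar>b2\<bar> \<cdot>\<^sub>v (H *\<^sub>v x) + ?c \<cdot>\<^sub>v (A *\<^sub>v w) = vec m (\<lambda>i. \<bar>b2\<bar> * rest p i)"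
    "?c \<cdot>\<^sub>v (A *\<^sub>v x) + (- \<bar>b1\<bar>) \<cdot>\<^sub>v (H *\<^sub>v w) = vec m (\<lambda>i. \<bar>b1\<bar> * rest k i)"
    using append_vec_eq[of "\<bar>b2\<bar> \<cdot>\<^sub>v (H *\<^sub>v x) + ?c \<cdot>\<^sub>v (A *\<^sub>v w)" m "vec m (\<lambda>i. \<bar>b2\<bar> * rest p i)"] H A xw
    by auto
  have neg: "(B *\<^sub>v z) $ i = - (B *\<^sub>v w) $ i" if "B \<in> carrier_mat m m" "i < m" for B i
    using that xw(2) by (simp add: zw)
  have eqp: "(M *\<^sub>v x) $ i + \<alpha> * (A *\<^sub>v x) $ i + b1 * (A *\<^sub>v z) $ i = rest p i" if i: "i < m" for i
  proof -
    \<comment> \<open>In this form the coupling coefficient contains \<open>|b2|\<close>, which can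
      then be cancelled from the whole first block row.\<close>
    have c: "?c = - b1 * \<bar>b2\<bar>" using b12 by (auto simp: mult_less_0_iff)
    have "\<bar>b2\<bar> * (H *\<^sub>v x) $ i + ?c * (A *\<^sub>v w) $ i = \<bar>b2\<bar> * rest p i"
      using arg_cong[OF parts(1), of "\<lambda>v. v $ i"] i H A xw by (simp del: index_mult_mat_vec)
    then have "\<bar>b2\<bar> * ((H *\<^sub>v x) $ i + b1 * (A *\<^sub>v z) $ i) = \<bar>b2\<bar> * rest p i"
      using i A unfolding c by (simp add: neg algebra_simps del: index_mult_mat_vec)
    then show ?thesis using b12 Hv[OF xw(1) i] by simp
  qed
  have eqk: "(M *\<^sub>v z) $ i + b2 * (A *\<^sub>v x) $ i + \<alpha> * (A *\<^sub>v z) $ i = rest k i" if i: "i < m" for i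
  proof -
    have "?c * (A *\<^sub>v x) $ i - \<bar>b1\<bar> * (H *\<^sub>v w) $ i = \<bar>b1\<bar> * rest k i"
      using arg_cong[OF parts(2), of "\<lambda>v. v $ i"] i H A xw by (simp del: index_mult_mat_vec)
    then have "\<bar>b1\<bar> * (b2 * (A *\<^sub>v x) $ i + (H *\<^sub>v z) $ i) = \<bar>b1\<bar> * rest k i"
      using i H by (simp add: neg algebra_simps del: index_mult_mat_vec)
    then show ?thesis using b12 Hv[OF z i] by simp
  qed
  \<comment> \<open>The row sum is cut at the block: columns before \<open>p\<close> have zero
    coefficients, the two block columns are new, and the columns after \<open>k\<close> are
    unchanged and are those already subtracted in \<open>rest\<close>.\<close>
  have split: "(\<Sum>j<n. R $$ (q, j) * (A *\<^sub>v col Z' j) $ i) =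
      R $$ (q, p) * (A *\<^sub>v x) $ i + R $$ (q, k) * (A *\<^sub>v z) $ i + (G $$ (i, q) - rest q i)"
    if q: "q = p \<or> q = k" for q i
  proof -
    have "visited R p" using visited.double[OF k] by (simp add: p_def)
    then have "(\<Sum>j=0..<p. R $$ (q, j) * (A *\<^sub>v col Z' j) $ i) = 0"
      using visited_block_zero[OF R_quasi, of p q] kn pn kp q R by (intro sum.neutral) auto
    moreover have "(\<Sum>j=Suc k..<n. R $$ (q, j) * (A *\<^sub>v col Z' j) $ i) = G $$ (i, q) - rest q i"
      using other kp by (auto simp: rest_def intro!: sum.cong)
    moreover have "(\<Sum>j=0..<k. R $$ (q, j) * (A *\<^sub>v col Z' j) $ i) =
        (\<Sum>j=0..<p. R $$ (q, j) * (A *\<^sub>v col Z' j) $ i) + R $$ (q, p) * (A *\<^sub>v x) $ i"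
      by (simp add: kp colp del: index_mult_mat_vec)
    ultimately show ?thesis
      by (simp add: sum_split_at[OF kn] colk del: index_mult_mat_vec)
  qed
  show "column_eq G Z' (k - 1)"
    unfolding column_eq_def p_def[symmetric]
  proof (intro allI impI)
    fix i assume "i < m"
    from eqp[OF this] show
      "(M *\<^sub>v col Z' p) $ i + (\<Sum>j<n. R $$ (p, j) * (A *\<^sub>v col Z' j) $ i) = G $$ (i, p)"
      by (simp add: split colp del: index_mult_mat_vec flip: b1_def \<alpha>_def)
  qed
  show "column_eq G Z' k"
    unfolding column_eq_def
  proof (intro allI impI)
    fix i assume "i < m"
    from eqk[OF this] show
      "(M *\<^sub>v col Z' k) $ i + (\<Sum>j<n. R $$ (k, j) * (A *\<^sub>v col Z' j) $ i) = G $$ (i, k)"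
      by (simp add: split colk akk del: index_mult_mat_vec flip: b2_def)
  qed
qed

text \<open>The induction is strong because a 2x2 block lowers \<open>v\<close> by two. As
  \<open>v\<close> is a boundary, the equations of the columns from \<open>v\<close> on do not
  involve the columns that are overwritten later.\<close>

lemma back_substitution_correct:
  assumes G: "G \<in> carrier_mat m n" and "Z \<in> carrier_mat m n" "visited R v"
    and "\<And>q. v \<le> q \<Longrightarrow> q < n \<Longrightarrow> column_eq G Z q"
  shows "val (back_substitution solve (Sparse M) (Sparse A) R G v Z) \<in> carrier_mat m n \<and>
    (\<forall>q<n. column_eq G (val (back_substitution solve (Sparse M) (Sparse A) R G v Z)) q)"
  using assms(2-)
proof (induction v arbitrary: Z rule: less_induct)
  case (less v)
  show ?case
  proof (cases v)
    case 0
    then show ?thesis using less.prems by simp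
  next
    case (Suc k)
    have v: "visited R (Suc k)" using less.prems Suc by simp
    have zero: "R $$ (q, j) = 0" if "Suc k \<le> q" "q < n" "j \<le> k" for q j
      using visited_block_zero[OF R_quasi v, of q j] that R by auto
    have keep: "column_eq G Z' q"
      if q: "Suc k \<le> q" "q < n" and col: "\<And>j. k < j \<Longrightarrow> j < n \<Longrightarrow> col Z' j = col Z j" for Z' q
    proof (rule column_eq_cong)
      show "column_eq G Z q" using less.prems(3)[of q] q Suc by simp
      show "col Z' q = col Z q" using col[of q] q by simp
      show "col Z' j = col Z j" if "j < n" "R $$ (q, j) \<noteq> 0" for j
        using col[of j] zero[OF q, of j] that by (cases "j \<le> k") auto
    qed
    show ?thesis
    proof (cases "starts_single R k")
      case True
      note step = step_i[OF G less.prems(1) v True]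
      have "column_eq G (val (step_i solve (Sparse M) (Sparse A) R G k Z)) q" if "k \<le> q" "q < n" for q
      proof (cases "q = k")
        case False
        with that show ?thesis by (intro keep step(2)) auto
      qed (use step in simp)
      then show ?thesis
        using less.IH[of k, OF _ step(1) visited.single[OF v True]] Suc True by simp
    next
      case False
      note step = step_ii[OF G less.prems(1) v False]
      note k = not_starts_singleD[OF R_quasi v False]
      have "column_eq G (val (step_ii solve (Sparse M) (Sparse A) R G k Z)) q"
        if "k - 1 \<le> q" "q < n" for q
      proof (cases "q = k \<or> q = k - 1")
        case False
        with that show ?thesis by (intro keep step(2)) auto
      qed (use step in auto)
      then show ?thesis
        using less.IH[of "k - 1", OF _ step(1) visited.double[OF v False]] Suc False k(1) by simp
    qed
  qed
qed

lemma back_substitution_eq: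
  assumes G: "G \<in> carrier_mat m n"
  defines "Z \<equiv> val (back_substitution solve (Sparse M) (Sparse A) R G n (0\<^sub>m m n))"
  shows "Z \<in> carrier_mat m n" "M * Z + A * Z * transpose_mat R = G"
proof -
  have "visited R n" using visited.start[of R] R by simp
  from back_substitution_correct[OF G _ this, of "0\<^sub>m m n"]
  have Z: "Z \<in> carrier_mat m n" "\<And>q. q < n \<Longrightarrow> column_eq G Z q" by (auto simp: Z_def)
  show "Z \<in> carrier_mat m n" by (rule Z)
  show "M * Z + A * Z * transpose_mat R = G"
  proof (rule eq_matI)
    fix i q assume "i < dim_row G" "q < dim_col G"
    with G have iq: "i < m" "q < n" by auto
    have "(M * Z) $$ (i, q) = (M *\<^sub>v col Z q) $ i" using M Z iq by simp
    moreover have "(A * Z * transpose_mat R) $$ (i, q) = (\<Sum>j<n. (A * Z) $$ (i, j) * R $$ (q, j))"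
    proof -
      have "(W * transpose_mat R) $$ (i, q) = (\<Sum>j<n. W $$ (i, j) * R $$ (q, j))"
        if "W \<in> carrier_mat m n" for W
        using that R iq by (simp add: scalar_prod_def lessThan_atLeast0)
      then show ?thesis using A Z by simp
    qed
    moreover have "(\<Sum>j<n. (A * Z) $$ (i, j) * R $$ (q, j)) = (\<Sum>j<n. R $$ (q, j) * (A *\<^sub>v col Z j) $ i)"
      using A Z iq by (intro sum.cong) auto
    ultimately show "(M * Z + A * Z * transpose_mat R) $$ (i, q) = G $$ (i, q)"
      using Z(2)[OF iq(2)] iq A R Z(1) by (simp add: column_eq_def)
  qed (use A R Z G in auto)
qed

section \<open>Return to the Kronecker system\<close>

abbreviation "inv_At \<equiv> the (mat_inverse At)"

lemma cholesky_solve_At: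
  assumes "b \<in> carrier_vec n"
  shows "val (cholesky_solve (val (cholesky At)) b) = inv_At *\<^sub>v b"
proof -
  note L = cholesky_correct[OF At]
  note x = cholesky_solve_correct[OF L(1-3) assms]
  have "inv_At *\<^sub>v (At *\<^sub>v val (cholesky_solve (val (cholesky At)) b)) =
      val (cholesky_solve (val (cholesky At)) b)"
    using inverse_At At x(1) by (subst assoc_mult_mat_vec[symmetric, of _ n n _ n]) auto
  then show ?thesis using x(2) by (simp add: L(4))
qed

lemma val_cholesky_columns:
  assumes "B \<in> carrier_mat n k"
  shows "mat n k (\<lambda>(i, j). val (cholesky_solve (val (cholesky At)) (col B j)) $ i) = inv_At * B"
  using assms inverse_At by (intro eq_matI) (auto simp: cholesky_solve_At)

lemma val_X_columns:
  "mat n n (\<lambda>(i, j). val (cholesky_solve (val (cholesky At)) (col Mt j)) $ i) = X"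
  unfolding X_def by (rule val_cholesky_columns[OF Mt(1)])

lemma val_rhs_columns:
  assumes "Fh \<in> carrier_mat m n"
  shows "mat n m (\<lambda>(i, j). val (cholesky_solve (val (cholesky At)) (row Fh j)) $ i) =
    inv_At * transpose_mat Fh"
  using assms by (subst val_cholesky_columns[of "transpose_mat Fh" m, symmetric]) (auto intro!: eq_matI)

text \<open>The equation solved by \<open>Z\<close> is multiplied from the right by
  \<open>transpose_mat Q * At\<close>. This turns \<open>Z\<close> into \<open>U\<close> in the
  first term; in the second, the transpose of \<open>At * Q * R = Mt * Q\<close> exchanges
  \<open>R\<close> for \<open>Mt\<close>. The right-hand side becomes \<open>Fh\<close>.\<close>

lemma bartels_stewart_correct:
  assumes F: "F \<in> carrier_vec (n * m)"
  defines "u \<equiv> val (bartels_stewart schur_alg solve At Mt m (Sparse M) (Sparse A) F)"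
  shows "u \<in> carrier_vec (n * m)" "(At \<otimes>\<^sub>K M + Mt \<otimes>\<^sub>K A) *\<^sub>v u = F"
proof -
  define Fh where "Fh = unstack_cols m n F"
  define Y where "Y = inv_At * transpose_mat Fh"
  define G where "G = transpose_mat Y * Q"
  define Z where "Z = val (back_substitution solve (Sparse M) (Sparse A) R G n (0\<^sub>m m n))"
  define U where "U = Z * transpose_mat Q"
  have Fh: "Fh \<in> carrier_mat m n" by (simp add: Fh_def unstack_cols_def)
  have Y: "Y \<in> carrier_mat n m" using Fh inverse_At by (simp add: Y_def)
  have G: "G \<in> carrier_mat m n" using Y Q by (simp add: G_def)
  note Z = back_substitution_eq[OF G, folded Z_def]
  have U: "U \<in> carrier_mat m n" using Z Q by (simp add: U_def)
  have "u = stack_cols U"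
    using At(1) schur_alg val_X_columns val_rhs_columns[OF Fh]
      val_mat_mult[of "transpose_mat Y" m n Q n] val_mat_mult[of Z m n "transpose_mat Q" n]
      Y Z Q
    by (simp add: u_def bartels_stewart_def Let_def U_def Z_def flip: Y_def Fh_def G_def)
  with U show "u \<in> carrier_vec (n * m)" by simp
  \<comment> \<open>\<open>At\<close> is inverted from the left on the transposed data; its symmetry
    allows it to reappear on the right.\<close>
  have "Fh = transpose_mat Y * At"
  proof -
    have "transpose_mat Fh = At * Y"
      unfolding Y_def using At(1) inverse_At Fh
      by (subst assoc_mult_mat[symmetric, of _ n n _ n _ m]) auto
    then have "Fh = transpose_mat (At * Y)" by (metis transpose_transpose)
    also have "\<dots> = transpose_mat Y * transpose_mat At" using At Y by (simp add: transpose_mult)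
    finally show ?thesis using At by (simp add: spd_def symmetric_matrix_def)
  qed
  moreover have "M * U * transpose_mat At + A * U * transpose_mat Mt = G * transpose_mat Q * At"
  proof -
    have "transpose_mat R * transpose_mat Q * At = transpose_mat (At * Q * R)"
      using At Q R by (simp add: transpose_mult[of _ n n _ n] assoc_mult_mat[of _ n n _ n _ n]
          spd_def symmetric_matrix_def)
    also have "\<dots> = transpose_mat Q * transpose_mat Mt"
      using At_Q_R Mt Q by (simp add: transpose_mult[of _ n n _ n])
    finally have *: "transpose_mat R * transpose_mat Q * At = transpose_mat Q * transpose_mat Mt" .
    have "G * transpose_mat Q * At = (M * Z + A * Z * transpose_mat R) * (transpose_mat Q * At)"
      using Z G Q At by (simp add: assoc_mult_mat[of _ m n _ n _ n])
    also have "\<dots> = M * Z * (transpose_mat Q * At) + A * Z * transpose_mat R * (transpose_mat Q * At)"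
      using M A Z(1) R Q At by (intro add_mult_distrib_mat[of _ m n]) auto
    also have "M * Z * (transpose_mat Q * At) = M * U * transpose_mat At"
      using M Z(1) Q At by (simp add: U_def assoc_mult_mat[of _ m m _ n _ n]
          assoc_mult_mat[of _ m n _ n _ n] spd_def symmetric_matrix_def)
    also have "A * Z * transpose_mat R * (transpose_mat Q * At) =
        A * Z * (transpose_mat R * transpose_mat Q * At)"
      using A Z(1) R Q At
      by (subst assoc_mult_mat[of "A * Z" m n _ n _ n]) (auto simp: assoc_mult_mat[of _ n n _ n _ n])
    also have "\<dots> = A * U * transpose_mat Mt"
      unfolding * using A Z(1) Q Mt by (simp add: U_def assoc_mult_mat[of _ m m _ n _ n]
          assoc_mult_mat[of _ m n _ n _ n])
    finally show ?thesis ..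
  qed
  moreover have "G * transpose_mat Q = transpose_mat Y"
    using Y Q by (simp add: G_def assoc_mult_mat[of _ m n _ n _ n] Q_orth)
  ultimately have "M * U * transpose_mat At + A * U * transpose_mat Mt = Fh" by simp
  then have "stack_cols (M * U * transpose_mat At) + stack_cols (A * U * transpose_mat Mt) = F"
    using M A U At Mt F by (simp add: stack_cols_add[of _ m n] stack_unstack_cols Fh_def)
  moreover have "(At \<otimes>\<^sub>K M + Mt \<otimes>\<^sub>K A) *\<^sub>v stack_cols U =
      (At \<otimes>\<^sub>K M) *\<^sub>v stack_cols U + (Mt \<otimes>\<^sub>K A) *\<^sub>v stack_cols U"
    using M A U At Mt by (intro add_mult_distrib_mat_vec[of _ "n * m" "n * m"]) auto
  ultimately show "(At \<otimes>\<^sub>K M + Mt \<otimes>\<^sub>K A) *\<^sub>v u = F"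
    using M A U At Mt m by (simp add: \<open>u = stack_cols U\<close> kronecker_mult_stack_cols)
qed

lemma bartels_stewart_unique:
  assumes "F \<in> carrier_vec (n * m)" "v \<in> carrier_vec (n * m)"
  shows "(At \<otimes>\<^sub>K M + Mt \<otimes>\<^sub>K A) *\<^sub>v v = F \<longleftrightarrow>
    v = val (bartels_stewart schur_alg solve At Mt m (Sparse M) (Sparse A) F)"
proof -
  have K: "At \<otimes>\<^sub>K M + Mt \<otimes>\<^sub>K A \<in> carrier_mat (n * m) (n * m)" using M A At Mt by simp
  have "uniquely_solvable (At \<otimes>\<^sub>K M + Mt \<otimes>\<^sub>K A)"
    using bartels_stewart_correct by (intro uniquely_solvable_if_surjective[OF K]) auto
  then show ?thesis
    using assms bartels_stewart_correct[OF assms(1)] K unfolding uniquely_solvable_def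
    by (metis carrier_matD)
qed

end

section \<open>Costs\<close>

lemma cells_simps [simp]:
  "cells (x :: real) = 1" "cells (v :: 'b vec) = dim_vec v" "cells (A :: 'b mat) = dim_row A * dim_col A"
  "cells (y, z) = cells y + cells z"
  by (simp_all add: cells_real_def cells_vec_def cells_mat_def cells_prod_def)

lemma dim_set_col [simp]: "dim_row (set_col A k v) = dim_row A" "dim_col (set_col A k v) = dim_col A"
  by (simp_all add: set_col_def)

lemma dim_set_entry [simp]: "dim_vec (set_entry v i x) = dim_vec v"
  by (simp add: set_entry_def)

text \<open>\<open>2 * n + 2\<close> bounds a sum of at most \<open>n\<close> products, a
  subtraction and a root or division; it is paid once for the pivot and at most once per entry of
  the column. In the storage bound, one \<open>n * n\<close> is the old factor and the other its
  updated copy.\<close>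

lemma
  assumes "dim_row A = n"
  shows ops_cholesky: "ops (cholesky A) \<le> n * (2 * n + 2 + n * (2 * n + 2))"
    and mem_cholesky: "mem (cholesky A) \<le> 2 * (n * n) + n + 8"
proof -
  define f where "f j L p i = (if i < j then ret 0 else if i = j then ret p
      else do {
        s' \<leftarrow> sum_up [0..<j] (\<lambda>k. mul_op (L $$ (i, k)) (L $$ (j, k)));
        d' \<leftarrow> sub_op (A $$ (i, j)) s';
        div_op d' p
      })" for j i :: nat and p and L :: "real mat"
  have f_ops: "ops (build_vec n (f j L p)) \<le> n * (2 * n + 2)" if "j < n" for j p L
    by (rule ops_build_vec_le) (use that in \<open>auto simp: f_def arith_op_defs(2,4) cost_sum_up_mul\<close>)
  have f_mem: "mem (build_vec n (f j L p)) \<le> n + 3" for j p L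
    by (rule mem_build_vec_le)
      (auto simp: f_def arith_op_defs(2,4) intro: order_trans[OF cost_sum_up_mul(2)])
  have "ops (cholesky A) \<le> length [0..<n] * (2 * n + 2 + n * (2 * n + 2))"
    unfolding cholesky_def assms Let_def f_def[symmetric]
    by (rule for_each_ops_le[where P = "\<lambda>_. True"])
      (auto simp: sub_op_def sqrt_op_def cost_sum_up_mul intro!: order_trans[OF add_left_mono[OF f_ops]])
  then show "ops (cholesky A) \<le> n * (2 * n + 2 + n * (2 * n + 2))" by simp
  have "mem (cholesky A) \<le> n * n + (n * n + n + 8)"
    unfolding cholesky_def assms Let_def f_def[symmetric]
    by (rule for_each_mem_le[where P = "\<lambda>L. L \<in> carrier_mat n n"])
      (auto simp: sub_op_def sqrt_op_def set_col_def
        intro: order_trans[OF cost_sum_up_mul(2)] order_trans[OF f_mem])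
  then show "mem (cholesky A) \<le> 2 * (n * n) + n + 8" by simp
qed

text \<open>Of the three vectors in \<open>3 * n + 5\<close>, one is \<open>y\<close>, kept during
  the backward sweep; the others are the state of that sweep and its updated copy.\<close>

lemma
  assumes "dim_row L = n"
  shows ops_cholesky_solve: "ops (cholesky_solve L b) \<le> 2 * (n * (2 * n + 2))"
    and mem_cholesky_solve: "mem (cholesky_solve L b) \<le> 3 * n + 5"
proof -
  define f where "f i y = do {
       s \<leftarrow> sum_up [0..<i] (\<lambda>j. mul_op (L $$ (i, j)) (y $ j));
       d \<leftarrow> sub_op (b $ i) s;
       q \<leftarrow> div_op d (L $$ (i, i));
       ret (set_entry y i q)
     }" for i y
  define g where "g y i x = do {
       s \<leftarrow> sum_up [Suc i..<n] (\<lambda>j. mul_op (L $$ (j, i)) (x $ j));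
       d \<leftarrow> sub_op (y $ i) s;
       q \<leftarrow> div_op d (L $$ (i, i));
       ret (set_entry x i q)
     }" for y x :: "real vec" and i
  have eq: "cholesky_solve L b = do { y \<leftarrow> for_each [0..<n] f (0\<^sub>v n); for_each (rev [0..<n]) (g y) (0\<^sub>v n) }"
    by (simp add: cholesky_solve_def f_def[abs_def] g_def[abs_def] assms)
  have fm: "mem (f i y) \<le> n + 5" "dim_vec (val (f i y)) = n" if "dim_vec y = n" for i y
    using that by (auto simp: f_def sub_op_def div_op_def intro: order_trans[OF cost_sum_up_mul(2)])
  have gm: "mem (g y i x) \<le> n + 5" "dim_vec (val (g y i x)) = n" if "dim_vec x = n" for i x y
    using that by (auto simp: g_def sub_op_def div_op_def intro: order_trans[OF cost_sum_up_mul(2)])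
  have "ops (for_each [0..<n] f (0\<^sub>v n)) \<le> length [0..<n] * (2 * n + 2)"
    by (rule for_each_ops_le[where P = "\<lambda>_. True"])
      (auto simp: f_def sub_op_def div_op_def cost_sum_up_mul)
  moreover have "ops (for_each (rev [0..<n]) (g y) (0\<^sub>v n)) \<le> length (rev [0..<n]) * (2 * n + 2)" for y
    by (rule for_each_ops_le[where P = "\<lambda>_. True"])
      (auto simp: g_def sub_op_def div_op_def cost_sum_up_mul)
  ultimately show "ops (cholesky_solve L b) \<le> 2 * (n * (2 * n + 2))"
    unfolding eq comp_sel_bind mult_2 by (intro add_mono) auto
  have fmem: "mem (for_each [0..<n] f (0\<^sub>v n)) \<le> n + (n + 5)"
    by (rule for_each_mem_le[where P = "\<lambda>y. dim_vec y = n"]) (auto simp: fm)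
  have gmem: "mem (for_each (rev [0..<n]) (g y) (0\<^sub>v n)) \<le> n + (n + 5)" for y
    by (rule for_each_mem_le[where P = "\<lambda>y. dim_vec y = n"]) (auto simp: gm)
  have "dim_vec (val (for_each [0..<n] f (0\<^sub>v n))) = n"
    unfolding val_for_each
    by (rule fold_upt_invariant[where I = "\<lambda>_ y. dim_vec y = n"]) (auto simp: fm)
  with fmem gmem show "mem (cholesky_solve L b) \<le> 3 * n + 5"
    unfolding eq comp_sel_bind by (auto intro: order_trans)
qed

lemma
  assumes "dim_row A = a" "dim_col A = b" "dim_col B = c"
  shows ops_mat_mult: "ops (mat_mult A B) \<le> c * (a * (2 * b))"
    and mem_mat_mult: "mem (mat_mult A B) \<le> a * c + (a + 2)"
  unfolding mat_mult_def assms
  by (intro ops_build_cols_le ops_build_vec_le; simp add: cost_sum_up_mul)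
    (intro mem_build_cols_le mem_build_vec_le; simp add: cost_sum_up_mul)

lemma nnz_eq_sum:
  "nnz A = (\<Sum>i<dim_row A. length (filter (\<lambda>j. A $$ (i, j) \<noteq> 0) [0..<dim_col A]))"
proof -
  have "{(i, j). i < dim_row A \<and> j < dim_col A \<and> A $$ (i, j) \<noteq> 0} =
      Sigma {..<dim_row A} (\<lambda>i. set (filter (\<lambda>j. A $$ (i, j) \<noteq> 0) [0..<dim_col A]))"
    by auto
  then have "nnz A = (\<Sum>i<dim_row A. card (set (filter (\<lambda>j. A $$ (i, j) \<noteq> 0) [0..<dim_col A])))"
    unfolding nnz_def by (simp only:) (rule card_SigmaI, auto)
  also have "\<dots> = (\<Sum>i<dim_row A. length (filter (\<lambda>j. A $$ (i, j) \<noteq> 0) [0..<dim_col A]))"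
    by (intro sum.cong refl distinct_card) simp
  finally show ?thesis .
qed

lemma
  shows ops_sparse_mult_vec: "ops (sparse_mult_vec (Sparse A) x) = 2 * nnz A"
    and mem_sparse_mult_vec: "mem (sparse_mult_vec (Sparse A) x) \<le> dim_row A + 2"
proof -
  show "ops (sparse_mult_vec (Sparse A) x) = 2 * nnz A"
    by (simp add: build_vec_def cost_sum_up_mul nnz_eq_sum sum_distrib_left)
  show "mem (sparse_mult_vec (Sparse A) x) \<le> dim_row A + 2"
    unfolding sparse_mult_vec.simps by (intro mem_build_vec_le) (simp add: cost_sum_up_mul)
qed

text \<open>Each of at most \<open>n\<close> columns costs one sparse product and a multiplication
  and subtraction per entry. The three vectors in \<open>3 * m + 2\<close> are the old right-hand
  side, the sparse product and the updated right-hand side.\<close>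

lemma
  assumes A: "dim_row A = m" and R: "dim_col R = n" and G: "dim_row G = m"
  shows ops_reduced_rhs: "ops (reduced_rhs (Sparse A) R G Z k l) \<le> n * (2 * nnz A + m * 2)"
    and mem_reduced_rhs: "mem (reduced_rhs (Sparse A) R G Z k l) \<le> 3 * m + 2"
proof -
  define f where "f j r = do {
     w \<leftarrow> sparse_mult_vec (Sparse A) (col Z j);
     build_vec (dim_vec r) (\<lambda>i. do {
       p \<leftarrow> mul_op (R $$ (k, j)) (w $ i);
       sub_op (r $ i) p
     })
   }" for j and r :: "real vec"
  have eq: "reduced_rhs (Sparse A) R G Z k l = for_each [l..<n] f (col G k)"
    by (simp add: reduced_rhs_def R f_def[abs_def] del: sparse_mult_vec.simps)
  have dim: "dim_vec (val (f j r)) = m" if "dim_vec r = m" for j r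
    using that by (simp add: f_def)
  have dim': "dim_vec (val (sparse_mult_vec (Sparse A) x)) = m" for x by (simp add: A)
  have "ops (f j r) \<le> 2 * nnz A + m * 2" if "dim_vec r = m" for j r
    unfolding f_def comp_sel_bind ops_sparse_mult_vec that
    by (intro add_left_mono ops_build_vec_le) (simp add: arith_op_defs)
  then have "ops (reduced_rhs (Sparse A) R G Z k l) \<le> length [l..<n] * (2 * nnz A + m * 2)"
    unfolding eq by (intro for_each_ops_le[where P = "\<lambda>r. dim_vec r = m"]) (auto simp: G dim)
  also have "\<dots> \<le> n * (2 * nnz A + m * 2)" by (intro mult_right_mono) auto
  finally show "ops (reduced_rhs (Sparse A) R G Z k l) \<le> n * (2 * nnz A + m * 2)" .
  have "mem (f j r) \<le> 2 * m + 2" if "dim_vec r = m" for j r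
  proof -
    have "mem (build_vec m (\<lambda>i. do { p \<leftarrow> mul_op (R $$ (k, j)) (w $ i); sub_op (r $ i) p })) \<le> m + 2" for w
      by (intro mem_build_vec_le) (simp add: arith_op_defs)
    then show ?thesis
      unfolding f_def comp_sel_bind that using mem_sparse_mult_vec[of A "col Z j"]
      by (simp add: A dim' del: sparse_mult_vec.simps)
  qed
  then have "mem (reduced_rhs (Sparse A) R G Z k l) \<le> m + (2 * m + 2)"
    unfolding eq by (intro for_each_mem_le[where P = "\<lambda>r. dim_vec r = m"]) (auto simp: G dim)
  then show "mem (reduced_rhs (Sparse A) R G Z k l) \<le> 3 * m + 2" by simp
qed

lemma length_joint_pattern:
  assumes "M \<in> carrier_mat m m" "A \<in> carrier_mat m m"
  shows "length (joint_pattern M A) \<le> nnz M + nnz A"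
proof -
  have "distinct (joint_pattern M A)" by (simp add: joint_pattern_def distinct_product)
  then have "length (joint_pattern M A) = card (set (joint_pattern M A))" by (simp add: distinct_card)
  also have "set (joint_pattern M A) =
      {(i, j). i < dim_row M \<and> j < dim_col M \<and> M $$ (i, j) \<noteq> 0} \<union>
      {(i, j). i < dim_row A \<and> j < dim_col A \<and> A $$ (i, j) \<noteq> 0}"
    using assms by (auto simp: set_joint_pattern[of M m])
  also have "card \<dots> \<le> nnz M + nnz A" unfolding nnz_def by (rule card_Un_le)
  finally show ?thesis .
qed

text \<open>Cells count nonzero entries of the result; a computed entry may be zero and a position
  may be listed twice, so the length of the list is only an upper bound.\<close>

lemma cells_build_sparse: "cells (val (build_sparse nr nc P f)) \<le> 3 * length P"
proof -
  have "nnz (mat nr nc (\<lambda>p. if p \<in> set P then val (f p) else 0)) \<le> card (set P)"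
    unfolding nnz_def by (intro card_mono) (auto split: if_splits)
  also have "\<dots> \<le> length P" by (rule card_length)
  finally show ?thesis by simp
qed

lemma
  shows ops_assemble_i: "ops (assemble_i (Sparse M) (Sparse A) R k) \<le> length (joint_pattern M A) * 2"
    and mem_assemble_i: "mem (assemble_i (Sparse M) (Sparse A) R k) \<le> 3 * length (joint_pattern M A) + 2"
    and cells_assemble_i: "cells (val (assemble_i (Sparse M) (Sparse A) R k)) \<le> 3 * length (joint_pattern M A)"
  unfolding assemble_i.simps
  by (intro ops_build_sparse_le, simp add: arith_op_defs,
    intro mem_build_sparse_le, simp add: arith_op_defs, rule cells_build_sparse)

text \<open>Each joint position yields four entries of at most four operations, and each entry takes
  three cells. The absolute values of \<open>b1\<close> and \<open>b2\<close> are computed once: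
  they are the \<open>2\<close> in the operations and, with four numbers of work space per entry,
  the \<open>6\<close> in the storage.\<close>

lemma
  fixes M A :: "real mat"
  defines "p \<equiv> length (joint_pattern M A)"
  shows ops_assemble_ii: "ops (assemble_ii (Sparse M) (Sparse A) R k) \<le> 16 * p + 2"
    and mem_assemble_ii: "mem (assemble_ii (Sparse M) (Sparse A) R k) \<le> 12 * p + 6"
    and cells_assemble_ii: "cells (val (assemble_ii (Sparse M) (Sparse A) R k)) \<le> 12 * p"
proof -
  define P where "P = concat (map (\<lambda>(i, j).
    [(i, j), (i, j + dim_row M), (i + dim_row M, j), (i + dim_row M, j + dim_row M)]) (joint_pattern M A))"
  have "length (concat (map (\<lambda>(i, j).
      [(i, j), (i, j + a), (i + a, j), (i + a, j + a)]) xs)) = 4 * length xs" for xs and a :: nat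
    by (induction xs) auto
  then have P: "length P = 4 * p" by (simp add: P_def p_def)
  show "ops (assemble_ii (Sparse M) (Sparse A) R k) \<le> 16 * p + 2"
    unfolding assemble_ii.simps Let_def comp_sel_bind P_def[symmetric]
    by (auto simp: arith_op_defs P intro!: order_trans[OF ops_build_sparse_le[of P _ 4]])
  show "mem (assemble_ii (Sparse M) (Sparse A) R k) \<le> 12 * p + 6"
    unfolding assemble_ii.simps Let_def comp_sel_bind P_def[symmetric]
    by (auto simp: arith_op_defs P intro!: order_trans[OF mem_build_sparse_le[of P _ 4]])
  show "cells (val (assemble_ii (Sparse M) (Sparse A) R k)) \<le> 12 * p"
    using cells_build_sparse[of _ _ P] P
    unfolding assemble_ii.simps Let_def comp_sel_bind P_def[symmetric] by simp
qed

section \<open>Cost of the back substitution loop\<close>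

locale bartels_stewart_cost = bartels_stewart_problem +
  fixes c solve_ops solve_mem :: nat
  assumes nnz: "nnz M \<le> c * m" "nnz A \<le> c * m"
    and solve_cost: "\<And>S b. \<lbrakk>S \<in> systems_i M A R \<union> systems_ii M A R; b \<in> carrier_vec (dim_row S)\<rbrakk> \<Longrightarrow>
      ops (solve (Sparse S) b) \<le> solve_ops \<and> mem (solve (Sparse S) b) \<le> solve_mem"
begin

definition "rhs_ops = n * (2 * (c * m) + 2 * m)"
text \<open>Read off from a double step: two reduced right-hand sides, one solve, assembly from at
  most \<open>2 * (c * m)\<close> joint positions, scaling of \<open>2 * m\<close> entries, negation
  of \<open>m\<close> entries, and twice two absolute values. A single step costs less.\<close>

definition "step_ops = 2 * rhs_ops + solve_ops + 32 * (c * m) + 3 * m + 4"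
text \<open>\<open>m * n\<close> is the updated copy of \<open>Z\<close>. The other terms bound the
  vectors, the assembled matrix and the solver, with slack so that both kinds of step fit.\<close>

definition "step_mem = m * n + solve_mem + 48 * (c * m) + 12 * m + 12"

lemma reduced_rhs_cost:
  assumes G: "G \<in> carrier_mat m n"
  shows "ops (reduced_rhs (Sparse A) R G Z k l) \<le> rhs_ops"
    "mem (reduced_rhs (Sparse A) R G Z k l) \<le> 3 * m + 2"
proof -
  have dims: "dim_row A = m" "dim_col R = n" "dim_row G = m" using A R G by auto
  have "ops (reduced_rhs (Sparse A) R G Z k l) \<le> n * (2 * nnz A + m * 2)"
    by (rule ops_reduced_rhs[OF dims])
  also have "\<dots> \<le> rhs_ops"
    unfolding rhs_ops_def using nnz(2) by (intro mult_left_mono) auto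
  finally show "ops (reduced_rhs (Sparse A) R G Z k l) \<le> rhs_ops" .
  show "mem (reduced_rhs (Sparse A) R G Z k l) \<le> 3 * m + 2" by (rule mem_reduced_rhs[OF dims])
qed

lemma length_joint_pattern_le: "length (joint_pattern M A) \<le> 2 * (c * m)"
  using length_joint_pattern[OF M(2) A(2)] nnz by simp

lemma step_i_cost:
  assumes G: "G \<in> carrier_mat m n" and Z: "Z \<in> carrier_mat m n"
    and k: "visited R (Suc k)" "starts_single R k"
  shows "ops (step_i solve (Sparse M) (Sparse A) R G k Z) \<le> step_ops"
    "mem (step_i solve (Sparse M) (Sparse A) R G k Z) \<le> step_mem"
proof -
  have kn: "k < n" using visited_le[OF k(1)] R by auto
  define b where "b = reduced_rhs (Sparse A) R G Z k (Suc k)"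
  define S where "S = assemble_i (Sparse M) (Sparse A) R k"
  define p where "p = length (joint_pattern M A)"
  have b: "val b \<in> carrier_vec m"
    unfolding b_def using A R G Z kn by (subst val_reduced_rhs[of _ m _ n]) auto
  have S: "val S = Sparse (system_i M A R k)" unfolding S_def by (rule val_assemble_i[OF M(2) A(2)])
  have z: "val (solve (val S) (val b)) \<in> carrier_vec m" unfolding S by (rule solve_system_i[OF k b])
  have "system_i M A R k \<in> systems_i M A R" using k by (auto simp: systems_i_def)
  then have solve: "ops (solve (val S) (val b)) \<le> solve_ops" "mem (solve (val S) (val b)) \<le> solve_mem"
    using solve_cost[of "system_i M A R k" "val b"] b carrier_matD[OF system_i_carrier] by (auto simp: S)
  note costs = reduced_rhs_cost[OF G, of Z k "Suc k", folded b_def]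
    ops_assemble_i[of M A R k, folded S_def p_def] mem_assemble_i[of M A R k, folded S_def p_def]
    cells_assemble_i[of M A R k, folded S_def p_def] length_joint_pattern_le[folded p_def]
  have eq: "step_i solve (Sparse M) (Sparse A) R G k Z =
      do { b' \<leftarrow> b; S' \<leftarrow> S; z \<leftarrow> solve S' b'; ret (set_col Z k z) }"
    by (simp only: step_i_def b_def S_def)
  show "ops (step_i solve (Sparse M) (Sparse A) R G k Z) \<le> step_ops"
    using costs solve(1) unfolding eq step_ops_def comp_sel_bind comp_sel_ret by linarith
  show "mem (step_i solve (Sparse M) (Sparse A) R G k Z) \<le> step_mem"
    using costs solve(2) b z Z
    unfolding eq step_mem_def comp_sel_bind comp_sel_ret nat_add_max_right max.bounded_iff cells_simps dim_set_col
    by (intro conjI; simp)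
qed

lemma step_ii_cost:
  assumes G: "G \<in> carrier_mat m n" and Z: "Z \<in> carrier_mat m n"
    and k: "visited R (Suc k)" "\<not> starts_single R k"
  shows "ops (step_ii solve (Sparse M) (Sparse A) R G k Z) \<le> step_ops"
    "mem (step_ii solve (Sparse M) (Sparse A) R G k Z) \<le> step_mem"
proof -
  have kn: "k < n" using visited_le[OF k(1)] R by auto
  define r1 where "r1 = reduced_rhs (Sparse A) R G Z (k - 1) (Suc k)"
  define r2 where "r2 = reduced_rhs (Sparse A) R G Z k (Suc k)"
  define S where "S = assemble_ii (Sparse M) (Sparse A) R k"
  define p where "p = length (joint_pattern M A)"
  define b where "b x1 x2 c1 c2 = build_vec (2 * m)
    (\<lambda>i. if i < m then mul_op c2 (x1 $ i) else mul_op c1 (x2 $ (i - m)))" for x1 x2 c1 c2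
  define z where "z y = build_vec m (\<lambda>i. neg_op (y $ (i + m)))" for y
  have r: "val r1 \<in> carrier_vec m" "val r2 \<in> carrier_vec m"
    unfolding r1_def r2_def using A R G Z kn by (simp_all add: val_reduced_rhs[of _ m _ n])
  have b: "val (b x1 x2 c1 c2) \<in> carrier_vec (2 * m)" "ops (b x1 x2 c1 c2) \<le> 2 * m * 1"
    "mem (b x1 x2 c1 c2) \<le> 2 * m + 1" for x1 x2 c1 c2
    unfolding b_def
    by (simp, (rule ops_build_vec_le; simp add: mul_op_def), (rule mem_build_vec_le; simp add: mul_op_def))
  have zc: "dim_vec (val (z y)) = m" "ops (z y) \<le> m * 1" "mem (z y) \<le> m + 1" for y
    unfolding z_def
    by (simp, (rule ops_build_vec_le; simp add: neg_op_def), (rule mem_build_vec_le; simp add: neg_op_def))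
  have S: "val S = Sparse (system_ii M A R k)" unfolding S_def by (rule val_assemble_ii[OF M(2) A(2)])
  have y: "dim_vec (val (solve (val S) (val (b x1 x2 c1 c2)))) = 2 * m" for x1 x2 c1 c2
    unfolding S using solve_system_ii(1)[OF k b(1)] by simp
  have "system_ii M A R k \<in> systems_ii M A R" using k by (auto simp: systems_ii_def)
  then have solve: "ops (solve (val S) (val (b x1 x2 c1 c2))) \<le> solve_ops"
    "mem (solve (val S) (val (b x1 x2 c1 c2))) \<le> solve_mem" for x1 x2 c1 c2
    using solve_cost[of "system_ii M A R k" "val (b x1 x2 c1 c2)"] b(1) carrier_matD[OF system_ii_carrier]
    by (auto simp: S)
  note costs = reduced_rhs_cost[OF G, of Z "k - 1" "Suc k", folded r1_def]
    reduced_rhs_cost[OF G, of Z k "Suc k", folded r2_def]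
    ops_assemble_ii[of M A R k, folded S_def p_def] mem_assemble_ii[of M A R k, folded S_def p_def]
    cells_assemble_ii[of M A R k, folded S_def p_def] length_joint_pattern_le[folded p_def]
  have eq: "step_ii solve (Sparse M) (Sparse A) R G k Z = do {
      x1 \<leftarrow> r1;
      x2 \<leftarrow> r2;
      c1 \<leftarrow> abs_op (R $$ (k - 1, k));
      c2 \<leftarrow> abs_op (R $$ (k, k - 1));
      b' \<leftarrow> b x1 x2 c1 c2;
      S' \<leftarrow> S;
      y \<leftarrow> solve S' b';
      z' \<leftarrow> z y;
      ret (set_col (set_col Z (k - 1) (vec_first y m)) k z')
    }"
  proof -
    have "dim_row G = m" using G by simp
    then show ?thesis
      unfolding step_ii_def Let_def b_def z_def r1_def r2_def S_def by (simp only:)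
  qed
  let ?c1 = "\<bar>R $$ (k - 1, k)\<bar>" and ?c2 = "\<bar>R $$ (k, k - 1)\<bar>"
  let ?y = "val (solve (val S) (val (b (val r1) (val r2) ?c1 ?c2)))"
  have abs: "abs_op x = Comp \<bar>x\<bar> 1 1" for x by (simp add: abs_op_def)
  show "ops (step_ii solve (Sparse M) (Sparse A) R G k Z) \<le> step_ops"
    using costs solve(1)[of "val r1" "val r2" ?c1 ?c2] b(2)[of "val r1" "val r2" ?c1 ?c2] zc(2)[of ?y]
    unfolding eq step_ops_def comp_sel_bind comp_sel_ret abs comp.sel by linarith
  show "mem (step_ii solve (Sparse M) (Sparse A) R G k Z) \<le> step_mem"
    using costs solve(2)[of "val r1" "val r2" ?c1 ?c2] b(3)[of "val r1" "val r2" ?c1 ?c2] zc(3)[of ?y]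
    unfolding eq step_mem_def comp_sel_bind comp_sel_ret abs comp.sel nat_add_max_right max.bounded_iff cells_simps
      dim_set_col r[THEN carrier_vecD] b(1)[THEN carrier_vecD] y zc(1) carrier_matD[OF Z]
    by (intro conjI) linarith+
qed

text \<open>A double step lowers \<open>v\<close> by two but pays for one step, so
  \<open>v * step_ops\<close> suffices. The extra \<open>m * n\<close> is the old \<open>Z\<close>,
  which \<open>replace\<close> keeps until the step is finished.\<close>

lemma back_substitution_cost:
  assumes G: "G \<in> carrier_mat m n" and "Z \<in> carrier_mat m n" "visited R v"
  shows "ops (back_substitution solve (Sparse M) (Sparse A) R G v Z) \<le> v * step_ops \<and>
    mem (back_substitution solve (Sparse M) (Sparse A) R G v Z) \<le> m * n + step_mem"
  using assms(2-)
proof (induction v arbitrary: Z rule: less_induct)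
  case (less v)
  show ?case
  proof (cases v)
    case 0
    then show ?thesis using less.prems by (simp add: step_mem_def)
  next
    case (Suc k)
    have v: "visited R (Suc k)" using less.prems Suc by simp
    show ?thesis
    proof (cases "starts_single R k")
      case True
      show ?thesis
        using less.IH[of k, OF _ step_i(1)[OF G less.prems(1) v True] visited.single[OF v True]]
          step_i_cost[OF G less.prems(1) v True] Suc True less.prems(1) by simp
    next
      case False
      let ?Z = "val (step_ii solve (Sparse M) (Sparse A) R G k Z)"
      have IH: "ops (back_substitution solve (Sparse M) (Sparse A) R G (k - 1) ?Z) \<le> (k - 1) * step_ops"
        "mem (back_substitution solve (Sparse M) (Sparse A) R G (k - 1) ?Z) \<le> m * n + step_mem"
        using less.IH[of "k - 1", OF _ step_ii(1)[OF G less.prems(1) v False] visited.double[OF v False]]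
          Suc by auto
      have "ops (back_substitution solve (Sparse M) (Sparse A) R G (k - 1) ?Z) \<le> k * step_ops"
        by (rule order_trans[OF IH(1)]) (intro mult_right_mono, auto)
      then show ?thesis
        using IH(2) step_ii_cost[OF G less.prems(1) v False] Suc False less.prems(1) by simp
    qed
  qed
qed

end

section \<open>Total operations and storage\<close>

context bartels_stewart_cost
begin

lemma
  assumes F: "F \<in> carrier_vec (n * m)"
  shows ops_bartels_stewart: "ops (bartels_stewart schur_alg solve At Mt m (Sparse M) (Sparse A) F) \<le>
      16 * n ^ 3 + (36 * c + 23) * (m * n ^ 2) + ops (schur_alg X) + n * solve_ops"
    and mem_bartels_stewart: "bartels_stewart_memory schur_alg solve At Mt m (Sparse M) (Sparse A) F \<le>
      29 * n ^ 2 + (54 * c + 23) * (m * n) + mem (schur_alg X) + solve_mem"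
proof -
  define L where "L = val (cholesky At)"
  define Fh where "Fh = unstack_cols m n F"
  define Y where "Y = inv_At * transpose_mat Fh"
  define G where "G = transpose_mat Y * Q"
  define Xc where "Xc = build_cols n n (\<lambda>j. cholesky_solve L (col Mt j))"
  define Yc where "Yc = build_cols n m (\<lambda>i. cholesky_solve L (row Fh i))"
  define Gc where "Gc = mat_mult (transpose_mat Y) Q"
  define Zc where "Zc = back_substitution solve (Sparse M) (Sparse A) R G n (0\<^sub>m m n)"
  define Uc where "Uc = mat_mult (val Zc) (transpose_mat Q)"
  have Fh: "Fh \<in> carrier_mat m n" by (simp add: Fh_def unstack_cols_def)
  have Y: "Y \<in> carrier_mat n m" using Fh inverse_At by (simp add: Y_def)
  have G: "G \<in> carrier_mat m n" using Y Q by (simp add: G_def)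
  have L: "L \<in> carrier_mat n n" unfolding L_def by (rule cholesky_correct(1)[OF At])
  have vals: "val Xc = X" "val Yc = Y" "val Gc = G"
    using val_X_columns val_rhs_columns[OF Fh] val_mat_mult[of "transpose_mat Y" m n Q n] Y Q
    by (simp_all add: Xc_def Yc_def Gc_def L_def Y_def G_def)
  have Z: "val Zc \<in> carrier_mat m n" unfolding Zc_def by (rule back_substitution_eq(1)[OF G])
  have U: "val Uc \<in> carrier_mat m n"
    using val_mat_mult[of "val Zc" m n "transpose_mat Q" n] Z Q by (simp add: Uc_def)
  have dims: "dim_row At = n" "dim_row L = n" "dim_row Q = n" "dim_col Q = n" "dim_row Y = n" "dim_col Y = m"
    "dim_row (val Zc) = m" "dim_col (val Zc) = n"
    using At L Q Y Z by auto
  note unfold = bartels_stewart_def Let_def comp_sel_bind comp_sel_ret dims(1) L_def[symmetric]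
    Xc_def[symmetric] vals schur_alg prod.case Fh_def[symmetric] Yc_def[symmetric] Gc_def[symmetric]
    Zc_def[symmetric] Uc_def[symmetric]
  have "visited R n" using visited.start[of R] R by simp
  then have Zcost: "ops Zc \<le> n * step_ops \<and> mem Zc \<le> m * n + step_mem"
    unfolding Zc_def by (intro back_substitution_cost[OF G]) auto
  have ops: "ops (cholesky At) \<le> n * (2 * n + 2 + n * (2 * n + 2))"
    "ops Xc \<le> n * (2 * (n * (2 * n + 2)))" "ops Yc \<le> m * (2 * (n * (2 * n + 2)))"
    "ops Gc \<le> n * (m * (2 * n))" "ops Uc \<le> n * (m * (2 * n))" "ops Zc \<le> n * step_ops"
    unfolding Xc_def Yc_def Gc_def Uc_def
    by (intro ops_cholesky ops_build_cols_le ops_cholesky_solve ops_mat_mult Zcost[THEN conjunct1];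
        simp add: dims)+
  have mems: "mem (cholesky At) \<le> 2 * (n * n) + n + 8" "mem Xc \<le> n * n + (3 * n + 5)"
    "mem Yc \<le> n * m + (3 * n + 5)" "mem Gc \<le> m * n + (m + 2)" "mem Uc \<le> m * n + (m + 2)"
    "mem Zc \<le> m * n + step_mem"
    unfolding Xc_def Yc_def Gc_def Uc_def
    by (intro mem_cholesky mem_build_cols_le mem_cholesky_solve mem_mat_mult Zcost[THEN conjunct2];
        simp add: dims)+
  \<comment> \<open>Lower-order terms are pushed into the leading ones. For the operations, 16 = 6 +
    8 + 2 collects powers of \<open>n\<close>, 36 = 4 + 32 the terms with \<open>c\<close>, and 23 =
    8 + 4 + 4 + 3 + 4 the rest. For the storage, 29 = 6 + 3 + 20, 23 = 10 + 13 and 54 = 48 + 6, the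
    6 coming from the two sparse input matrices.\<close>
  have mono: "n \<le> n * n" "n * n \<le> n * n * n" "m \<le> m * n" "m * n \<le> m * n * n" "n * n \<le> m * n * n"
    "c * m \<le> c * (m * n)" "c * (m * n) \<le> c * (m * n * n)" "1 \<le> n * n"
    using n m by auto
  have step: "n * step_ops = 4 * (c * (m * n * n)) + 4 * (m * n * n) + n * solve_ops +
      32 * (c * (m * n)) + 3 * (m * n) + 4 * n"
    by (simp add: step_ops_def rhs_ops_def algebra_simps)
  have "ops (bartels_stewart schur_alg solve At Mt m (Sparse M) (Sparse A) F) =
      ops (cholesky At) + (ops Xc + (ops (schur_alg X) + (ops Yc + (ops Gc + (ops Zc + ops Uc)))))"
    by (simp only: unfold add_0_right add_0_left)
  also have "\<dots> \<le> n * (2 * n + 2 + n * (2 * n + 2)) + (n * (2 * (n * (2 * n + 2))) + (ops (schur_alg X) +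
      (m * (2 * (n * (2 * n + 2))) + (n * (m * (2 * n)) + (n * step_ops + n * (m * (2 * n)))))))"
    using ops by (intro add_mono) auto
  also have "\<dots> = 6 * (n * n * n) + 8 * (n * n) + 2 * n + 8 * (m * n * n) + 4 * (m * n) + ops (schur_alg X) + n * step_ops"
    by (simp add: algebra_simps)
  also have "\<dots> \<le> 16 * (n * n * n) + 36 * (c * (m * n * n)) + 23 * (m * n * n) + ops (schur_alg X) + n * solve_ops"
    unfolding step using mono by linarith
  also have "\<dots> = 16 * n ^ 3 + (36 * c + 23) * (m * n ^ 2) + ops (schur_alg X) + n * solve_ops"
    by (simp add: power2_eq_square power3_eq_cube algebra_simps)
  finally show "ops (bartels_stewart schur_alg solve At Mt m (Sparse M) (Sparse A) F) \<le>
      16 * n ^ 3 + (36 * c + 23) * (m * n ^ 2) + ops (schur_alg X) + n * solve_ops" .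
  have cells: "cells L = n * n" "cells X = n * n" "cells (Q, R) = n * n + n * n"
    "cells Fh = m * n" "cells Y = n * m" "cells G = m * n" "cells (val Zc) = m * n" "cells (val Uc) = m * n"
    "cells (stack_cols (val Uc)) = m * n"
    using L X Q R Fh Y G Z U by (auto simp: stack_cols_def)
  have "mem (bartels_stewart schur_alg solve At Mt m (Sparse M) (Sparse A) F) \<le>
      4 * (n * n) + 8 * (m * n) + mem (schur_alg X) + 3 * n + m + 8 + step_mem"
    using mems
    by (simp only: unfold cells nat_add_max_right max.bounded_iff)
      (simp add: mult.commute[of n m])
  moreover have "cells At + cells Mt + cells (Sparse M) + cells (Sparse A) + cells F \<le>
      2 * (n * n) + 6 * (c * m) + m * n"
    using At Mt nnz F by (simp add: mult.commute[of n m])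
  ultimately have "bartels_stewart_memory schur_alg solve At Mt m (Sparse M) (Sparse A) F \<le>
      6 * (n * n) + 10 * (m * n) + mem (schur_alg X) + 3 * n + 13 * m + 20 + 54 * (c * m) + solve_mem"
    unfolding bartels_stewart_memory_def step_mem_def by simp
  also have "\<dots> \<le> 29 * (n * n) + 54 * (c * (m * n)) + 23 * (m * n) + mem (schur_alg X) + solve_mem"
    using mono by linarith
  also have "\<dots> = 29 * n ^ 2 + (54 * c + 23) * (m * n) + mem (schur_alg X) + solve_mem"
    by (simp add: power2_eq_square algebra_simps)
  finally show "bartels_stewart_memory schur_alg solve At Mt m (Sparse M) (Sparse A) F \<le>
      29 * n ^ 2 + (54 * c + 23) * (m * n) + mem (schur_alg X) + solve_mem" .
qed

end

theorem mainTheorem1: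
  fixes \<Omega> :: "'a::euclidean_space set" and T :: real
    and \<omega> :: "nat \<Rightarrow> 'a element list" and m :: "nat \<Rightarrow> nat"
    and \<psi> :: "nat \<Rightarrow> nat \<Rightarrow> 'a \<Rightarrow> real"
    and schur :: "real mat \<Rightarrow> (real mat \<times> real mat) comp"
    and solve :: "nat \<Rightarrow> spatial_solver"
    and C_C C_S :: "nat \<Rightarrow> real"
  defines "Mx \<equiv> \<lambda>\<nu>. mass_x \<Omega> (m \<nu>) (\<psi> \<nu>)"
    and "Ax \<equiv> \<lambda>\<nu>. stiff_x \<Omega> (m \<nu>) (\<psi> \<nu>)"
    and "Mt \<equiv> mass_t T"
    and "At \<equiv> stiff_t T"
    and "F \<equiv> \<lambda>\<nu> N t f. rhs_vec \<Omega> (\<omega> \<nu>) (m \<nu>) (\<psi> \<nu>) T N t f"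
    and "R \<equiv> \<lambda>N t. snd (val (schur (inv_stiff_mass_t T N t)))"
  assumes T: "0 < T"
    and domain: "admissible_domain \<Omega>"
    and meshes: "shape_regular_sequence \<Omega> \<omega>"
    and basis: "\<And>\<nu>. nodal_basis \<Omega> (\<omega> \<nu>) (m \<nu>) (\<psi> \<nu>)"
    and spd_x: "\<And>\<nu>. spd (Mx \<nu>) \<and> spd (Ax \<nu>)"
    and sparse_x: "\<exists>c::nat. \<forall>\<nu>. nnz (Mx \<nu>) \<le> c * m \<nu> \<and> nnz (Ax \<nu>) \<le> c * m \<nu>"
    and definite_t: "\<And>N t. time_mesh T N t \<Longrightarrow> spd (At N t) \<and> positive_definite (Mt N t)"
    and schur_correct: "\<And>N t. time_mesh T N t \<Longrightarrow>
      real_schur (inv_stiff_mass_t T N t) (val (schur (inv_stiff_mass_t T N t)))"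
    and solve_correct: "\<And>\<nu> N t S b.
      \<lbrakk>time_mesh T N t;
       S \<in> systems_i (Mx \<nu>) (Ax \<nu>) (R N t) \<union> systems_ii (Mx \<nu>) (Ax \<nu>) (R N t);
       uniquely_solvable S; b \<in> carrier_vec (dim_row S)\<rbrakk> \<Longrightarrow>
      val (solve \<nu> (Sparse S) b) \<in> carrier_vec (dim_col S) \<and> S *\<^sub>v val (solve \<nu> (Sparse S) b) = b"
    and cost_functions: "\<And>n. 0 \<le> C_C n \<and> 0 \<le> C_S n"
  shows
    "(\<forall>\<nu> N t f. time_mesh T N t \<and> l2 (\<Omega> \<times> {0<..<T}) f \<longrightarrow>
       (\<forall>S \<in> systems_i (Mx \<nu>) (Ax \<nu>) (R N t). spd S) \<and>
       (\<forall>S \<in> systems_ii (Mx \<nu>) (Ax \<nu>) (R N t).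
          symmetric_matrix S \<and> indefinite S \<and> uniquely_solvable S) \<and>
       (\<exists>u. val (bartels_stewart schur (solve \<nu>) (At N t) (Mt N t) (m \<nu>)
              (Sparse (Mx \<nu>)) (Sparse (Ax \<nu>)) (F \<nu> N t f)) = u \<and>
          u \<in> carrier_vec (N * m \<nu>) \<and>
          (\<forall>v \<in> carrier_vec (N * m \<nu>).
             (At N t \<otimes>\<^sub>K Mx \<nu> + Mt N t \<otimes>\<^sub>K Ax \<nu>) *\<^sub>v v = F \<nu> N t f \<longleftrightarrow> v = u)))
     \<and>
     ((\<exists>c::real. \<forall>N t. time_mesh T N t \<longrightarrow>
          real (ops (schur (inv_stiff_mass_t T N t))) \<le> c * real N ^ 3 \<and>
          real (mem (schur (inv_stiff_mass_t T N t))) \<le> c * real N ^ 2) \<longrightarrow>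
      (\<exists>c::real. \<forall>\<nu> N t S b. time_mesh T N t \<and>
          S \<in> systems_i (Mx \<nu>) (Ax \<nu>) (R N t) \<union> systems_ii (Mx \<nu>) (Ax \<nu>) (R N t) \<and>
          b \<in> carrier_vec (dim_row S) \<longrightarrow>
          real (ops (solve \<nu> (Sparse S) b)) \<le> c * C_C (m \<nu>) \<and>
          real (mem (solve \<nu> (Sparse S) b)) \<le> c * C_S (m \<nu>)) \<longrightarrow>
      (\<exists>K::real. \<forall>\<nu> N t f. time_mesh T N t \<and> l2 (\<Omega> \<times> {0<..<T}) f \<longrightarrow>
          real (ops (bartels_stewart schur (solve \<nu>) (At N t) (Mt N t) (m \<nu>)
              (Sparse (Mx \<nu>)) (Sparse (Ax \<nu>)) (F \<nu> N t f)))
            \<le> K * (real N ^ 3 + real (m \<nu>) * real N ^ 2 + C_C (m \<nu>) * real N) \<and>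
          real (bartels_stewart_memory schur (solve \<nu>) (At N t) (Mt N t) (m \<nu>)
              (Sparse (Mx \<nu>)) (Sparse (Ax \<nu>)) (F \<nu> N t f))
            \<le> K * (real N ^ 2 + real (m \<nu>) * real N + C_S (m \<nu>))))"
proof (intro conjI impI)
  have problem: "bartels_stewart_problem N (At N t) (Mt N t) (inv_stiff_mass_t T N t)
      (fst (val (schur (inv_stiff_mass_t T N t)))) (R N t) (m \<nu>) (Mx \<nu>) (Ax \<nu>) (solve \<nu>) schur"
    if t: "time_mesh T N t" for \<nu> N t
  proof
    show "0 < N" using t by (simp add: time_mesh_def)
    show "At N t \<in> carrier_mat N N" "Mt N t \<in> carrier_mat N N"
      by (simp_all add: At_def Mt_def stiff_t_def mass_t_def)
    show "spd (At N t)" "positive_definite (Mt N t)" using definite_t[OF t] by auto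
    show "inv_stiff_mass_t T N t = the (mat_inverse (At N t)) * Mt N t"
      by (simp add: inv_stiff_mass_t_def At_def Mt_def)
    show "real_schur (inv_stiff_mass_t T N t) (fst (val (schur (inv_stiff_mass_t T N t))), R N t)"
      using schur_correct[OF t] by (simp add: R_def)
    show "0 < m \<nu>" using basis[of \<nu>] by (simp add: nodal_basis_def)
    show "spd (Mx \<nu>)" "spd (Ax \<nu>)" using spd_x by auto
    show "Mx \<nu> \<in> carrier_mat (m \<nu>) (m \<nu>)" "Ax \<nu> \<in> carrier_mat (m \<nu>) (m \<nu>)"
      by (simp_all add: Mx_def Ax_def mass_x_def stiff_x_def)
    show "val (schur (inv_stiff_mass_t T N t)) = (fst (val (schur (inv_stiff_mass_t T N t))), R N t)"
      by (simp add: R_def)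
  qed (rule solve_correct[OF t])
  have F: "F \<nu> N t f \<in> carrier_vec (N * m \<nu>)" for \<nu> N t f
    by (simp add: F_def rhs_vec_def)
  show "\<forall>\<nu> N t f. time_mesh T N t \<and> l2 (\<Omega> \<times> {0<..<T}) f \<longrightarrow>
       (\<forall>S \<in> systems_i (Mx \<nu>) (Ax \<nu>) (R N t). spd S) \<and>
       (\<forall>S \<in> systems_ii (Mx \<nu>) (Ax \<nu>) (R N t).
          symmetric_matrix S \<and> indefinite S \<and> uniquely_solvable S) \<and>
       (\<exists>u. val (bartels_stewart schur (solve \<nu>) (At N t) (Mt N t) (m \<nu>)
              (Sparse (Mx \<nu>)) (Sparse (Ax \<nu>)) (F \<nu> N t f)) = u \<and>
          u \<in> carrier_vec (N * m \<nu>) \<and>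
          (\<forall>v \<in> carrier_vec (N * m \<nu>).
             (At N t \<otimes>\<^sub>K Mx \<nu> + Mt N t \<otimes>\<^sub>K Ax \<nu>) *\<^sub>v v = F \<nu> N t f \<longleftrightarrow> v = u))"
  proof (intro allI impI, elim conjE)
    fix \<nu> N t f assume t: "time_mesh T N t"
    interpret bartels_stewart_problem N "At N t" "Mt N t" "inv_stiff_mass_t T N t"
      "fst (val (schur (inv_stiff_mass_t T N t)))" "R N t" "m \<nu>" "Mx \<nu>" "Ax \<nu>" "solve \<nu>" schur
      by (rule problem[OF t])
    show "(\<forall>S \<in> systems_i (Mx \<nu>) (Ax \<nu>) (R N t). spd S) \<and>
       (\<forall>S \<in> systems_ii (Mx \<nu>) (Ax \<nu>) (R N t).
          symmetric_matrix S \<and> indefinite S \<and> uniquely_solvable S) \<and>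
       (\<exists>u. val (bartels_stewart schur (solve \<nu>) (At N t) (Mt N t) (m \<nu>)
              (Sparse (Mx \<nu>)) (Sparse (Ax \<nu>)) (F \<nu> N t f)) = u \<and>
          u \<in> carrier_vec (N * m \<nu>) \<and>
          (\<forall>v \<in> carrier_vec (N * m \<nu>).
             (At N t \<otimes>\<^sub>K Mx \<nu> + Mt N t \<otimes>\<^sub>K Ax \<nu>) *\<^sub>v v = F \<nu> N t f \<longleftrightarrow> v = u))"
      using spd_system_i[OF M A] system_ii[OF M A m] bartels_stewart_correct(1)[OF F]
        bartels_stewart_unique[OF F]
      by (auto simp: systems_i_def systems_ii_def)
  qed
  assume "\<exists>c::real. \<forall>N t. time_mesh T N t \<longrightarrow>
          real (ops (schur (inv_stiff_mass_t T N t))) \<le> c * real N ^ 3 \<and>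
          real (mem (schur (inv_stiff_mass_t T N t))) \<le> c * real N ^ 2"
    and "\<exists>c::real. \<forall>\<nu> N t S b. time_mesh T N t \<and>
          S \<in> systems_i (Mx \<nu>) (Ax \<nu>) (R N t) \<union> systems_ii (Mx \<nu>) (Ax \<nu>) (R N t) \<and>
          b \<in> carrier_vec (dim_row S) \<longrightarrow>
          real (ops (solve \<nu> (Sparse S) b)) \<le> c * C_C (m \<nu>) \<and>
          real (mem (solve \<nu> (Sparse S) b)) \<le> c * C_S (m \<nu>)"
  then obtain c1 c2 :: real where
    c1: "\<And>N t. time_mesh T N t \<Longrightarrow> real (ops (schur (inv_stiff_mass_t T N t))) \<le> c1 * real N ^ 3"
      "\<And>N t. time_mesh T N t \<Longrightarrow> real (mem (schur (inv_stiff_mass_t T N t))) \<le> c1 * real N ^ 2"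
    and c2: "\<And>\<nu> N t S b. time_mesh T N t \<Longrightarrow>
          S \<in> systems_i (Mx \<nu>) (Ax \<nu>) (R N t) \<union> systems_ii (Mx \<nu>) (Ax \<nu>) (R N t) \<Longrightarrow>
          b \<in> carrier_vec (dim_row S) \<Longrightarrow>
          real (ops (solve \<nu> (Sparse S) b)) \<le> c2 * C_C (m \<nu>) \<and>
          real (mem (solve \<nu> (Sparse S) b)) \<le> c2 * C_S (m \<nu>)" by metis
  obtain c :: nat where c: "\<And>\<nu>. nnz (Mx \<nu>) \<le> c * m \<nu>" "\<And>\<nu>. nnz (Ax \<nu>) \<le> c * m \<nu>"
    using sparse_x by auto
  \<comment> \<open>Dominates every coefficient in both bounds at once, with 52 = 29 + 23. It is
    uniform in the meshes because \<open>c\<close>, \<open>c1\<close> and \<open>c2\<close> were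
    fixed before any mesh.\<close>
  define K where "K = 54 * real c + 52 + \<bar>c1\<bar> + \<bar>c2\<bar>"
  show "\<exists>K::real. \<forall>\<nu> N t f. time_mesh T N t \<and> l2 (\<Omega> \<times> {0<..<T}) f \<longrightarrow>
          real (ops (bartels_stewart schur (solve \<nu>) (At N t) (Mt N t) (m \<nu>)
              (Sparse (Mx \<nu>)) (Sparse (Ax \<nu>)) (F \<nu> N t f)))
            \<le> K * (real N ^ 3 + real (m \<nu>) * real N ^ 2 + C_C (m \<nu>) * real N) \<and>
          real (bartels_stewart_memory schur (solve \<nu>) (At N t) (Mt N t) (m \<nu>)
              (Sparse (Mx \<nu>)) (Sparse (Ax \<nu>)) (F \<nu> N t f))
            \<le> K * (real N ^ 2 + real (m \<nu>) * real N + C_S (m \<nu>))"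
  proof (rule exI[of _ K], intro allI impI, elim conjE)
    fix \<nu> N t f assume t: "time_mesh T N t"
    \<comment> \<open>The cost locale takes natural bounds. Counts are integers, so rounding down
      loses nothing; the absolute value keeps the product nonnegative when \<open>c2\<close> is
      negative.\<close>
    define so where "so = nat \<lfloor>\<bar>c2\<bar> * C_C (m \<nu>)\<rfloor>"
    define sm where "sm = nat \<lfloor>\<bar>c2\<bar> * C_S (m \<nu>)\<rfloor>"
    have C: "0 \<le> C_C (m \<nu>)" "0 \<le> C_S (m \<nu>)" using cost_functions by auto
    interpret bartels_stewart_problem N "At N t" "Mt N t" "inv_stiff_mass_t T N t"
      "fst (val (schur (inv_stiff_mass_t T N t)))" "R N t" "m \<nu>" "Mx \<nu>" "Ax \<nu>" "solve \<nu>" schur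
      by (rule problem[OF t])
    interpret bartels_stewart_cost N "At N t" "Mt N t" "inv_stiff_mass_t T N t"
      "fst (val (schur (inv_stiff_mass_t T N t)))" "R N t" "m \<nu>" "Mx \<nu>" "Ax \<nu>" "solve \<nu>" schur
      c so sm
    proof
      fix S :: "real mat" and b :: "real vec"
      assume Sb: "S \<in> systems_i (Mx \<nu>) (Ax \<nu>) (R N t) \<union> systems_ii (Mx \<nu>) (Ax \<nu>) (R N t)"
        "b \<in> carrier_vec (dim_row S)"
      have "c2 * C_C (m \<nu>) \<le> \<bar>c2\<bar> * C_C (m \<nu>)" "c2 * C_S (m \<nu>) \<le> \<bar>c2\<bar> * C_S (m \<nu>)"
        using C by (auto intro!: mult_right_mono)
      then show "ops (solve \<nu> (Sparse S) b) \<le> so \<and> mem (solve \<nu> (Sparse S) b) \<le> sm"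
        using c2[OF t Sb] unfolding so_def sm_def by (auto intro!: le_nat_floor)
    qed (use c in auto)
    have so: "real so \<le> \<bar>c2\<bar> * C_C (m \<nu>)" "real sm \<le> \<bar>c2\<bar> * C_S (m \<nu>)"
      using C by (auto simp: so_def sm_def)
    have sch: "real (ops (schur (inv_stiff_mass_t T N t))) \<le> \<bar>c1\<bar> * real N ^ 3"
      "real (mem (schur (inv_stiff_mass_t T N t))) \<le> \<bar>c1\<bar> * real N ^ 2"
      by (rule order_trans[OF c1(1)[OF t]], simp add: mult_right_mono,
        rule order_trans[OF c1(2)[OF t]], simp add: mult_right_mono)
    show "real (ops (bartels_stewart schur (solve \<nu>) (At N t) (Mt N t) (m \<nu>)
              (Sparse (Mx \<nu>)) (Sparse (Ax \<nu>)) (F \<nu> N t f)))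
            \<le> K * (real N ^ 3 + real (m \<nu>) * real N ^ 2 + C_C (m \<nu>) * real N) \<and>
          real (bartels_stewart_memory schur (solve \<nu>) (At N t) (Mt N t) (m \<nu>)
              (Sparse (Mx \<nu>)) (Sparse (Ax \<nu>)) (F \<nu> N t f))
            \<le> K * (real N ^ 2 + real (m \<nu>) * real N + C_S (m \<nu>))"
    proof
      let ?B = "bartels_stewart schur (solve \<nu>) (At N t) (Mt N t) (m \<nu>)
        (Sparse (Mx \<nu>)) (Sparse (Ax \<nu>)) (F \<nu> N t f)"
      have "real (ops ?B) \<le> 16 * real N ^ 3 + (36 * real c + 23) * (real (m \<nu>) * real N ^ 2) +
          real (ops (schur (inv_stiff_mass_t T N t))) + real N * real so"
        using of_nat_mono[OF ops_bartels_stewart[OF F], where ?'a = real] by simp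
      also have "\<dots> \<le> 16 * real N ^ 3 + (36 * real c + 23) * (real (m \<nu>) * real N ^ 2) +
          \<bar>c1\<bar> * real N ^ 3 + real N * (\<bar>c2\<bar> * C_C (m \<nu>))"
        using sch so by (intro add_mono mult_left_mono) auto
      also have "\<dots> = (16 + \<bar>c1\<bar>) * real N ^ 3 + (36 * real c + 23) * (real (m \<nu>) * real N ^ 2) +
          \<bar>c2\<bar> * (C_C (m \<nu>) * real N)" by (simp add: algebra_simps)
      also have "\<dots> \<le> K * real N ^ 3 + K * (real (m \<nu>) * real N ^ 2) + K * (C_C (m \<nu>) * real N)"
        using C by (intro add_mono mult_right_mono) (auto simp: K_def)
      finally show "real (ops ?B) \<le> K * (real N ^ 3 + real (m \<nu>) * real N ^ 2 + C_C (m \<nu>) * real N)"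
        by (simp add: distrib_left)
      let ?memory = "bartels_stewart_memory schur (solve \<nu>) (At N t) (Mt N t) (m \<nu>)
        (Sparse (Mx \<nu>)) (Sparse (Ax \<nu>)) (F \<nu> N t f)"
      have "real ?memory \<le> 29 * real N ^ 2 + (54 * real c + 23) * (real (m \<nu>) * real N) +
          real (mem (schur (inv_stiff_mass_t T N t))) + real sm"
        using of_nat_mono[OF mem_bartels_stewart[OF F], where ?'a = real] by simp
      also have "\<dots> \<le> 29 * real N ^ 2 + (54 * real c + 23) * (real (m \<nu>) * real N) +
          \<bar>c1\<bar> * real N ^ 2 + \<bar>c2\<bar> * C_S (m \<nu>)"
        using sch so by (intro add_mono) auto
      also have "\<dots> = (29 + \<bar>c1\<bar>) * real N ^ 2 + (54 * real c + 23) * (real (m \<nu>) * real N) + \<bar>c2\<bar> * C_S (m \<nu>)"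
        by (simp add: algebra_simps)
      also have "\<dots> \<le> K * real N ^ 2 + K * (real (m \<nu>) * real N) + K * C_S (m \<nu>)"
        using C by (intro add_mono mult_right_mono) (auto simp: K_def)
      finally show "real ?memory \<le> K * (real N ^ 2 + real (m \<nu>) * real N + C_S (m \<nu>))"
        by (simp add: distrib_left)
    qed
  qed
qed

end
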